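(* Let $K\le\lambda\in\rho(\mathbf L_0)\cup\rho(\mathbf L_\infty)$. Then $\lambda$ is a double eigenvalue (eigenvalue of multiplicity two) for a single self-adjoint extension $\mathbf L(\theta)$ where $\theta\in\mathcal M$. Likewise, $\lambda$ is a double eigenvalue for a single self-adjoint extension $\widetilde{\mathbf L}(\vartheta)$ where $\vartheta=-\theta^{-1}\in\mathcal M$. In particular, $\theta$ and $\vartheta$ must be real, have non-zero off-diagonal entries and be invertible.
   Context: Setting. Let $-\infty\le a<b\le\infty$, let $p,w>0$ a.e. and $q$ real-valued a.e. on $(a,b)$ with $1/p,q,w\in L^1_{\rm loc}((a,b),dx)$, and put $\ell[f]=-\frac1w\big((pf')'+qf\big)$, acting in $L^2[(a,b),w]$ with $\langle f,g\rangle=\int_a^b f\overline g\,w\,dx$. Let $\mathcal D_{\max}=\{f: f,pf'\in AC_{\rm loc}(a,b),\ f,\ell[f]\in L^2[(a,b),w]\}$ and $[f,g](x)=p(x)\big(f(x)\overline{g'(x)}-f'(x)\overline{g(x)}\big)$; for $f,g\in\mathcal D_{\max}$ the limits at the endpoints exist. Let $\mathcal D_{\min}=\{f\in\mathcal D_{\max}:[f,g](b)-[f,g](a)=0\ \forall g\in\mathcal D_{\max}\}$, and let $\mathbf L_{\max},\mathbf L_{\min}$ be $\ell$ with domains $\mathcal D_{\max},\mathcal D_{\min}$. Standing assumptions: both endpoints are limit-circle, and $\mathbf L_{\min}$ is semi-bounded from below with lower bound $K\in\mathbb R$: $\langle\mathbf L_{\min}f,f\rangle\ge K\langle f,f\rangle$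 (so the endpoints are non-oscillating). Quasi-derivatives. Fix $\lambda_0\in\mathbb R$. A real solution $u$ of $(\ell-\lambda_0)y=0$ is principal (non-principal) at an endpoint if $1/(pu^2)$ is not integrable (is integrable) there. Let $u_a,v_a$ (resp. $u_b,v_b$) be real principal and non-principal solutions of $(\ell-\lambda_0)y=0$ at $a$ (resp. $b$) with $[u_a,v_a](a)=1$, $[u_b,v_b](b)=1$. For $f\in\mathcal D_{\max}$: $f^{[0]}(a)=[f,v_a](a)$, $f^{[1]}(a)=-[f,u_a](a)$, $f^{[0]}(b)=[f,v_b](b)$, $f^{[1]}(b)=-[f,u_b](b)$. Extensions. $\Gamma_0f=(f^{[0]}(a),f^{[0]}(b))^T$, $\Gamma_1f=(f^{[1]}(a),-f^{[1]}(b))^T$, $\Gamma_0'=-\Gamma_1$, $\Gamma_1'=\Gamma_0$. $\mathbf L_0$ and $\mathbf L_\infty$ are the restrictions of $\mathbf L_{\max}$ to $\ker\Gamma_0$ and $\ker\Gamma_1$. $\mathcal M$ is the set of Hermitian $2\times2$ matrices. For $\theta\in\mathcal M$, $\mathbf L(\theta)$ is the restriction of $\mathbf L_{\max}$ to $\{f\in\mathcal D_{\max}:\theta\Gamma_0f=\Gamma_1f\}$; for $\vartheta\in\mathcal M$, $\widetilde{\mathbf L}(\vartheta)$ is the restriction of $\mathbf L_{\max}$ to $\{f\in\mathcal D_{\max}:\vartheta\Gamma_0'f=\Gamma_1'f\}$. $\rho$ denotes the resolvent set.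
   Formalization: The claim fails on the union of resolvent sets, so it is split: a unique θ exists if λ ∈ ρ(L_0), a unique ϑ exists if λ ∈ ρ(L_∞); invertibility and ϑ = −θ^{-1} are asserted only when both exist, which covers the intersection. *)

theory Defs
  imports "HOL-Analysis.Analysis" "HOL-Library.Function_Algebras"
begin

definition ac_on :: "real \<Rightarrow> real \<Rightarrow> (real \<Rightarrow> complex) \<Rightarrow> bool" where
  "ac_on c d f \<longleftrightarrow>
     (\<forall>\<epsilon>>0. \<exists>\<delta>>0. \<forall>(n::nat) (s::nat \<Rightarrow> real) t.
        (\<forall>i<n. c \<le> s i \<and> s i \<le> t i \<and> t i \<le> d) \<and>
        disjoint_family_on (\<lambda>i. {s i<..<t i}) {..<n} \<and>
        (\<Sum>i<n. t i - s i) < \<delta>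
        \<longrightarrow> (\<Sum>i<n. norm (f (t i) - f (s i))) < \<epsilon>)"

definition hermitian :: "complex^2^2 \<Rightarrow> bool" where
  "hermitian \<theta> \<longleftrightarrow> (\<forall>i j. \<theta> $ i $ j = cnj (\<theta> $ j $ i))"

definition real_matrix :: "complex^2^2 \<Rightarrow> bool" where
  "real_matrix \<theta> \<longleftrightarrow> (\<forall>i j. \<theta> $ i $ j \<in> \<real>)"


section \<open>The differential expression and its operators\<close>

locale sl_expression =
  fixes a b :: ereal and p q w :: "real \<Rightarrow> real"
begin

abbreviation I :: "real set" where
  "I \<equiv> einterval a b"

definition ac_loc :: "(real \<Rightarrow> complex) \<Rightarrow> bool" where
  "ac_loc f \<longleftrightarrow> (\<forall>c d. {c..d} \<subseteq> I \<longrightarrow> ac_on c d f)"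

definition l1_loc :: "(real \<Rightarrow> real) \<Rightarrow> bool" where
  "l1_loc f \<longleftrightarrow> (\<forall>c d. {c..d} \<subseteq> I \<longrightarrow> f absolutely_integrable_on {c..d})"

definition coefficients :: bool where
  "coefficients \<longleftrightarrow> a < b \<and>
     (AE x in lebesgue_on I. 0 < p x) \<and> (AE x in lebesgue_on I. 0 < w x) \<and>
     l1_loc (\<lambda>x. 1 / p x) \<and> l1_loc q \<and> l1_loc w"

definition l2_on :: "real set \<Rightarrow> (real \<Rightarrow> complex) \<Rightarrow> bool" where
  "l2_on S f \<longleftrightarrow> f \<in> borel_measurable (lebesgue_on S) \<and>
     (\<lambda>x. (norm (f x))\<^sup>2 * w x) absolutely_integrable_on S"

definition wip :: "(real \<Rightarrow> complex) \<Rightarrow> (real \<Rightarrow> complex) \<Rightarrow> complex" where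
  "wip f g = (\<integral>x. f x * cnj (g x) * of_real (w x) \<partial>lebesgue_on I)"

definition wnorm :: "(real \<Rightarrow> complex) \<Rightarrow> real" where
  "wnorm f = sqrt (Re (wip f f))"

definition ae_eq :: "(real \<Rightarrow> complex) \<Rightarrow> (real \<Rightarrow> complex) \<Rightarrow> bool" where
  "ae_eq f g \<longleftrightarrow> (AE x in lebesgue_on I. f x = g x)"

text \<open>The product of \<open>p\<close> and \<open>f'\<close> is only defined almost everywhere. The condition
  that it lies in \<open>AC\<^sub>l\<^sub>o\<^sub>c\<close> means that it has a locally absolutely continuous
  representative, which is then unique on the interval; pointwise values
  such as those in the bracket refer to that representative.\<close>

definition is_qderiv :: "(real \<Rightarrow> complex) \<Rightarrow> (real \<Rightarrow> complex) \<Rightarrow> bool" where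
  "is_qderiv f h \<longleftrightarrow> ac_loc h \<and> (\<forall>x. x \<notin> I \<longrightarrow> h x = 0) \<and>
     ae_eq h (\<lambda>x. of_real (p x) * vector_derivative f (at x))"

definition qderiv :: "(real \<Rightarrow> complex) \<Rightarrow> real \<Rightarrow> complex" where
  "qderiv f = (THE h. is_qderiv f h)"

definition regular_fun :: "(real \<Rightarrow> complex) \<Rightarrow> bool" where
  "regular_fun f \<longleftrightarrow> ac_loc f \<and> (\<exists>h. is_qderiv f h)"

definition sl_ell :: "(real \<Rightarrow> complex) \<Rightarrow> real \<Rightarrow> complex" where
  "sl_ell f = (\<lambda>x. - (1 / of_real (w x)) *
     (vector_derivative (qderiv f) (at x) + of_real (q x) * f x))"

definition bracket :: "(real \<Rightarrow> complex) \<Rightarrow> (real \<Rightarrow> complex) \<Rightarrow> real \<Rightarrow> complex" where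
  "bracket f g = (\<lambda>x. f x * cnj (qderiv g x) - qderiv f x * cnj (g x))"

definition bracket_a :: "(real \<Rightarrow> complex) \<Rightarrow> (real \<Rightarrow> complex) \<Rightarrow> complex" where
  "bracket_a f g = Lim (filtermap real_of_ereal (at_right a)) (bracket f g)"

definition bracket_b :: "(real \<Rightarrow> complex) \<Rightarrow> (real \<Rightarrow> complex) \<Rightarrow> complex" where
  "bracket_b f g = Lim (filtermap real_of_ereal (at_left b)) (bracket f g)"

text \<open>Elements of the maximal domain are represented by functions that are continuous
  on the interval and extended by zero. As \<open>w > 0\<close> almost everywhere, every class
  in the maximal domain has exactly one such representative, so a domain is
  a plain set of functions. Every operator below is a restriction of the maximal
  operator and is represented by its domain, the action being \<open>sl_ell\<close>.\<close>

definition dmax :: "(real \<Rightarrow> complex) set" where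
  "dmax = {f. (\<forall>x. x \<notin> I \<longrightarrow> f x = 0) \<and> regular_fun f \<and> l2_on I f \<and> l2_on I (sl_ell f)}"

definition dmin :: "(real \<Rightarrow> complex) set" where
  "dmin = {f \<in> dmax. \<forall>g\<in>dmax. bracket_b f g - bracket_a f g = 0}"

definition dense_domain :: "(real \<Rightarrow> complex) set \<Rightarrow> bool" where
  "dense_domain D \<longleftrightarrow>
     (\<forall>h. l2_on I h \<longrightarrow> (\<forall>\<epsilon>>0. \<exists>f\<in>D. wnorm (\<lambda>x. h x - f x) < \<epsilon>))"

definition in_adjoint :: "(real \<Rightarrow> complex) set \<Rightarrow> (real \<Rightarrow> complex) \<Rightarrow> (real \<Rightarrow> complex) \<Rightarrow> bool" where
  "in_adjoint D g h \<longleftrightarrow> l2_on I g \<and> l2_on I h \<and> (\<forall>f\<in>D. wip (sl_ell f) g = wip f h)"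

definition self_adjoint :: "(real \<Rightarrow> complex) set \<Rightarrow> bool" where
  "self_adjoint D \<longleftrightarrow> dense_domain D \<and>
     (\<forall>g h. l2_on I g \<and> l2_on I h \<longrightarrow>
        (in_adjoint D g h \<longleftrightarrow> (\<exists>f\<in>D. ae_eq f g \<and> ae_eq (sl_ell f) h)))"

definition resolvent_set :: "(real \<Rightarrow> complex) set \<Rightarrow> complex set" where
  "resolvent_set D = {z.
     (\<forall>h. l2_on I h \<longrightarrow> (\<exists>!f. f \<in> D \<and> ae_eq (\<lambda>x. sl_ell f x - z * f x) h)) \<and>
     (\<exists>C. \<forall>f\<in>D. wnorm f \<le> C * wnorm (\<lambda>x. sl_ell f x - z * f x))}"

definition eigenspace :: "(real \<Rightarrow> complex) set \<Rightarrow> complex \<Rightarrow> (real \<Rightarrow> complex) set" where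
  "eigenspace D z = {f \<in> D. ae_eq (sl_ell f) (\<lambda>x. z * f x)}"

definition eig_mult :: "(real \<Rightarrow> complex) set \<Rightarrow> complex \<Rightarrow> nat" where
  "eig_mult D z = vector_space.dim (\<lambda>(c::complex) f x. c * f x) (eigenspace D z)"

definition semibounded_below :: "(real \<Rightarrow> complex) set \<Rightarrow> real \<Rightarrow> bool" where
  "semibounded_below D K \<longleftrightarrow> (\<forall>f\<in>D. K * Re (wip f f) \<le> Re (wip (sl_ell f) f))"

definition solution :: "complex \<Rightarrow> (real \<Rightarrow> complex) \<Rightarrow> bool" where
  "solution z y \<longleftrightarrow> regular_fun y \<and> ae_eq (sl_ell y) (\<lambda>x. z * y x)"

text \<open>By Weyl's alternative the choice of \<open>z\<close> is immaterial.\<close>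

definition limit_circle_a :: bool where
  "limit_circle_a \<longleftrightarrow> (\<exists>z. \<forall>y. solution z y \<longrightarrow> (\<exists>c\<in>I. l2_on (einterval a (ereal c)) y))"

definition limit_circle_b :: bool where
  "limit_circle_b \<longleftrightarrow> (\<exists>z. \<forall>y. solution z y \<longrightarrow> (\<exists>c\<in>I. l2_on (einterval (ereal c) b) y))"

definition real_solution :: "real \<Rightarrow> (real \<Rightarrow> complex) \<Rightarrow> bool" where
  "real_solution lam y \<longleftrightarrow> solution (of_real lam) y \<and> (\<forall>x\<in>I. y x \<in> \<real>)"

text \<open>The zero function is \<open>non_principal\<close> here because \<open>1 / 0 = 0\<close>; the normalisation
  \<open>[u, v] = 1\<close> excludes it.\<close>

definition non_principal_a :: "real \<Rightarrow> (real \<Rightarrow> complex) \<Rightarrow> bool" where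
  "non_principal_a lam y \<longleftrightarrow> real_solution lam y \<and>
     (\<exists>c\<in>I. (\<lambda>x. 1 / (p x * (Re (y x))\<^sup>2)) absolutely_integrable_on einterval a (ereal c))"

definition principal_a :: "real \<Rightarrow> (real \<Rightarrow> complex) \<Rightarrow> bool" where
  "principal_a lam y \<longleftrightarrow> real_solution lam y \<and>
     \<not> (\<exists>c\<in>I. (\<lambda>x. 1 / (p x * (Re (y x))\<^sup>2)) absolutely_integrable_on einterval a (ereal c))"

definition non_principal_b :: "real \<Rightarrow> (real \<Rightarrow> complex) \<Rightarrow> bool" where
  "non_principal_b lam y \<longleftrightarrow> real_solution lam y \<and>
     (\<exists>c\<in>I. (\<lambda>x. 1 / (p x * (Re (y x))\<^sup>2)) absolutely_integrable_on einterval (ereal c) b)"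

definition principal_b :: "real \<Rightarrow> (real \<Rightarrow> complex) \<Rightarrow> bool" where
  "principal_b lam y \<longleftrightarrow> real_solution lam y \<and>
     \<not> (\<exists>c\<in>I. (\<lambda>x. 1 / (p x * (Re (y x))\<^sup>2)) absolutely_integrable_on einterval (ereal c) b)"

end


section \<open>Boundary maps and the parametrised extensions\<close>

locale sl_frame = sl_expression +
  fixes u\<^sub>a v\<^sub>a u\<^sub>b v\<^sub>b :: "real \<Rightarrow> complex"
begin

definition frame :: "real \<Rightarrow> bool" where
  "frame lam\<^sub>0 \<longleftrightarrow>
     principal_a lam\<^sub>0 u\<^sub>a \<and> non_principal_a lam\<^sub>0 v\<^sub>a \<and> bracket_a u\<^sub>a v\<^sub>a = 1 \<and>
     principal_b lam\<^sub>0 u\<^sub>b \<and> non_principal_b lam\<^sub>0 v\<^sub>b \<and> bracket_b u\<^sub>b v\<^sub>b = 1"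

definition \<Gamma>\<^sub>0 :: "(real \<Rightarrow> complex) \<Rightarrow> complex^2" where
  "\<Gamma>\<^sub>0 f = vector [bracket_a f v\<^sub>a, bracket_b f v\<^sub>b]"

text \<open>The quasi-derivatives of order one are \<open>- [f, u\<^sub>a](a)\<close> and \<open>- [f, u\<^sub>b](b)\<close>; the second
  entry of \<open>\<Gamma>\<^sub>1\<close> is the negative of the latter.\<close>

definition \<Gamma>\<^sub>1 :: "(real \<Rightarrow> complex) \<Rightarrow> complex^2" where
  "\<Gamma>\<^sub>1 f = vector [- bracket_a f u\<^sub>a, bracket_b f u\<^sub>b]"

definition L_0 :: "(real \<Rightarrow> complex) set" where
  "L_0 = {f \<in> dmax. \<Gamma>\<^sub>0 f = 0}"

definition L_inf :: "(real \<Rightarrow> complex) set" where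
  "L_inf = {f \<in> dmax. \<Gamma>\<^sub>1 f = 0}"

definition L_ext :: "complex^2^2 \<Rightarrow> (real \<Rightarrow> complex) set" where
  "L_ext \<theta> = {f \<in> dmax. \<theta> *v \<Gamma>\<^sub>0 f = \<Gamma>\<^sub>1 f}"

definition L_ext' :: "complex^2^2 \<Rightarrow> (real \<Rightarrow> complex) set" where
  "L_ext' \<theta>' = {f \<in> dmax. \<theta>' *v (- \<Gamma>\<^sub>1 f) = \<Gamma>\<^sub>0 f}"

end

end

theory Submission
  imports Defs
begin

text \<open>Since both endpoints are limit-circle, all solutions of \<open>\<ell> y = \<lambda> y\<close> lie in the maximal domain, so
  \<open>\<lambda>\<close> is a double eigenvalue of an extension exactly when the domain contains the two-dimensional solution
  space. When \<open>\<lambda>\<close> is in the resolvent set of \<open>L\<^sub>0\<close>, the map \<open>\<Gamma>\<^sub>0\<close> is injective on that space, hence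
  bijective onto the plane, and \<open>\<theta>\<close> has to be \<open>\<Gamma>\<^sub>1\<close> composed with its inverse. Green's formula makes this matrix
  Hermitian, invariance of the solution space under conjugation makes it real, and a vanishing off-diagonal
  entry would give a nonzero solution whose boundary values at \<open>a\<close> both vanish.

  Self-adjointness rests on variation of constants: the equation \<open>\<ell> f = r\<close> is solvable in the
  maximal domain for every square integrable \<open>r\<close>, and the boundary values can be prescribed freely.
  The a.e. differentiability of locally absolutely continuous functions comes from the Radon--Nikodym theorem
  applied to the Stieltjes measures of the variation function \<open>V\<close> and of \<open>V - f\<close>.\<close>


section \<open>Absolutely continuous functions on the line\<close>

text \<open>With merely integrable coefficients the equation holds only a.e. Functions are therefore
  carried together with an integrand (\<open>primitive_on\<close>), and
  \<open>\<ell> y = z y\<close> is read as a first-order system for \<open>y\<close> and its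
  quasi-derivative. Boundary data are computed with the bilinear Wronskian instead of the
  sesquilinear bracket: it is constant for two solutions with the same \<open>z\<close>, and it
  obeys a Pluecker identity that passes to the limit at an endpoint. This identity converts values
  against one pair of Wronskian 1 into values against any other function, and so links the given
  frames with the solutions used for computing. In the equation with right-hand side
  \<open>r\<close>, the values at \<open>a\<close> are integration constants, while the change from
  \<open>a\<close> to \<open>b\<close> is an inner product of \<open>r\<close> with the conjugated
  homogeneous solutions; prescribing values at \<open>b\<close> is thus a choice of
  \<open>r\<close>. Self-adjointness becomes linear algebra: the domain has to equal its own
  complement under the boundary form. The relation between the two matrices comes from composing the
  two boundary conditions on the solution space, where both hold.\<close>

definition nonoverlapping :: "(real \<times> real) set \<Rightarrow> bool" where
  "nonoverlapping P \<longleftrightarrow> finite P \<and> (\<forall>s t. (s,t) \<in> P \<longrightarrow> s < t) \<and>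
     (\<forall>s t s' t'. (s,t) \<in> P \<longrightarrow> (s',t') \<in> P \<longrightarrow> s = s' \<and> t = t' \<or> t \<le> s' \<or> t' \<le> s)"

definition pairs_within :: "real \<Rightarrow> real \<Rightarrow> (real \<times> real) set \<Rightarrow> bool" where
  "pairs_within x y P \<longleftrightarrow> nonoverlapping P \<and> (\<forall>s t. (s,t) \<in> P \<longrightarrow> x \<le> s \<and> t \<le> y)"

definition oscillation :: "(real \<Rightarrow> real) \<Rightarrow> (real \<times> real) set \<Rightarrow> real" where
  "oscillation f P = (\<Sum>(s,t)\<in>P. \<bar>f t - f s\<bar>)"

definition total_length :: "(real \<times> real) set \<Rightarrow> real" where
  "total_length P = (\<Sum>(s,t)\<in>P. t - s)"

text \<open>The condition of \<open>ac_on\<close>, for real functions on the whole line and with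
  finite sets of pairs in place of indexed families: sets are split and united without renumbering.
  Functions on a segment enter through \<open>ac_on_abs_cont_clamp\<close>.\<close>

definition abs_cont :: "(real \<Rightarrow> real) \<Rightarrow> bool" where
  "abs_cont f \<longleftrightarrow> (\<forall>\<epsilon>>0. \<exists>\<delta>>0. \<forall>P. nonoverlapping P \<and> total_length P < \<delta> \<longrightarrow> oscillation f P < \<epsilon>)"

lemma nonoverlapping_less: "nonoverlapping P \<Longrightarrow> i \<in> P \<Longrightarrow> fst i < snd i"
  unfolding nonoverlapping_def by (metis prod.collapse)

lemma nonoverlapping_subset: "nonoverlapping P \<Longrightarrow> Q \<subseteq> P \<Longrightarrow> nonoverlapping Q"
  unfolding nonoverlapping_def by (meson finite_subset subsetD)

lemma pairs_within_subset: "pairs_within x y P \<Longrightarrow> Q \<subseteq> P \<Longrightarrow> pairs_within x y Q"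
  unfolding pairs_within_def using nonoverlapping_subset by blast

lemma oscillation_nonneg [simp]: "0 \<le> oscillation f P"
  unfolding oscillation_def by (auto intro: sum_nonneg)

lemma pairs_within_empty: "pairs_within x y {}"
  by (simp add: pairs_within_def nonoverlapping_def)

lemma pairs_within_trivial:
  assumes "pairs_within x y P" "y \<le> x"
  shows "P = {}"
  using assms unfolding pairs_within_def nonoverlapping_def by fastforce

lemma pairs_within_Un:
  assumes "pairs_within x y P" "pairs_within y z Q" "x \<le> y" "y \<le> z"
  shows "pairs_within x z (P \<union> Q)" "P \<inter> Q = {}"
  using assms unfolding pairs_within_def nonoverlapping_def by fastforce+

lemma oscillation_Un:
  assumes "finite P" "finite Q" "P \<inter> Q = {}"
  shows "oscillation f (P \<union> Q) = oscillation f P + oscillation f Q"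
  unfolding oscillation_def using assms by (rule sum.union_disjoint)

lemma total_length_le_measure:
  assumes P: "nonoverlapping P" and S: "\<And>s t. (s,t) \<in> P \<Longrightarrow> {s<..<t} \<subseteq> S" "S \<in> fmeasurable lborel"
  shows "total_length P \<le> measure lborel S"
proof -
  have fin: "finite P" using P by (auto simp: nonoverlapping_def)
  let ?I = "\<lambda>(s,t). {s<..<t::real}"
  have disj: "disjoint_family_on ?I P"
    using P unfolding disjoint_family_on_def nonoverlapping_def by fastforce
  have "total_length P = (\<Sum>i\<in>P. measure lborel (?I i))"
    unfolding total_length_def
    using P by (intro sum.cong) (auto simp: nonoverlapping_def less_imp_le)
  also have "\<dots> = measure lborel (\<Union>i\<in>P. ?I i)"
    by (rule measure_finite_Union [symmetric, OF fin _ disj]) (use P in \<open>auto simp: nonoverlapping_def less_imp_le\<close>)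
  also have "\<dots> \<le> measure lborel S"
  proof (rule measure_mono_fmeasurable)
    show "(\<Union>i\<in>P. ?I i) \<subseteq> S" using S(1) by fastforce
    show "(\<Union>i\<in>P. ?I i) \<in> sets lborel" using fin by (auto intro!: sets.finite_UN)
  qed (rule S)
  finally show ?thesis .
qed

lemma total_length_le:
  assumes "pairs_within x y P" "x \<le> y"
  shows "total_length P \<le> y - x"
proof -
  have "total_length P \<le> measure lborel {x..y}"
    using assms by (intro total_length_le_measure) (auto simp: pairs_within_def fmeasurable_def emeasure_lborel_Icc_eq, force+)
  then show ?thesis using assms by simp
qed

text \<open>At most one pair straddles the cut point. It is replaced by two pairs that meet at
  \<open>y\<close>, and by the triangle inequality the oscillation does not drop.\<close>

lemma pairs_within_split:
  assumes P: "pairs_within x z P" and y: "x \<le> y" "y \<le> z"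
  obtains P1 P2 where "pairs_within x y P1" "pairs_within y z P2"
    "oscillation f P \<le> oscillation f P1 + oscillation f P2"
proof -
  let ?L = "{(s,t)\<in>P. t \<le> y}" and ?R = "{(s,t)\<in>P. y \<le> s}" and ?M = "{(s,t)\<in>P. s < y \<and> y < t}"
  have fin: "finite P" using P by (auto simp: pairs_within_def nonoverlapping_def)
  have L: "pairs_within x y ?L" using pairs_within_subset [OF P, of ?L]
    by (auto simp: pairs_within_def)
  have R: "pairs_within y z ?R" using pairs_within_subset [OF P, of ?R]
    by (auto simp: pairs_within_def)
  have PM: "P = (?L \<union> ?R) \<union> ?M" by auto
  have disj: "?L \<inter> ?R = {}" "(?L \<union> ?R) \<inter> ?M = {}"
    using P unfolding pairs_within_def nonoverlapping_def by fastforce+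
  have fL: "finite ?L" "finite ?R" "finite ?M" using fin by (auto intro: finite_subset)
  have "oscillation f P = oscillation f ((?L \<union> ?R) \<union> ?M)"
    by (rule arg_cong [OF PM])
  also have "\<dots> = oscillation f (?L \<union> ?R) + oscillation f ?M"
    using fL disj by (intro oscillation_Un) blast+
  also have "oscillation f (?L \<union> ?R) = oscillation f ?L + oscillation f ?R"
    using fL disj by (intro oscillation_Un) blast+
  finally have sum: "oscillation f P = oscillation f ?L + oscillation f ?R + oscillation f ?M" .
  show thesis
  proof (cases "?M = {}")
    case True
    then have "oscillation f ?M = 0" by (simp only: oscillation_def sum.empty)
    with sum L R that show thesis by auto
  next
    case False
    then obtain s t where st: "(s,t) \<in> P" "s < y" "y < t" by auto
    have M: "?M = {(s,t)}"
      using P st unfolding pairs_within_def nonoverlapping_def by fastforce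
    have 1: "pairs_within x y (insert (s,y) ?L)"
      using P st fL unfolding pairs_within_def nonoverlapping_def by fastforce
    have 2: "pairs_within y z (insert (y,t) ?R)"
      using P st fL unfolding pairs_within_def nonoverlapping_def by fastforce
    have n: "(s,y) \<notin> ?L" "(y,t) \<notin> ?R" 
      using P st unfolding pairs_within_def nonoverlapping_def by fastforce+
    have "oscillation f ?M \<le> \<bar>f y - f s\<bar> + \<bar>f t - f y\<bar>"
      unfolding M oscillation_def by simp
    moreover have "oscillation f (insert (s,y) ?L) = \<bar>f y - f s\<bar> + oscillation f ?L"
      "oscillation f (insert (y,t) ?R) = \<bar>f t - f y\<bar> + oscillation f ?R"
      unfolding oscillation_def using n fL(1,2) by (subst sum.insert; auto)+
    ultimately show thesis using that [OF 1 2] sum by linarith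
  qed
qed

section \<open>Total variation of an absolutely continuous function\<close>

definition variation :: "(real \<Rightarrow> real) \<Rightarrow> real \<Rightarrow> real \<Rightarrow> real" where
  "variation f x y = (SUP P\<in>{P. pairs_within x y P}. oscillation f P)"

text \<open>The segment is cut into pieces of half the length \<open>\<delta>\<close> that belongs
  to \<open>\<epsilon> = 1\<close>. Each piece contributes at most 1, so the number of pieces bounds
  the oscillation of every family.\<close>

lemma abs_cont_bdd_variation:
  assumes "abs_cont f"
  shows "bdd_above (oscillation f ` {P. pairs_within x y P})"
proof -
  obtain \<delta> where \<delta>: "\<delta> > 0" "\<And>P. nonoverlapping P \<Longrightarrow> total_length P < \<delta> \<Longrightarrow> oscillation f P < 1"
    using assms unfolding abs_cont_def by (metis zero_less_one)
  have *: "oscillation f P \<le> real k" if "pairs_within x z P" "z - x \<le> real k * (\<delta>/2)" for k z P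
    using that
  proof (induction k arbitrary: z P)
    case 0
    then have "P = {}" using pairs_within_trivial by auto
    then show ?case by (simp add: oscillation_def)
  next
    case (Suc k)
    show ?case
    proof (cases "z - x < \<delta>")
      case True
      then have "oscillation f P \<le> 1"
      proof (cases "x \<le> z")
        case True
        then have "total_length P < \<delta>" using total_length_le [OF Suc.prems(1)] \<open>z - x < \<delta>\<close> by linarith
        then show ?thesis using \<delta>(2) [of P] Suc.prems by (auto simp: pairs_within_def intro: less_imp_le)
      next
        case False
        then have "P = {}" using pairs_within_trivial Suc.prems by auto
        then show ?thesis by (simp add: oscillation_def)
      qed
      then show ?thesis by simp
    next
      case False
      \<comment> \<open>Half of \<open>\<delta>\<close> because \<open>abs_cont\<close> asks for a
        total length strictly below \<open>\<delta>\<close>.\<close>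
      define y where "y = z - \<delta>/2"
      have y: "x \<le> y" "y \<le> z" using False \<delta>(1) by (auto simp: y_def)
      obtain P1 P2 where P12: "pairs_within x y P1" "pairs_within y z P2"
        "oscillation f P \<le> oscillation f P1 + oscillation f P2"
        using pairs_within_split [OF Suc.prems(1) y] by blast
      have "oscillation f P1 \<le> real k"
        using Suc.IH [OF P12(1)] Suc.prems(2) by (simp add: y_def algebra_simps)
      moreover have "oscillation f P2 < 1"
        using \<delta>(2) [of P2] total_length_le [OF P12(2)] y \<delta>(1) P12(2) by (auto simp: pairs_within_def y_def)
      ultimately show ?thesis using P12(3) by simp
    qed
  qed
  obtain k where "(y - x) / (\<delta>/2) < real k" using reals_Archimedean2 by blast
  then have "y - x \<le> real k * (\<delta>/2)" using \<delta>(1) by (simp add: field_simps)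
  then show ?thesis using * by (intro bdd_aboveI2 [where M = "real k"]) auto
qed

lemma oscillation_le_variation:
  assumes "abs_cont f" "pairs_within x y P"
  shows "oscillation f P \<le> variation f x y"
  unfolding variation_def using assms by (intro cSUP_upper abs_cont_bdd_variation) auto

lemma variation_le:
  assumes "\<And>P. pairs_within x y P \<Longrightarrow> oscillation f P \<le> B"
  shows "variation f x y \<le> B"
  unfolding variation_def using assms pairs_within_empty by (intro cSUP_least) auto

lemma variation_nonneg: "abs_cont f \<Longrightarrow> 0 \<le> variation f x y"
  using oscillation_le_variation [OF _ pairs_within_empty] oscillation_nonneg
  by (metis dual_order.trans)

lemma variation_trivial: "y \<le> x \<Longrightarrow> variation f x y = 0"
proof -
  assume "y \<le> x"
  then have "{P. pairs_within x y P} = {{}}"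
    using pairs_within_trivial pairs_within_empty by auto
  then show ?thesis by (simp add: variation_def oscillation_def)
qed

lemma abs_le_variation:
  assumes "abs_cont f" "x \<le> y"
  shows "\<bar>f y - f x\<bar> \<le> variation f x y"
proof (cases "x = y")
  case True then show ?thesis by (simp add: variation_trivial)
next
  case False
  then have "pairs_within x y {(x,y)}" using assms by (auto simp: pairs_within_def nonoverlapping_def)
  from oscillation_le_variation [OF assms(1) this] show ?thesis by (simp add: oscillation_def)
qed

lemma variation_approx:
  assumes "abs_cont f" "0 < \<eta>"
  obtains P where "pairs_within x y P" "variation f x y - \<eta> < oscillation f P"
proof (rule ccontr)
  assume "\<not> thesis"
  then have "\<And>P. pairs_within x y P \<Longrightarrow> oscillation f P \<le> variation f x y - \<eta>"
    using that by force
  then have "variation f x y \<le> variation f x y - \<eta>" by (rule variation_le)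
  then show False using assms by simp
qed

lemma variation_add:
  assumes f: "abs_cont f" and y: "x \<le> y" "y \<le> z"
  shows "variation f x z = variation f x y + variation f y z"
proof (rule antisym)
  show "variation f x z \<le> variation f x y + variation f y z"
  proof (rule variation_le)
    fix P assume P: "pairs_within x z P"
    obtain P1 P2 where "pairs_within x y P1" "pairs_within y z P2"
        "oscillation f P \<le> oscillation f P1 + oscillation f P2"
      using pairs_within_split [OF P y] by blast
    then show "oscillation f P \<le> variation f x y + variation f y z"
      using oscillation_le_variation [OF f] by (meson add_mono order_trans)
  qed
next
  have "variation f x y + variation f y z \<le> variation f x z + \<eta>" if "\<eta> > 0" for \<eta>
  proof -
    obtain P where P: "pairs_within x y P" "variation f x y - \<eta>/2 < oscillation f P"
      using variation_approx [OF f, of "\<eta>/2"] \<open>\<eta> > 0\<close> by auto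
    obtain Q where Q: "pairs_within y z Q" "variation f y z - \<eta>/2 < oscillation f Q"
      using variation_approx [OF f, of "\<eta>/2"] \<open>\<eta> > 0\<close> by auto
    have "oscillation f (P \<union> Q) \<le> variation f x z"
      using pairs_within_Un [OF P(1) Q(1) y] oscillation_le_variation [OF f] by blast
    moreover have "oscillation f (P \<union> Q) = oscillation f P + oscillation f Q"
      using pairs_within_Un [OF P(1) Q(1) y] P(1) Q(1)
      by (intro oscillation_Un) (auto simp: pairs_within_def nonoverlapping_def)
    ultimately show ?thesis using P(2) Q(2) by linarith
  qed
  then show "variation f x y + variation f y z \<le> variation f x z"
    by (rule field_le_epsilon)
qed

text \<open>Each pair is refined by a family that nearly attains the variation on it. The
  refinements together are again nonoverlapping and no longer than the original family, so the
  \<open>\<delta>\<close> of \<open>f\<close> for \<open>\<epsilon>/2\<close> also serves the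
  variation.\<close>

lemma abs_cont_variation:
  assumes f: "abs_cont f"
  shows "abs_cont (variation f c)"
  unfolding abs_cont_def
proof (intro allI impI)
  fix \<epsilon> :: real assume "\<epsilon> > 0"
  then obtain \<delta> where \<delta>: "\<delta> > 0" "\<And>P. nonoverlapping P \<Longrightarrow> total_length P < \<delta> \<Longrightarrow> oscillation f P < \<epsilon>/2"
    using f unfolding abs_cont_def by (metis half_gt_zero)
  have "oscillation (variation f c) P < \<epsilon>" if P: "nonoverlapping P" "total_length P < \<delta>" for P
  proof -
    have fin: "finite P" using P by (auto simp: nonoverlapping_def)
    \<comment> \<open>The loss \<open>\<eta>\<close> occurs once per pair and adds up to at most
      \<open>\<epsilon>/2\<close>; the \<open>+ 1\<close> covers the empty family.\<close>
    define \<eta> where "\<eta> = \<epsilon> / (2 * (real (card P) + 1))"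
    have \<eta>: "\<eta> > 0" using \<open>\<epsilon> > 0\<close> by (simp add: \<eta>_def)
    have "\<forall>i. \<exists>Q. pairs_within (fst i) (snd i) Q \<and> variation f (fst i) (snd i) - \<eta> < oscillation f Q"
      using variation_approx [OF f \<eta>] by metis
    then obtain Q where Q: "\<And>i. pairs_within (fst i) (snd i) (Q i)"
        "\<And>i. variation f (fst i) (snd i) - \<eta> < oscillation f (Q i)" by metis
    have finQ: "finite (Q i)" for i using Q(1)[of i] by (auto simp: pairs_within_def nonoverlapping_def)
    have in_Q: "s < t \<and> fst i \<le> s \<and> t \<le> snd i" if "(s,t) \<in> Q i" for s t i
      using Q(1)[of i] that by (auto simp: pairs_within_def nonoverlapping_def)
    have sep: "snd i \<le> fst j \<or> snd j \<le> fst i" if "i \<in> P" "j \<in> P" "i \<noteq> j" for i j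
      using P(1) that unfolding nonoverlapping_def by (metis prod.collapse)
    have disj: "Q i \<inter> Q j = {}" if "i \<in> P" "j \<in> P" "i \<noteq> j" for i j
    proof (rule equals0I)
      fix p assume "p \<in> Q i \<inter> Q j"
      then obtain s t where "(s,t) \<in> Q i" "(s,t) \<in> Q j" by (cases p) auto
      then show False using sep [OF that] in_Q [of s t i] in_Q [of s t j] by linarith
    qed
    have non: "nonoverlapping (\<Union>i\<in>P. Q i)"
      unfolding nonoverlapping_def
    proof (intro conjI)
      show "finite (\<Union>i\<in>P. Q i)" using fin finQ by auto
      show "\<forall>s t. (s,t) \<in> (\<Union>i\<in>P. Q i) \<longrightarrow> s < t" using in_Q by auto
      show "\<forall>s t s' t'. (s,t) \<in> (\<Union>i\<in>P. Q i) \<longrightarrow> (s',t') \<in> (\<Union>i\<in>P. Q i) \<longrightarrow> s = s' \<and> t = t' \<or> t \<le> s' \<or> t' \<le> s"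
      proof (intro allI impI)
        fix s t s' t' assume "(s,t) \<in> (\<Union>i\<in>P. Q i)" "(s',t') \<in> (\<Union>i\<in>P. Q i)"
        then obtain i j where a: "(s,t) \<in> Q i" "i \<in> P" "(s',t') \<in> Q j" "j \<in> P" by blast
        show "s = s' \<and> t = t' \<or> t \<le> s' \<or> t' \<le> s"
        proof (cases "i = j")
          case True
          then show ?thesis using Q(1)[of i] a unfolding pairs_within_def nonoverlapping_def by fastforce
        next
          case False
          then show ?thesis using sep [of i j] a in_Q [of s t i] in_Q [of s' t' j] by fastforce
        qed
      qed
    qed
    have "total_length (\<Union>i\<in>P. Q i) = (\<Sum>i\<in>P. total_length (Q i))"
      unfolding total_length_def using fin finQ disj by (intro sum.UNION_disjoint) auto
    also have "\<dots> \<le> (\<Sum>i\<in>P. snd i - fst i)"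
      using P(1) Q(1) by (intro sum_mono total_length_le) (auto dest: nonoverlapping_less intro: less_imp_le)
    also have "\<dots> = total_length P" by (simp add: total_length_def split_def)
    finally have "oscillation f (\<Union>i\<in>P. Q i) < \<epsilon>/2" using \<delta>(2) [OF non] P(2) by linarith
    moreover have "oscillation f (\<Union>i\<in>P. Q i) = (\<Sum>i\<in>P. oscillation f (Q i))"
      unfolding oscillation_def using fin finQ disj by (intro sum.UNION_disjoint) auto
    moreover have "(\<Sum>i\<in>P. variation f (fst i) (snd i)) \<le> (\<Sum>i\<in>P. oscillation f (Q i) + \<eta>)"
      using Q(2) by (intro sum_mono) (metis diff_less_eq less_imp_le)
    moreover have "\<dots> = (\<Sum>i\<in>P. oscillation f (Q i)) + real (card P) * \<eta>"
      by (simp add: sum.distrib)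
    moreover have "real (card P) * \<eta> \<le> \<epsilon>/2"
      using \<open>\<epsilon> > 0\<close> by (simp add: \<eta>_def field_simps)
    moreover have "oscillation (variation f c) P \<le> (\<Sum>i\<in>P. variation f (fst i) (snd i))"
      unfolding oscillation_def split_def
    proof (rule sum_mono)
      fix i assume "i \<in> P"
      then have i: "fst i < snd i" using P(1) nonoverlapping_less by blast
      show "\<bar>variation f c (snd i) - variation f c (fst i)\<bar> \<le> variation f (fst i) (snd i)"
      proof (cases "c \<le> fst i")
        case True
        then show ?thesis using variation_add [OF f True less_imp_le [OF i]] variation_nonneg [OF f, of "fst i" "snd i"] by linarith
      next
        case F: False
        show ?thesis
        proof (cases "c \<le> snd i")
          case True
          then show ?thesis using variation_add [OF f _ True, of "fst i"] F variation_nonneg [OF f, of "fst i" c]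
              variation_nonneg [OF f, of c "snd i"] variation_trivial [of "fst i" c f] by linarith
        next
          case False
          then show ?thesis using F variation_nonneg [OF f] by (simp add: variation_trivial)
        qed
      qed
    qed
    ultimately show ?thesis by linarith
  qed
  with \<delta>(1) show "\<exists>\<delta>>0. \<forall>P. nonoverlapping P \<and> total_length P < \<delta> \<longrightarrow> oscillation (variation f c) P < \<epsilon>"
    by blast
qed

lemma abs_cont_diff:
  assumes "abs_cont f" "abs_cont g"
  shows "abs_cont (\<lambda>x. f x - g x)"
  unfolding abs_cont_def
proof (intro allI impI)
  fix \<epsilon> :: real assume "\<epsilon> > 0"
  then obtain \<delta>1 \<delta>2 where \<delta>: "\<delta>1 > 0" "\<And>P. nonoverlapping P \<Longrightarrow> total_length P < \<delta>1 \<Longrightarrow> oscillation f P < \<epsilon>/2"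
    "\<delta>2 > 0" "\<And>P. nonoverlapping P \<Longrightarrow> total_length P < \<delta>2 \<Longrightarrow> oscillation g P < \<epsilon>/2"
    using assms unfolding abs_cont_def by (metis half_gt_zero)
  have le: "oscillation (\<lambda>x. f x - g x) P \<le> oscillation f P + oscillation g P" for P
    unfolding oscillation_def sum.distrib [symmetric] by (intro sum_mono) auto
  have "oscillation (\<lambda>x. f x - g x) P < \<epsilon>" if "nonoverlapping P" "total_length P < min \<delta>1 \<delta>2" for P
    using le [of P] \<delta>(2) [of P] \<delta>(4) [of P] that by simp
  then show "\<exists>\<delta>>0. \<forall>P. nonoverlapping P \<and> total_length P < \<delta> \<longrightarrow> oscillation (\<lambda>x. f x - g x) P < \<epsilon>"
    using \<delta> by (intro exI [of _ "min \<delta>1 \<delta>2"]) auto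
qed

lemma abs_cont_continuous:
  assumes "abs_cont f"
  shows "continuous_on UNIV f"
  unfolding continuous_on_iff
proof (intro ballI allI impI)
  fix x e :: real assume "e > 0"
  then obtain \<delta> where \<delta>: "\<delta> > 0" "\<And>P. nonoverlapping P \<Longrightarrow> total_length P < \<delta> \<Longrightarrow> oscillation f P < e"
    using assms unfolding abs_cont_def by metis
  have "dist (f y) (f x) < e" if "dist y x < \<delta>" for y
  proof -
    consider "y = x" | "y < x" | "x < y" by linarith
    then show ?thesis
      using \<delta>(2) [of "{(x,y)}"] \<delta>(2) [of "{(y,x)}"] that \<open>e > 0\<close>
      by cases (auto simp: dist_real_def nonoverlapping_def total_length_def oscillation_def)
  qed
  then show "\<exists>d>0. \<forall>x'\<in>UNIV. dist x' x < d \<longrightarrow> dist (f x') (f x) < e" using \<delta>(1) by blast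
qed

text \<open>A null set lies in an open set of small Lebesgue measure. A finite union of boxes in
  that set is a division into intervals of small total length, and its Stieltjes measure is at most
  the oscillation of \<open>F\<close> over these intervals.\<close>

lemma mono_abs_cont_absolutely_continuous:
  assumes F: "mono F" "abs_cont F"
  shows "absolutely_continuous lborel (interval_measure F)"
  unfolding absolutely_continuous_def
proof
  fix N :: "real set" assume N: "N \<in> null_sets lborel"
  let ?M = "interval_measure F"
  have cont: "continuous_on UNIV F" by (rule abs_cont_continuous) (rule F)
  have bor: "N \<in> sets borel" using N by auto
  have "emeasure ?M N \<le> 0 + ennreal \<epsilon>" if \<epsilon>: "\<epsilon> > 0" for \<epsilon>
  proof -
    obtain \<delta> where \<delta>: "\<delta> > 0" "\<And>P. nonoverlapping P \<Longrightarrow> total_length P < \<delta> \<Longrightarrow> oscillation F P < \<epsilon>"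
      using F(2) \<epsilon> unfolding abs_cont_def by metis
    obtain U where U: "open U" "N \<subseteq> U" "emeasure lborel (U - N) < \<delta>"
      using outer_regular_lborel [OF bor \<delta>(1)] by blast
    have U_eq: "emeasure lborel U = emeasure lborel (U - N)"
      using N U(1) by (simp add: emeasure_Diff_null_set)
    have Uf: "U \<in> fmeasurable lborel" using U U_eq by (auto simp: fmeasurable_def intro: less_trans)
    have mU: "measure lborel U < \<delta>"
      using U(3) \<delta>(1) unfolding measure_def U_eq
      by (metis enn2real_less_iff ennreal_less_top less_imp_le order.strict_trans)
    obtain D where D: "countable D" "D \<subseteq> Pow U" "\<And>X. X \<in> D \<Longrightarrow> \<exists>a b. X = cbox a b" "\<Union>D = U"
      using open_countable_Union_open_cbox [OF U(1)] by blast
    have fin: "emeasure ?M (\<Union>\<F>) \<le> ennreal \<epsilon>" if \<F>: "finite \<F>" "\<F> \<subseteq> D" for \<F>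
    proof -
      obtain p where p: "p division_of \<Union>\<F>"
        using elementary_unions_intervals [OF \<F>(1)] D(3) \<F>(2) by blast
      have fp: "finite p" using p by blast
      have k: "{Inf k..Sup k} = k" and k_le: "Inf k \<le> Sup k" if kp: "k \<in> p" for k
      proof -
        obtain x y where "k = cbox x y" "k \<noteq> {}" using division_ofD(3,4) [OF p kp] by auto
        then show "{Inf k..Sup k} = k" "Inf k \<le> Sup k" by simp_all
      qed
      \<comment> \<open>Degenerate intervals are dropped since \<open>nonoverlapping\<close>
        requires \<open>s < t\<close>; they add nothing to the sum of increments of
        \<open>F\<close>.\<close>
      define p' where "p' = {k \<in> p. Inf k < Sup k}"
      have p': "finite p'" "p' \<subseteq> p" using fp by (auto simp: p'_def)
      let ?h = "\<lambda>k::real set. (Inf k, Sup k)"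
      have inj: "inj_on ?h p'"
      proof (rule inj_onI)
        fix k1 k2 assume "k1 \<in> p'" "k2 \<in> p'" "?h k1 = ?h k2"
        then show "k1 = k2" using k [of k1] k [of k2] p'(2) by auto
      qed
      have non: "nonoverlapping (?h ` p')"
        unfolding nonoverlapping_def
      proof (intro conjI allI impI)
        show "finite (?h ` p')" using p' by simp
        show "s < t" if "(s,t) \<in> ?h ` p'" for s t using that by (auto simp: p'_def)
        fix s t s' t' assume "(s,t) \<in> ?h ` p'" "(s',t') \<in> ?h ` p'"
        then obtain k1 k2 where k12: "k1 \<in> p'" "k2 \<in> p'" "s = Inf k1" "t = Sup k1" "s' = Inf k2" "t' = Sup k2"
          by auto
        show "s = s' \<and> t = t' \<or> t \<le> s' \<or> t' \<le> s"
        proof (cases "k1 = k2")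
          case False
          then have "interior k1 \<inter> interior k2 = {}"
            using p k12 p'(2) by (metis division_ofD(5) subsetD)
          moreover have "interior k1 = {s<..<t}" "interior k2 = {s'<..<t'}"
            using k [of k1] k [of k2] k12 p'(2) by (metis interior_atLeastAtMost_real subsetD)+
          ultimately have "\<not> max s s' < min t t'"
            using dense [of "max s s'" "min t t'"] by auto
          moreover have "s < t" "s' < t'" using k12 by (auto simp: p'_def)
          ultimately show ?thesis by auto
        qed (use k12 in auto)
      qed
      have "total_length (?h ` p') \<le> measure lborel U"
      proof (rule total_length_le_measure [OF non _ Uf])
        fix s t assume "(s,t) \<in> ?h ` p'"
        then obtain k1 where "k1 \<in> p'" "s = Inf k1" "t = Sup k1" by auto
        then have "k1 \<in> p" "{s..t} = k1" using k [of k1] p'(2) by auto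
        moreover have "\<Union>\<F> \<subseteq> U" using \<F>(2) D(2) by blast
        ultimately have "{s..t} \<subseteq> U" using division_ofD(2) [OF p] by (metis order_trans)
        then show "{s<..<t} \<subseteq> U" by auto
      qed
      then have osc: "oscillation F (?h ` p') < \<epsilon>" using \<delta>(2) [OF non] mU by linarith
      have M: "emeasure ?M k1 = ennreal (F (Sup k1) - F (Inf k1))" if "k1 \<in> p" for k1
        using emeasure_interval_measure_Icc [of "Inf k1" "Sup k1" F] k [OF that] k_le [OF that] monoD [OF F(1)] cont by simp
      have "emeasure ?M (\<Union>\<F>) = emeasure ?M (\<Union>k\<in>p. k)" using p by (simp add: division_of_def)
      also have "\<dots> \<le> (\<Sum>k\<in>p. emeasure ?M k)"
        by (rule emeasure_subadditive_finite [OF fp]) (use p in \<open>auto dest!: division_ofD(4)\<close>)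
      also have "\<dots> = (\<Sum>k\<in>p. ennreal (F (Sup k) - F (Inf k)))" using M by (intro sum.cong) auto
      also have "\<dots> = ennreal (\<Sum>k\<in>p. F (Sup k) - F (Inf k))"
        using k_le monoD [OF F(1)] by (intro sum_ennreal) auto
      also have "(\<Sum>k\<in>p. F (Sup k) - F (Inf k)) = (\<Sum>k\<in>p'. F (Sup k) - F (Inf k))"
      proof (rule sum.mono_neutral_right [OF fp p'(2)], rule ballI)
        fix k1 assume "k1 \<in> p - p'"
        then have "Inf k1 = Sup k1" using k_le [of k1] by (auto simp: p'_def)
        then show "F (Sup k1) - F (Inf k1) = 0" by simp
      qed
      also have "\<dots> \<le> oscillation F (?h ` p')"
        unfolding oscillation_def by (subst sum.reindex [OF inj]) (auto intro!: sum_mono)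
      finally show ?thesis using osc by (meson ennreal_leI less_imp_le order_trans)
    qed
    have "emeasure ?M U \<le> ennreal \<epsilon>"
    proof (cases "D = {}")
      case True
      then have "U = {}" using D(4) by blast
      then show ?thesis by simp
    next
      case False
      define A where "A n = \<Union>(from_nat_into D ` {..n::nat})" for n
      have in_D: "from_nat_into D n \<in> D" for n using False by (rule from_nat_into)
      have "(\<Union>n. A n) = U"
      proof -
        have "(\<Union>n. A n) = \<Union>(range (from_nat_into D))" unfolding A_def by auto
        then show ?thesis using D(4) range_from_nat_into [OF False D(1)] by simp
      qed
      moreover have "incseq A" unfolding A_def by (intro monoI Union_mono image_mono) auto
      moreover have "range A \<subseteq> sets ?M"
      proof -
        have "from_nat_into D n \<in> sets borel" for n using D(3) [OF in_D [of n]] by auto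
        then show ?thesis unfolding A_def by auto
      qed
      ultimately have "emeasure ?M U = (SUP n. emeasure ?M (A n))"
        using SUP_emeasure_incseq [of A ?M] by simp
      also have "\<dots> \<le> ennreal \<epsilon>"
        using in_D by (intro SUP_least) (auto simp: A_def intro!: fin)
      finally show ?thesis .
    qed
    moreover have "emeasure ?M N \<le> emeasure ?M U" using U by (intro emeasure_mono) auto
    ultimately show ?thesis by simp
  qed
  then have "emeasure ?M N \<le> 0" by (rule ennreal_le_epsilon)
  then show "N \<in> null_sets ?M" using bor by (auto simp: null_sets_def)
qed

lemma mono_abs_cont_integral:
  assumes F: "mono F" "abs_cont F"
  obtains g :: "real \<Rightarrow> real" where
    "\<And>x y. x \<le> y \<Longrightarrow> g absolutely_integrable_on {x..y}"
    "\<And>x y. x \<le> y \<Longrightarrow> F y - F x = integral {x..y} g"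
proof -
  let ?M = "interval_measure F"
  have cont: "continuous_on UNIV F" by (rule abs_cont_continuous) (rule F)
  obtain g where g [measurable]: "g \<in> borel_measurable lborel" and dens: "density lborel g = ?M"
    using sigma_finite_measure.Radon_Nikodym [OF sigma_finite_lborel mono_abs_cont_absolutely_continuous [OF F]] by auto
  define h where "h = (\<lambda>x. enn2real (g x))"
  have h_meas [measurable]: "h \<in> borel_measurable borel" unfolding h_def using g by simp
  have *: "(h has_integral (F y - F x)) {x..y}" if "x \<le> y" for x y
  proof -
    have "(\<integral>\<^sup>+z. g z * indicator {x..y} z \<partial>lborel) = emeasure ?M {x..y}"
      unfolding dens [symmetric] by (subst emeasure_density) auto
    also have eq: "\<dots> = ennreal (F y - F x)"
      by (rule emeasure_interval_measure_Icc [OF that _ cont]) (use F(1) in \<open>auto dest: monoD\<close>)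
    finally have int: "(\<integral>\<^sup>+z. g z * indicator {x..y} z \<partial>lborel) = ennreal (F y - F x)" .
    \<comment> \<open>The segment has finite mass, so the density is finite a.e. on it and replacing
      \<open>g\<close> by its real part \<open>h\<close> changes no integral.\<close>
    then have "AE z in lborel. g z * indicator {x..y} z \<noteq> \<infinity>"
      by (intro nn_integral_PInf_AE) auto
    then have "(\<integral>\<^sup>+z. ennreal (h z * indicator {x..y} z) \<partial>lborel) = (\<integral>\<^sup>+z. g z * indicator {x..y} z \<partial>lborel)"
      by (intro nn_integral_cong_AE, eventually_elim) (auto simp: h_def indicator_def less_top)
    with int have "((\<lambda>z. h z * indicator {x..y} z) has_integral (F y - F x)) UNIV"
      using F(1) that by (intro nn_integral_has_integral) (auto simp: h_def dest: monoD)
    then have "((\<lambda>z. if z \<in> {x..y} then h z else 0) has_integral (F y - F x)) UNIV"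
      by (rule has_integral_eq [rotated]) auto
    then show ?thesis by (simp only: has_integral_restrict_UNIV)
  qed
  show thesis
  proof (rule that)
    fix x y :: real assume "x \<le> y"
    then show "h absolutely_integrable_on {x..y}"
      using * [of x y] by (intro nonnegative_absolutely_integrable_1) (auto simp: h_def)
    show "F y - F x = integral {x..y} h" using * [OF \<open>x \<le> y\<close>] by (simp add: integral_unique)
  qed
qed

text \<open>Both the variation from \<open>c\<close> and its difference with \<open>f\<close> are
  monotone, and \<open>f\<close> is the difference of the two. Constancy to the left of
  \<open>c\<close> gives monotonicity on the whole line, because the variation from \<open>c\<close>
  is 0 there.\<close>

lemma abs_cont_integral:
  assumes f: "abs_cont f" and const: "\<And>x. x \<le> c \<Longrightarrow> f x = f c"
  obtains g :: "real \<Rightarrow> real" where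
    "\<And>x y. x \<le> y \<Longrightarrow> g absolutely_integrable_on {x..y}"
    "\<And>x y. x \<le> y \<Longrightarrow> f y - f x = integral {x..y} g"
proof -
  let ?V = "variation f c"
  have *: "\<bar>f y - f x\<bar> \<le> ?V y - ?V x" if "x \<le> y" for x y
  proof -
    consider "c \<le> x" | "x < c" "c \<le> y" | "y < c" by linarith
    then show ?thesis
    proof cases
      case 1
      then show ?thesis using variation_add [OF f 1 that] abs_le_variation [OF f that] by linarith
    next
      case 2
      then show ?thesis using abs_le_variation [OF f 2(2)] const [of x] variation_trivial [of x c f] by simp
    next
      case 3
      then show ?thesis using that const [of x] const [of y] variation_trivial [of x c f] variation_trivial [of y c f] by simp
    qed
  qed
  have "mono ?V" by (rule monoI) (use * in fastforce)
  then obtain g1 where g1: "\<And>x y. x \<le> y \<Longrightarrow> g1 absolutely_integrable_on {x..y}"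
    "\<And>x y. x \<le> y \<Longrightarrow> ?V y - ?V x = integral {x..y} g1"
    using mono_abs_cont_integral [OF _ abs_cont_variation [OF f]] by blast
  have "mono (\<lambda>x. ?V x - f x)" by (rule monoI) (use * in fastforce)
  then obtain g2 where g2: "\<And>x y. x \<le> y \<Longrightarrow> g2 absolutely_integrable_on {x..y}"
    "\<And>x y. x \<le> y \<Longrightarrow> (?V y - f y) - (?V x - f x) = integral {x..y} g2"
    using mono_abs_cont_integral [OF _ abs_cont_diff [OF abs_cont_variation [OF f] f]] by blast
  show thesis
  proof (rule that)
    fix x y :: real assume le: "x \<le> y"
    show "(\<lambda>x. g1 x - g2 x) absolutely_integrable_on {x..y}"
      by (rule set_integral_diff(1) [OF g1(1) g2(1)]) (use le in auto)
    show "f y - f x = integral {x..y} (\<lambda>x. g1 x - g2 x)"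
      using g1 [OF le] g2 [OF le] by (subst Henstock_Kurzweil_Integration.integral_diff)
        (auto dest: absolutely_integrable_on_def [THEN iffD1])
  qed
qed

lemma ac_on_abs_cont_clamp:
  assumes ac: "ac_on c d f" and cd: "c \<le> d" and N: "\<And>z w. \<bar>N z - N w\<bar> \<le> norm (z - w)"
  shows "abs_cont (\<lambda>x. N (f (max c (min d x))))"
  unfolding abs_cont_def
proof (intro allI impI)
  fix \<epsilon> :: real assume "\<epsilon> > 0"
  then have "\<exists>\<delta>>0. \<forall>(n::nat) (s::nat \<Rightarrow> real) t.
        (\<forall>i<n. c \<le> s i \<and> s i \<le> t i \<and> t i \<le> d) \<and>
        disjoint_family_on (\<lambda>i. {s i<..<t i}) {..<n} \<and>
        (\<Sum>i<n. t i - s i) < \<delta>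
        \<longrightarrow> (\<Sum>i<n. norm (f (t i) - f (s i))) < \<epsilon>"
    by (rule ac [unfolded ac_on_def, THEN spec, THEN mp])
  then obtain \<delta> where \<delta>: "\<delta> > 0" and ac': "\<forall>(n::nat) (s::nat \<Rightarrow> real) t.
        (\<forall>i<n. c \<le> s i \<and> s i \<le> t i \<and> t i \<le> d) \<and>
        disjoint_family_on (\<lambda>i. {s i<..<t i}) {..<n} \<and>
        (\<Sum>i<n. t i - s i) < \<delta>
        \<longrightarrow> (\<Sum>i<n. norm (f (t i) - f (s i))) < \<epsilon>" by (elim exE conjE)
  let ?k = "\<lambda>x. max c (min d x)"
  have "oscillation (\<lambda>x. N (f (?k x))) P < \<epsilon>" if P: "nonoverlapping P" "total_length P < \<delta>" for P
  proof -
    have "finite P" using P(1) by (simp add: nonoverlapping_def)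
    then obtain h where h: "bij_betw h {0..<card P} P" using ex_bij_betw_nat_finite by blast
    let ?n = "card P" and ?s = "\<lambda>i. ?k (fst (h i))" and ?t = "\<lambda>i. ?k (snd (h i))"
    have hP: "h i \<in> P" if "i < ?n" for i using h that by (auto simp: bij_betw_def)
    have len: "total_length P = (\<Sum>i<?n. snd (h i) - fst (h i))"
      unfolding total_length_def split_def
      using sum.reindex_bij_betw [OF h, of "\<lambda>p. snd p - fst p"] by (simp add: lessThan_atLeast0)
    have osc: "oscillation (\<lambda>x. N (f (?k x))) P = (\<Sum>i<?n. \<bar>N (f (?t i)) - N (f (?s i))\<bar>)"
      unfolding oscillation_def split_def
      using sum.reindex_bij_betw [OF h, of "\<lambda>p. \<bar>N (f (?k (snd p))) - N (f (?k (fst p)))\<bar>"]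
      by (simp add: lessThan_atLeast0)
    have "disjoint_family_on (\<lambda>i. {?s i<..<?t i}) {..<?n}"
      unfolding disjoint_family_on_def
    proof (intro ballI impI)
      fix i j assume ij: "i \<in> {..<?n}" "j \<in> {..<?n}" "i \<noteq> j"
      then have "h i \<noteq> h j" using h by (auto simp: bij_betw_def inj_on_def)
      then have "snd (h i) \<le> fst (h j) \<or> snd (h j) \<le> fst (h i)"
        using P(1) hP [of i] hP [of j] ij unfolding nonoverlapping_def by (metis lessThan_iff prod.collapse)
      then have "?t i \<le> ?s j \<or> ?t j \<le> ?s i" by linarith
      moreover have "{a<..<b} \<inter> {a'<..<b'} = {}" if "b \<le> a' \<or> b' \<le> a" for a b a' b' :: real
        using that by auto
      ultimately show "{?s i<..<?t i} \<inter> {?s j<..<?t j} = {}" by blast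
    qed
    moreover have "(\<Sum>i<?n. ?t i - ?s i) \<le> total_length P"
      unfolding len
    proof (rule sum_mono)
      fix i assume "i \<in> {..<?n}"
      then have "fst (h i) < snd (h i)" using hP [of i] nonoverlapping_less [OF P(1)] by simp
      then show "?t i - ?s i \<le> snd (h i) - fst (h i)" by linarith
    qed
    moreover have "\<forall>i<?n. c \<le> ?s i \<and> ?s i \<le> ?t i \<and> ?t i \<le> d"
    proof (intro allI impI)
      fix i assume "i < ?n"
      then have "fst (h i) < snd (h i)" using hP [of i] nonoverlapping_less [OF P(1)] by simp
      then show "c \<le> ?s i \<and> ?s i \<le> ?t i \<and> ?t i \<le> d" using cd by auto
    qed
    ultimately have "(\<Sum>i<?n. norm (f (?t i) - f (?s i))) < \<epsilon>"
      using P(2) by (intro ac' [rule_format, of ?n ?s ?t] conjI) auto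
    moreover have "oscillation (\<lambda>x. N (f (?k x))) P \<le> (\<Sum>i<?n. norm (f (?t i) - f (?s i)))"
      unfolding osc using N by (intro sum_mono) auto
    ultimately show ?thesis by linarith
  qed
  then show "\<exists>\<delta>>0. \<forall>P. nonoverlapping P \<and> total_length P < \<delta> \<longrightarrow> oscillation (\<lambda>x. N (f (?k x))) P < \<epsilon>"
    using \<delta> by blast
qed

lemma ac_on_imp_integral:
  assumes ac: "ac_on c d f" and cd: "c \<le> d"
  obtains g :: "real \<Rightarrow> complex" where
    "g absolutely_integrable_on {c..d}"
    "\<And>x y. c \<le> x \<Longrightarrow> x \<le> y \<Longrightarrow> y \<le> d \<Longrightarrow> f y - f x = integral {x..y} g"
proof -
  let ?k = "\<lambda>x. max c (min d x)"
  have "\<bar>Re z - Re w\<bar> \<le> norm (z - w)" for z w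
    using abs_Re_le_cmod [of "z - w"] by simp
  from ac_on_abs_cont_clamp [OF ac cd this]
  obtain g1 where g1: "\<And>x y. x \<le> y \<Longrightarrow> g1 absolutely_integrable_on {x..y}"
    "\<And>x y. x \<le> y \<Longrightarrow> Re (f (?k y)) - Re (f (?k x)) = integral {x..y} g1"
    by (rule abs_cont_integral [where c = c]) (use cd in auto)
  have "\<bar>Im z - Im w\<bar> \<le> norm (z - w)" for z w
    using abs_Im_le_cmod [of "z - w"] by simp
  from ac_on_abs_cont_clamp [OF ac cd this]
  obtain g2 where g2: "\<And>x y. x \<le> y \<Longrightarrow> g2 absolutely_integrable_on {x..y}"
    "\<And>x y. x \<le> y \<Longrightarrow> Im (f (?k y)) - Im (f (?k x)) = integral {x..y} g2"
    by (rule abs_cont_integral [where c = c]) (use cd in auto)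
  let ?g = "\<lambda>x. complex_of_real (g1 x) + \<i> * complex_of_real (g2 x)"
  have ai: "(\<lambda>x. complex_of_real (g1 x)) absolutely_integrable_on {x..y}"
      "(\<lambda>x. \<i> * complex_of_real (g2 x)) absolutely_integrable_on {x..y}" if "x \<le> y" for x y
  proof -
    have "(complex_of_real \<circ> g1) absolutely_integrable_on {x..y}"
      by (rule absolutely_integrable_linear [OF g1(1) [OF that] bounded_linear_of_real])
    then show "(\<lambda>x. complex_of_real (g1 x)) absolutely_integrable_on {x..y}" by (simp add: o_def)
    have "((\<lambda>x. \<i> * complex_of_real x) \<circ> g2) absolutely_integrable_on {x..y}"
      by (rule absolutely_integrable_linear [OF g2(1) [OF that] bounded_linear_compose [OF bounded_linear_mult_right bounded_linear_of_real]])
    then show "(\<lambda>x. \<i> * complex_of_real (g2 x)) absolutely_integrable_on {x..y}" by (simp add: o_def)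
  qed
  show thesis
  proof (rule that)
    show "?g absolutely_integrable_on {c..d}" using ai [OF cd] by (rule set_integral_add(1))
    fix x y assume xy: "c \<le> x" "x \<le> y" "y \<le> d"
    have "?k x = x" "?k y = y" using xy by auto
    then have "f y - f x = complex_of_real (integral {x..y} g1) + \<i> * complex_of_real (integral {x..y} g2)"
      using g1(2) [OF xy(2)] g2(2) [OF xy(2)] by (auto simp: complex_eq_iff)
    also have "\<dots> = integral {x..y} ?g"
    proof (rule integral_unique [symmetric])
      have "(g1 has_integral integral {x..y} g1) {x..y}" "(g2 has_integral integral {x..y} g2) {x..y}"
        using g1(1) [OF xy(2)] g2(1) [OF xy(2)] by (auto simp: absolutely_integrable_on_def)
      then show "(?g has_integral complex_of_real (integral {x..y} g1) + \<i> * complex_of_real (integral {x..y} g2)) {x..y}"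
        by (intro has_integral_add has_integral_mult_right
            has_integral_linear [OF _ bounded_linear_of_real, unfolded o_def])
    qed
    finally show "f y - f x = integral {x..y} ?g" .
  qed
qed


section \<open>Lebesgue differentiation and primitives\<close>

text \<open>Truncation: \<open>norm (g x)\<close> is the sum of a part bounded by \<open>n\<close>
  and a remainder \<open>r\<close> of integral below \<open>\<epsilon>/2\<close>. The bounded part
  contributes at most \<open>n\<close> times the total length.\<close>

lemma integral_imp_ac_on:
  assumes g: "g absolutely_integrable_on {c..d}"
    and f: "\<And>x y. c \<le> x \<Longrightarrow> x \<le> y \<Longrightarrow> y \<le> d \<Longrightarrow> f y - f x = integral {x..y} g"
  shows "ac_on c d f"
  unfolding ac_on_def
proof (intro allI impI)
  fix \<epsilon> :: real assume \<epsilon>: "\<epsilon> > 0"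
  have ng: "(\<lambda>x. norm (g x)) absolutely_integrable_on {c..d}"
    using absolutely_integrable_norm [OF g] by (simp add: o_def)
  define k where "k n x = min (norm (g x)) (real n)" for n x
  have k_int: "k n absolutely_integrable_on {c..d}" for n
    unfolding k_def by (intro absolutely_integrable_min_1 ng) (auto intro: absolutely_integrable_continuous_real)
  have "(\<lambda>n. integral {c..d} (k n)) \<longlonglongrightarrow> integral {c..d} (\<lambda>x. norm (g x))"
  proof (rule dominated_convergence(2))
    show "k n integrable_on {c..d}" for n using k_int by (auto simp: absolutely_integrable_on_def)
    show "(\<lambda>x. norm (g x)) integrable_on {c..d}" using ng by (auto simp: absolutely_integrable_on_def)
    show "norm (k n x) \<le> norm (g x)" for n x by (auto simp: k_def)
    show "(\<lambda>n. k n x) \<longlonglongrightarrow> norm (g x)" for x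
    proof (rule tendsto_eventually)
      obtain N where "norm (g x) \<le> real N" using real_arch_simple by blast
      then show "\<forall>\<^sub>F n in sequentially. k n x = norm (g x)"
        unfolding eventually_sequentially k_def by (intro exI [of _ N]) auto
    qed
  qed
  then have "\<forall>\<^sub>F n in sequentially. integral {c..d} (\<lambda>x. norm (g x)) - \<epsilon>/2 < integral {c..d} (k n)"
    using \<epsilon> by (intro order_tendstoD) auto
  then obtain n where n: "integral {c..d} (\<lambda>x. norm (g x)) - \<epsilon>/2 < integral {c..d} (k n)"
    by (auto simp: eventually_sequentially)
  define r where "r x = norm (g x) - k n x" for x
  have r_int: "r absolutely_integrable_on {c..d}" unfolding r_def
    by (intro set_integral_diff(1) ng k_int)
  have r_pos: "0 \<le> r x" for x by (auto simp: r_def k_def)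
  have r_small: "integral {c..d} r < \<epsilon>/2" unfolding r_def
    using n ng k_int [of n] by (subst Henstock_Kurzweil_Integration.integral_diff) (auto simp: absolutely_integrable_on_def)
  \<comment> \<open>Chosen so that \<open>real n * \<delta> \<le> \<epsilon>/2\<close>; the
    \<open>+ 1\<close> covers \<open>n = 0\<close>.\<close>
  define \<delta> where "\<delta> = \<epsilon> / (2 * (real n + 1))"
  have "(\<Sum>i<m. norm (f (t i) - f (s i))) < \<epsilon>"
    if st: "\<forall>i<m. c \<le> s i \<and> s i \<le> t i \<and> t i \<le> d" and disj: "disjoint_family_on (\<lambda>i. {s i<..<t i}) {..<m}"
      and len: "(\<Sum>i<m. t i - s i) < \<delta>" for m :: nat and s t :: "nat \<Rightarrow> real"
  proof -
    have sub: "{s i..t i} \<subseteq> {c..d}" if "i < m" for i using st that by auto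
    have ri: "r integrable_on {s i..t i}" if "i < m" for i
      using absolutely_integrable_on_subinterval [OF r_int sub [OF that]] by (auto simp: absolutely_integrable_on_def)
    have bound: "norm (f (t i) - f (s i)) \<le> integral {s i..t i} r + real n * (t i - s i)" if "i < m" for i
    proof -
      have "norm (f (t i) - f (s i)) = norm (integral {s i..t i} g)" using f [of "s i" "t i"] st that by auto
      also have "\<dots> \<le> integral {s i..t i} (\<lambda>x. r x + real n)"
      proof (rule integral_norm_bound_integral)
        show "g integrable_on {s i..t i}"
          using absolutely_integrable_on_subinterval [OF g sub [OF that]] by (auto simp: absolutely_integrable_on_def)
        show "(\<lambda>x. r x + real n) integrable_on {s i..t i}" by (intro integrable_add ri that) auto
      qed (auto simp: r_def k_def)
      also have "\<dots> = integral {s i..t i} r + real n * (t i - s i)"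
        using st that ri by (subst Henstock_Kurzweil_Integration.integral_add) auto
      finally show ?thesis .
    qed
    have "(r has_integral (\<Sum>i<m. integral {s i..t i} r)) (\<Union>i<m. {s i<..<t i})"
    proof (rule has_integral_UN)
      show "(r has_integral integral {s i..t i} r) {s i<..<t i}" if "i \<in> {..<m}" for i
        using ri that has_integral_Icc_iff_Ioo has_integral_integral by (metis lessThan_iff)
      show "pairwise (\<lambda>i i'. negligible ({s i<..<t i} \<inter> {s i'<..<t i'})) {..<m}"
        using disj by (auto simp: pairwise_def disjoint_family_on_def)
    qed auto
    moreover have "(r has_integral integral {c..d} r) {c..d}"
      using r_int by (auto simp: absolutely_integrable_on_def)
    moreover have "(\<Union>i<m. {s i<..<t i}) \<subseteq> {c..d}" using st by fastforce
    ultimately have "(\<Sum>i<m. integral {s i..t i} r) \<le> integral {c..d} r"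
      using r_pos by (rule_tac has_integral_subset_le) auto
    moreover have "(\<Sum>i<m. norm (f (t i) - f (s i))) \<le> (\<Sum>i<m. integral {s i..t i} r + real n * (t i - s i))"
      using bound by (intro sum_mono) auto
    moreover have "\<dots> = (\<Sum>i<m. integral {s i..t i} r) + real n * (\<Sum>i<m. t i - s i)"
      by (simp add: sum.distrib sum_distrib_left)
    moreover have "real n * (\<Sum>i<m. t i - s i) \<le> real n * \<delta>" using len by (intro mult_left_mono) auto
    moreover have "real n * \<delta> \<le> \<epsilon>/2" using \<epsilon> by (simp add: \<delta>_def field_simps)
    ultimately show ?thesis using r_small by linarith
  qed
  moreover have "\<delta> > 0" using \<epsilon> by (simp add: \<delta>_def)
  ultimately show "\<exists>\<delta>>0. \<forall>(n::nat) (s::nat \<Rightarrow> real) t.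
        (\<forall>i<n. c \<le> s i \<and> s i \<le> t i \<and> t i \<le> d) \<and> disjoint_family_on (\<lambda>i. {s i<..<t i}) {..<n} \<and>
        (\<Sum>i<n. t i - s i) < \<delta> \<longrightarrow> (\<Sum>i<n. norm (f (t i) - f (s i))) < \<epsilon>"
    by blast
qed

text \<open>The null set depends on \<open>g\<close> alone, so one set serves every local primitive
  \<open>F\<close>. Averages over \<open>{x..x+h}\<close> give the derivative from the right; the
  derivative from the left comes from the reflected function, whose exceptional set is mirrored
  back.\<close>

lemma lebesgue_differentiation:
  fixes g :: "real \<Rightarrow> complex"
  assumes g: "\<And>c d. g integrable_on {c..d}"
  obtains N where "negligible N"
    "\<And>x F e. x \<notin> N \<Longrightarrow> 0 < e \<Longrightarrow>
      (\<And>y z. x - e < y \<Longrightarrow> y \<le> z \<Longrightarrow> z < x + e \<Longrightarrow> F z - F y = integral {y..z} g) \<Longrightarrow>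
      (F has_vector_derivative g x) (at x)"
proof -
  have "\<And>c d. g integrable_on cbox c d" using g by simp
  then obtain N1 where N1: "negligible N1" "\<And>x e. x \<notin> N1 \<Longrightarrow> 0 < e \<Longrightarrow>
      \<exists>d>0. \<forall>h. 0 < h \<and> h < d \<longrightarrow> norm (integral (cbox x (x + h *\<^sub>R One)) g /\<^sub>R h ^ DIM(real) - g x) < e"
    by (rule integrable_ccontinuous_explicit) blast
  have "(\<lambda>x. g (-x)) integrable_on cbox c d" for c d
    using Henstock_Kurzweil_Integration.integrable_reflect_real [where f = g and a = "-d" and b = "-c"] g [of "-d" "-c"] by simp
  then obtain N2 where N2: "negligible N2" "\<And>x e. x \<notin> N2 \<Longrightarrow> 0 < e \<Longrightarrow>
      \<exists>d>0. \<forall>h. 0 < h \<and> h < d \<longrightarrow>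
        norm (integral (cbox x (x + h *\<^sub>R One)) (\<lambda>x. g (-x)) /\<^sub>R h ^ DIM(real) - g (-x)) < e"
    by (rule integrable_ccontinuous_explicit) blast
  have neg: "negligible (uminus ` N2)"
    by (rule negligible_differentiable_image_negligible [OF order_refl N2(1)])
      (auto intro!: derivative_intros simp: differentiable_on_def)
  show thesis
  proof (rule that)
    show "negligible (N1 \<union> uminus ` N2)" using N1(1) neg by (rule negligible_Un)
    fix x e :: real and F
    assume x: "x \<notin> N1 \<union> uminus ` N2" and e: "0 < e"
      and F: "\<And>y z. x - e < y \<Longrightarrow> y \<le> z \<Longrightarrow> z < x + e \<Longrightarrow> F z - F y = integral {y..z} g"
    have "(\<lambda>h. norm (F (x + h) - F x - h *\<^sub>R g x) / norm h) \<midarrow>0\<rightarrow> 0"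
      unfolding LIM_eq
    proof (intro allI impI)
      fix r :: real assume r: "0 < r"
      obtain d1 where d1: "d1 > 0" "\<And>h. 0 < h \<Longrightarrow> h < d1 \<Longrightarrow> norm (integral {x..x+h} g /\<^sub>R h - g x) < r"
        using N1(2) [OF _ r, of x] x by auto
      have "- x \<notin> N2" using x by (metis UnI2 image_eqI minus_minus)
      then obtain d2 where d2: "d2 > 0"
        "\<And>h. 0 < h \<Longrightarrow> h < d2 \<Longrightarrow> norm (integral {-x..-x+h} (\<lambda>x. g (-x)) /\<^sub>R h - g x) < r"
        using N2(2) [OF _ r, of "-x"] by auto
      have *: "norm (D - h *\<^sub>R g x) / norm h = norm (D /\<^sub>R h - g x)" if "h \<noteq> 0" for D and h :: real
      proof -
        have "D - h *\<^sub>R g x = h *\<^sub>R (D /\<^sub>R h - g x)" using that by (simp add: scaleR_diff_right)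
        then show ?thesis using that by (metis norm_scaleR nonzero_mult_div_cancel_left norm_eq_zero real_norm_def)
      qed
      have "norm (F (x + h) - F x - h *\<^sub>R g x) / norm h < r"
        if h: "h \<noteq> 0" "\<bar>h\<bar> < min e (min d1 d2)" for h
      proof (cases "h > 0")
        case True
        then show ?thesis using * [OF h(1), of "F (x + h) - F x"] F [of x "x + h"] d1(2) [of h] h by auto
      next
        case False
        define k where "k = - h"
        have k: "k > 0" "k < e" "k < d2" "h = - k" using False h by (auto simp: k_def)
        have "F x - F (x - k) = integral {x - k..x} g" using F [of "x - k" x] k by auto
        also have "\<dots> = integral {-x..-x+k} (\<lambda>x. g (-x))"
          using Henstock_Kurzweil_Integration.integral_reflect_real [of x "x - k" g] by (simp add: algebra_simps)
        finally have "norm ((F x - F (x - k)) /\<^sub>R k - g x) < r" using d2(2) [of k] k by simp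
        then show ?thesis using * [OF h(1), of "F (x + h) - F x"] k by (simp add: scaleR_diff_right algebra_simps)
      qed
      then show "\<exists>s>0. \<forall>h. h \<noteq> 0 \<and> norm (h - 0) < s \<longrightarrow>
           norm (norm (F (x + h) - F x - h *\<^sub>R g x) / norm h - 0) < r"
        using e d1(1) d2(1) by (intro exI [of _ "min e (min d1 d2)"]) auto
    qed
    then show "(F has_vector_derivative g x) (at x)"
      unfolding has_vector_derivative_def has_derivative_at by (simp add: bounded_linear_scaleR_left)
  qed
qed

lemma AE_lebesgue_on_iff_negligible:
  assumes "S \<in> sets lebesgue"
  shows "(AE x in lebesgue_on S. P x) \<longleftrightarrow> negligible {x\<in>S. \<not> P x}"
proof -
  have "(AE x in lebesgue_on S. P x) \<longleftrightarrow> (AE x in lebesgue. x \<in> S \<longrightarrow> P x)"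
    using assms by (subst AE_restrict_space_iff) auto
  also have "\<dots> \<longleftrightarrow> negligible {x\<in>S. \<not> P x}"
  proof -
    have eq: "{x \<in> space lebesgue. \<not> (x \<in> S \<longrightarrow> P x)} = {x\<in>S. \<not> P x}" by auto
    show ?thesis
      unfolding eventually_ae_filter eq
    proof
      assume "\<exists>N\<in>null_sets lebesgue. {x\<in>S. \<not> P x} \<subseteq> N"
      then obtain N where "N \<in> null_sets lebesgue" "{x\<in>S. \<not> P x} \<subseteq> N" by blast
      then show "negligible {x\<in>S. \<not> P x}" using negligible_subset negligible_iff_null_sets by metis
    next
      assume "negligible {x\<in>S. \<not> P x}"
      then have "{x\<in>S. \<not> P x} \<in> null_sets lebesgue" by (simp add: negligible_iff_null_sets)
      then show "\<exists>N\<in>null_sets lebesgue. {x\<in>S. \<not> P x} \<subseteq> N" by blast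
    qed
  qed
  finally show ?thesis .
qed

text \<open>The working form of local absolute continuity. Keeping the integrand explicit allows it
  to be changed on null sets (\<open>primitive_on_cong_AE\<close>) and lets sums, products and
  limits be computed on integrands.\<close>

definition primitive_on :: "real set \<Rightarrow> (real \<Rightarrow> complex) \<Rightarrow> (real \<Rightarrow> complex) \<Rightarrow> bool" where
  "primitive_on S F g \<longleftrightarrow> (\<forall>c d. c \<le> d \<longrightarrow> {c..d} \<subseteq> S \<longrightarrow>
     g absolutely_integrable_on {c..d} \<and> F d - F c = integral {c..d} g)"

lemma primitive_onD:
  assumes "primitive_on S F g" "c \<le> d" "{c..d} \<subseteq> S"
  shows "g absolutely_integrable_on {c..d}" "g integrable_on {c..d}" "F d - F c = integral {c..d} g"
  using assms unfolding primitive_on_def absolutely_integrable_on_def by blast+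

lemma primitive_on_imp_ac_on:
  assumes F: "primitive_on S F g" and cd: "{c..d} \<subseteq> S"
  shows "ac_on c d F"
proof (cases "c \<le> d")
  case True
  show ?thesis
  proof (rule integral_imp_ac_on)
    show "g absolutely_integrable_on {c..d}" by (rule primitive_onD [OF F True cd])
    fix x y assume "c \<le> x" "x \<le> y" "y \<le> d"
    then show "F y - F x = integral {x..y} g" using cd by (intro primitive_onD [OF F]) auto
  qed
next
  case False
  have "n = 0" if "\<forall>i<n. c \<le> s i \<and> s i \<le> t i \<and> t i \<le> d" for n :: nat and s t :: "nat \<Rightarrow> real"
    using that False by (metis gr0I order_trans)
  then show ?thesis unfolding ac_on_def by (intro allI impI exI [of _ 1]) fastforce
qed

text \<open>\<open>lebesgue_differentiation\<close> expects an integrand on the whole line, so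
  \<open>g\<close> is set to 0 outside a segment. The segments in \<open>S\<close> with rational
  endpoints are countable and their interiors cover \<open>S\<close>; hence the exceptional sets
  unite to a null set.\<close>

lemma primitive_on_has_derivative:
  assumes F: "primitive_on S F g" and S: "open S"
  shows "AE x in lebesgue_on S. (F has_vector_derivative g x) (at x)"
proof -
  define Q where "Q = {(c,d). c \<in> \<rat> \<and> d \<in> \<rat> \<and> c < d \<and> {c..d} \<subseteq> S}"
  have "Q \<subseteq> \<rat> \<times> \<rat>" by (auto simp: Q_def)
  then have cQ: "countable Q" by (rule countable_subset) (auto intro: countable_rat)
  have "\<exists>N. negligible N \<and> (\<forall>x. x \<in> {fst p<..<snd p} - N \<longrightarrow> (F has_vector_derivative g x) (at x))"
    if "p \<in> Q" for p
  proof -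
    obtain c d where p: "p = (c,d)" by (cases p)
    have cd: "c < d" "{c..d} \<subseteq> S" using that p by (auto simp: Q_def)
    define h where "h x = (if x \<in> {c..d} then g x else 0)" for x
    have "h integrable_on UNIV"
      unfolding h_def using primitive_onD(2) [OF F less_imp_le cd(2)] cd(1)
      by (subst integrable_restrict_UNIV)
    then have "\<And>x y. h integrable_on {x..y}"
      by (metis integrable_on_subcbox interval_cbox subset_UNIV)
    then obtain N where N: "negligible N"
      "\<And>x F e. x \<notin> N \<Longrightarrow> 0 < e \<Longrightarrow>
        (\<And>y z. x - e < y \<Longrightarrow> y \<le> z \<Longrightarrow> z < x + e \<Longrightarrow> F z - F y = integral {y..z} h) \<Longrightarrow>
        (F has_vector_derivative h x) (at x)"
      by (rule lebesgue_differentiation) blast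
    have "(F has_vector_derivative g x) (at x)" if x: "x \<in> {c<..<d} - N" for x
    proof -
      have "(F has_vector_derivative h x) (at x)"
      proof (rule N(2) [of x "min (x - c) (d - x)"])
        fix y z assume yz: "x - min (x - c) (d - x) < y" "y \<le> z" "z < x + min (x - c) (d - x)"
        then have sub: "{y..z} \<subseteq> {c..d}" by auto
        have "F z - F y = integral {y..z} g" using primitive_onD(3) [OF F yz(2)] sub cd(2) by blast
        also have "\<dots> = integral {y..z} h" by (rule integral_cong) (use sub in \<open>auto simp: h_def\<close>)
        finally show "F z - F y = integral {y..z} h" .
      qed (use x in auto)
      moreover have "h x = g x" using x by (simp add: h_def)
      ultimately show ?thesis by simp
    qed
    then show ?thesis using N(1) p by auto
  qed
  then obtain N where N: "\<And>p. p \<in> Q \<Longrightarrow> negligible (N p)"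
    "\<And>p x. p \<in> Q \<Longrightarrow> x \<in> {fst p<..<snd p} - N p \<Longrightarrow> (F has_vector_derivative g x) (at x)" by metis
  have "negligible (\<Union>p\<in>Q. N p)" using N(1) cQ by (intro negligible_countable_Union) auto
  moreover have "{x\<in>S. \<not> (F has_vector_derivative g x) (at x)} \<subseteq> (\<Union>p\<in>Q. N p)"
  proof (rule subsetI, rule ccontr)
    fix x assume "x \<in> {x\<in>S. \<not> (F has_vector_derivative g x) (at x)}" and xN: "x \<notin> (\<Union>p\<in>Q. N p)"
    then have x: "x \<in> S" "\<not> (F has_vector_derivative g x) (at x)" by auto
    obtain e where e: "e > 0" "cball x e \<subseteq> S" using S x(1) open_contains_cball by blast
    obtain c where c: "c \<in> \<rat>" "x - e < c" "c < x" using Rats_dense_in_real [of "x - e" x] e by auto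
    obtain d where d: "d \<in> \<rat>" "x < d" "d < x + e" using Rats_dense_in_real [of x "x + e"] e by auto
    have "{c..d} \<subseteq> cball x e" using c d by (auto simp: dist_real_def)
    then have "(c,d) \<in> Q" using c d e by (auto simp: Q_def)
    then show False using N(2) [of "(c,d)" x] x xN c d by auto
  qed
  ultimately have "negligible {x\<in>S. \<not> (F has_vector_derivative g x) (at x)}"
    using negligible_subset by blast
  then show ?thesis using S by (subst AE_lebesgue_on_iff_negligible) auto
qed

lemma primitive_on_cong_AE:
  assumes F: "primitive_on S F g" and S: "S \<in> sets lebesgue" and eq: "AE x in lebesgue_on S. g x = g' x"
  shows "primitive_on S F g'"
  unfolding primitive_on_def
proof (intro allI impI)
  fix c d :: real assume cd: "c \<le> d" "{c..d} \<subseteq> S"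
  have N: "negligible {x\<in>S. g x \<noteq> g' x}" using eq AE_lebesgue_on_iff_negligible [OF S, of "\<lambda>x. g x = g' x"] by simp
  have "g' absolutely_integrable_on {c..d}"
    by (rule absolutely_integrable_spike [OF primitive_onD(1) [OF F cd] N]) (use cd in auto)
  moreover have "integral {c..d} g = integral {c..d} g'"
    by (rule integral_spike [OF N]) (use cd in auto)
  ultimately show "g' absolutely_integrable_on {c..d} \<and> F d - F c = integral {c..d} g'"
    using primitive_onD(3) [OF F cd] by simp
qed

text \<open>\<open>ac_on_imp_integral\<close> supplies a separate integrand for each segment. Each
  of them agrees a.e. with the derivative of \<open>F\<close>, which is therefore one integrand for
  all segments.\<close>

lemma ac_on_imp_primitive_on:
  assumes S: "open S" and ac: "\<And>c d. {c..d} \<subseteq> S \<Longrightarrow> ac_on c d F"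
  shows "primitive_on S F (\<lambda>x. vector_derivative F (at x))"
  unfolding primitive_on_def
proof (intro allI impI)
  fix c d :: real assume cd: "c \<le> d" "{c..d} \<subseteq> S"
  let ?D = "\<lambda>x. vector_derivative F (at x)"
  obtain g where g: "g absolutely_integrable_on {c..d}"
    "\<And>x y. c \<le> x \<Longrightarrow> x \<le> y \<Longrightarrow> y \<le> d \<Longrightarrow> F y - F x = integral {x..y} g"
    using ac_on_imp_integral [OF ac [OF cd(2)] cd(1)] by blast
  have "primitive_on {c<..<d} F g"
    unfolding primitive_on_def
  proof (intro allI impI conjI)
    fix x y assume xy: "x \<le> y" "{x..y} \<subseteq> {c<..<d}"
    then have "{x..y} \<subseteq> {c..d}" "c \<le> x" "y \<le> d" by auto
    then show "g absolutely_integrable_on {x..y}" "F y - F x = integral {x..y} g"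
      using absolutely_integrable_on_subinterval [OF g(1)] g(2) [of x y] xy(1) by auto
  qed
  then have "negligible {x\<in>{c<..<d}. \<not> (F has_vector_derivative g x) (at x)}"
    using primitive_on_has_derivative [of "{c<..<d}" F g] AE_lebesgue_on_iff_negligible [of "{c<..<d}"] by simp
  \<comment> \<open>Differentiability is known only inside the segment, so the two endpoints join
    the null set.\<close>
  then have N: "negligible ({x\<in>{c<..<d}. \<not> (F has_vector_derivative g x) (at x)} \<union> {c,d})"
    by (intro negligible_Un) auto
  have eq: "?D x = g x" if "x \<in> {c..d} - ({x\<in>{c<..<d}. \<not> (F has_vector_derivative g x) (at x)} \<union> {c,d})" for x
    using that by (intro vector_derivative_at) auto
  have "?D absolutely_integrable_on {c..d}"
    by (rule absolutely_integrable_spike [OF g(1) N]) (rule eq)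
  moreover have "integral {c..d} g = integral {c..d} ?D"
    by (rule integral_spike [OF N]) (rule eq)
  ultimately show "?D absolutely_integrable_on {c..d} \<and> F d - F c = integral {c..d} ?D"
    using g(2) [of c d] cd by simp
qed

lemma primitive_on_derivative:
  assumes "primitive_on S F g" "open S"
  shows "AE x in lebesgue_on S. vector_derivative F (at x) = g x"
  using primitive_on_has_derivative [OF assms] by eventually_elim (rule vector_derivative_at)

lemma primitive_on_continuous:
  assumes F: "primitive_on S F g" and S: "open S"
  shows "continuous_on S F"
proof (rule continuous_at_imp_continuous_on, rule ballI)
  fix x assume "x \<in> S"
  then obtain e where e: "e > 0" "cball x e \<subseteq> S" using S open_contains_cball by blast
  then have sub: "{x-e..x+e} \<subseteq> S" by (simp add: cball_eq_atLeastAtMost)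
  have "continuous_on {x-e..x+e} (\<lambda>t. F (x-e) + integral {x-e..t} g)"
    by (intro continuous_intros indefinite_integral_continuous_1 primitive_onD(2) [OF F _ sub]) (use e in auto)
  moreover have "F (x-e) + integral {x-e..t} g = F t" if "t \<in> {x-e..x+e}" for t
  proof -
    have "{x-e..t} \<subseteq> S" using that sub by fastforce
    then show ?thesis using primitive_onD(3) [OF F, of "x-e" t] that by (auto simp: algebra_simps)
  qed
  ultimately have "continuous_on {x-e..x+e} F" by (rule continuous_on_eq)
  then show "isCont F x" using e(1)
    by (intro continuous_on_interior [of "{x-e..x+e}"]) auto
qed

section \<open>Linearity and product rule for primitives\<close>

lemma primitive_on_cong:
  assumes "primitive_on S F g" "\<And>x. x \<in> S \<Longrightarrow> F x = F' x"
  shows "primitive_on S F' g"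
  using assms unfolding primitive_on_def by (metis atLeastAtMost_iff order_refl subsetD)

lemma primitive_on_add:
  assumes "primitive_on S F f" "primitive_on S G g"
  shows "primitive_on S (\<lambda>x. F x + G x) (\<lambda>x. f x + g x)"
  unfolding primitive_on_def
proof (intro allI impI conjI)
  fix c d :: real assume cd: "c \<le> d" "{c..d} \<subseteq> S"
  note F = primitive_onD [OF assms(1) cd] and G = primitive_onD [OF assms(2) cd]
  show "(\<lambda>x. f x + g x) absolutely_integrable_on {c..d}" using F(1) G(1) by (rule set_integral_add(1))
  show "F d + G d - (F c + G c) = integral {c..d} (\<lambda>x. f x + g x)"
    using F G by (simp add: Henstock_Kurzweil_Integration.integral_add algebra_simps)
qed

lemma primitive_on_linear:
  assumes "primitive_on S F f" "bounded_linear T"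
  shows "primitive_on S (\<lambda>x. T (F x)) (\<lambda>x. T (f x))"
  unfolding primitive_on_def
proof (intro allI impI conjI)
  fix c d :: real assume cd: "c \<le> d" "{c..d} \<subseteq> S"
  note F = primitive_onD [OF assms(1) cd]
  show "(\<lambda>x. T (f x)) absolutely_integrable_on {c..d}"
    using absolutely_integrable_linear [OF F(1) assms(2)] by (simp add: o_def)
  show "T (F d) - T (F c) = integral {c..d} (\<lambda>x. T (f x))"
    using F integral_linear [OF F(2) assms(2)] by (simp add: o_def linear_diff bounded_linear.linear [OF assms(2)] flip: linear_diff)
qed

lemma primitive_on_const: "primitive_on S (\<lambda>_. k) (\<lambda>_. 0)"
  unfolding primitive_on_def by (auto simp: absolutely_integrable_on_def)

lemma primitive_on_cmult: "primitive_on S F f \<Longrightarrow> primitive_on S (\<lambda>x. k * F x) (\<lambda>x. k * f x)"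
  by (rule primitive_on_linear [OF _ bounded_linear_mult_right])

lemma primitive_on_cnj: "primitive_on S F f \<Longrightarrow> primitive_on S (\<lambda>x. cnj (F x)) (\<lambda>x. cnj (f x))"
  by (rule primitive_on_linear [OF _ bounded_linear_cnj])

lemma primitive_on_diff:
  assumes "primitive_on S F f" "primitive_on S G g"
  shows "primitive_on S (\<lambda>x. F x - G x) (\<lambda>x. f x - g x)"
  using primitive_on_add [OF assms(1) primitive_on_cmult [OF assms(2), of "-1"]] by simp

lemma ac_on_mult:
  assumes f: "ac_on c d f" "continuous_on {c..d} f" and g: "ac_on c d g" "continuous_on {c..d} g"
  shows "ac_on c d (\<lambda>x. f x * g x)"
proof -
  have "\<exists>B>0. \<forall>x\<in>{c..d}. norm (h x) \<le> B" if "continuous_on {c..d} h" for h :: "real \<Rightarrow> complex"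
    using compact_imp_bounded [OF compact_continuous_image [OF that compact_Icc]]
    by (auto simp: bounded_pos)
  then obtain A B where A: "A > 0" "\<And>x. x \<in> {c..d} \<Longrightarrow> norm (f x) \<le> A"
    and B: "B > 0" "\<And>x. x \<in> {c..d} \<Longrightarrow> norm (g x) \<le> B" using f(2) g(2) by metis
  show ?thesis
    unfolding ac_on_def
  proof (intro allI impI)
    fix \<epsilon> :: real assume \<epsilon>: "\<epsilon> > 0"
    then have e: "\<epsilon> / (2 * B) > 0" "\<epsilon> / (2 * A) > 0" using A B by auto
    let ?P = "\<lambda>\<delta> n (s::nat \<Rightarrow> real) t. (\<forall>i<n::nat. c \<le> s i \<and> s i \<le> t i \<and> t i \<le> d) \<and>
      disjoint_family_on (\<lambda>i. {s i<..<t i}) {..<n} \<and> (\<Sum>i<n. t i - s i) < \<delta>"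
    obtain \<delta>1 where d1: "\<delta>1 > 0" "\<forall>n s t. ?P \<delta>1 n s t \<longrightarrow> (\<Sum>i<n. norm (f (t i) - f (s i))) < \<epsilon> / (2*B)"
      using f(1) [unfolded ac_on_def, THEN spec, THEN mp, OF e(1)] by (elim exE conjE) 
    obtain \<delta>2 where d2: "\<delta>2 > 0" "\<forall>n s t. ?P \<delta>2 n s t \<longrightarrow> (\<Sum>i<n. norm (g (t i) - g (s i))) < \<epsilon> / (2*A)"
      using g(1) [unfolded ac_on_def, THEN spec, THEN mp, OF e(2)] by (elim exE conjE) 
    show "\<exists>\<delta>>0. \<forall>n s t. ?P \<delta> n s t \<longrightarrow> (\<Sum>i<n. norm (f (t i) * g (t i) - f (s i) * g (s i))) < \<epsilon>"
    proof (intro exI [of _ "min \<delta>1 \<delta>2"] conjI allI impI)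
      show "0 < min \<delta>1 \<delta>2" using d1 d2 by simp
      fix n :: nat and s t :: "nat \<Rightarrow> real" assume P: "?P (min \<delta>1 \<delta>2) n s t"
      have *: "norm (f y * g y - f x * g x) \<le> B * norm (f y - f x) + A * norm (g y - g x)"
        if "x \<in> {c..d}" "y \<in> {c..d}" for x y
      proof -
        have "f y * g y - f x * g x = (f y - f x) * g y + f x * (g y - g x)" by (simp add: algebra_simps)
        then have "norm (f y * g y - f x * g x) \<le> norm (f y - f x) * norm (g y) + norm (f x) * norm (g y - g x)"
          by (metis norm_mult norm_triangle_ineq)
        also have "\<dots> \<le> norm (f y - f x) * B + A * norm (g y - g x)"
          using A B that by (intro add_mono mult_mono) (auto intro: less_imp_le)
        finally show ?thesis by (simp add: mult.commute)
      qed
      have "(\<Sum>i<n. norm (f (t i) * g (t i) - f (s i) * g (s i)))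
         \<le> (\<Sum>i<n. B * norm (f (t i) - f (s i)) + A * norm (g (t i) - g (s i)))"
        using P by (intro sum_mono *) (auto intro: order_trans)
      also have "\<dots> = B * (\<Sum>i<n. norm (f (t i) - f (s i))) + A * (\<Sum>i<n. norm (g (t i) - g (s i)))"
        by (simp add: sum.distrib sum_distrib_left)
      also have "\<dots> < B * (\<epsilon> / (2*B)) + A * (\<epsilon> / (2*A))"
        using d1(2) [rule_format, of n s t] d2(2) [rule_format, of n s t] P A(1) B(1)
        by (intro add_strict_mono mult_strict_left_mono) auto
      also have "\<dots> = \<epsilon>" using A(1) B(1) by simp
      finally show "(\<Sum>i<n. norm (f (t i) * g (t i) - f (s i) * g (s i))) < \<epsilon>" .
    qed
  qed
qed

text \<open>The product is absolutely continuous on segments, hence the integral of its a.e.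
  derivative; that derivative is read off from the pointwise product rule.\<close>

lemma primitive_on_mult:
  assumes F: "primitive_on S F f" and G: "primitive_on S G g" and S: "open S"
  shows "primitive_on S (\<lambda>x. F x * G x) (\<lambda>x. f x * G x + F x * g x)"
proof (rule primitive_on_cong_AE)
  show "primitive_on S (\<lambda>x. F x * G x) (\<lambda>x. vector_derivative (\<lambda>x. F x * G x) (at x))"
    using F G primitive_on_continuous [OF F S] primitive_on_continuous [OF G S]
    by (intro ac_on_imp_primitive_on [OF S] ac_on_mult primitive_on_imp_ac_on)
      (auto intro: continuous_on_subset)
  show "AE x in lebesgue_on S. vector_derivative (\<lambda>x. F x * G x) (at x) = f x * G x + F x * g x"
    using primitive_on_has_derivative [OF F S] primitive_on_has_derivative [OF G S]
  proof eventually_elim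
    case (elim x)
    show ?case using has_vector_derivative_mult [OF elim]
      by (intro vector_derivative_at) (simp add: add.commute)
  qed
qed (use S in auto)


section \<open>Linear systems with integrable coefficients\<close>

lemma absolutely_integrable_mult_continuous:
  fixes g F :: "real \<Rightarrow> complex"
  assumes g: "g absolutely_integrable_on {c..d}" and F: "continuous_on {c..d} F"
  shows "(\<lambda>x. g x * F x) absolutely_integrable_on {c..d}"
proof -
  have "F \<in> borel_measurable (lebesgue_on {c..d})"
    by (rule continuous_imp_measurable_on_sets_lebesgue [OF F]) auto
  moreover have "bounded (F ` {c..d})"
    by (intro compact_imp_bounded compact_continuous_image F) auto
  ultimately have "(\<lambda>x. F x * g x) absolutely_integrable_on {c..d}"
    using g by (intro absolutely_integrable_bounded_measurable_product [OF bilinear_times]) auto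
  then show ?thesis by (simp add: mult.commute)
qed

definition locally_integrable_on :: "real set \<Rightarrow> (real \<Rightarrow> complex) \<Rightarrow> bool" where
  "locally_integrable_on S g \<longleftrightarrow> (\<forall>c d. c \<le> d \<longrightarrow> {c..d} \<subseteq> S \<longrightarrow> g absolutely_integrable_on {c..d})"

lemma locally_integrable_mult_continuous:
  assumes "locally_integrable_on S g" "continuous_on S F"
  shows "locally_integrable_on S (\<lambda>x. g x * F x)"
  using assms unfolding locally_integrable_on_def
  by (blast intro: absolutely_integrable_mult_continuous continuous_on_subset)

text \<open>The signed integral from \<open>x0\<close> to \<open>x\<close>: for
  \<open>x \<noteq> x0\<close> one of the two segments is empty, and at \<open>x0\<close> both
  integrals vanish.\<close>

definition oriented_integral :: "real \<Rightarrow> (real \<Rightarrow> complex) \<Rightarrow> real \<Rightarrow> complex" where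
  "oriented_integral x0 g x = integral {x0..x} g - integral {x..x0} g"

lemma is_interval_segment:
  fixes S :: "real set"
  assumes "is_interval S" "c \<in> S" "d \<in> S"
  shows "{c..d} \<subseteq> S"
  using mem_is_interval_1_I [OF assms] by auto

lemma primitive_on_oriented_integral:
  assumes S: "is_interval S" "x0 \<in> S" and g: "locally_integrable_on S g"
  shows "primitive_on S (oriented_integral x0 g) g"
  unfolding primitive_on_def
proof (intro allI impI conjI)
  fix c d :: real assume cd: "c \<le> d" "{c..d} \<subseteq> S"
  show "g absolutely_integrable_on {c..d}" using g cd by (simp add: locally_integrable_on_def)
  have int: "g integrable_on {x..y}" if "x \<in> S" "y \<in> S" for x y
  proof (cases "x \<le> y")
    case True
    have "{x..y} \<subseteq> S" using S(1) that by (rule is_interval_segment)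
    then show ?thesis using g True unfolding locally_integrable_on_def absolutely_integrable_on_def by blast
  qed auto
  have mem: "c \<in> S" "d \<in> S" using cd by auto
  consider "x0 \<le> c" | "c < x0" "x0 < d" | "d \<le> x0" by linarith
  then show "oriented_integral x0 g d - oriented_integral x0 g c = integral {c..d} g"
  proof cases
    case 1
    have "integral {c..x0} g = 0" "integral {d..x0} g = 0" 
      using 1 cd(1) by (cases "c = x0"; cases "d = x0"; simp)+
    then show ?thesis
      using Henstock_Kurzweil_Integration.integral_combine [OF 1 cd(1) int [OF S(2) mem(2)]]
      by (simp add: oriented_integral_def algebra_simps)
  next
    case 2
    then show ?thesis
      using Henstock_Kurzweil_Integration.integral_combine [OF _ _ int [OF mem], of x0]
      by (simp add: oriented_integral_def algebra_simps)
  next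
    case 3
    have "integral {x0..c} g = 0" "integral {x0..d} g = 0" 
      using 3 cd(1) by (cases "c = x0"; cases "d = x0"; simp)+
    then show ?thesis
      using Henstock_Kurzweil_Integration.integral_combine [OF cd(1) 3 int [OF mem(1) S(2)]]
      by (simp add: oriented_integral_def algebra_simps)
  qed
qed

lemma oriented_integral_self [simp]: "oriented_integral x g x = 0"
  by (simp add: oriented_integral_def)

lemma primitive_on_limit:
  assumes prim: "\<And>k. primitive_on S (F k) (g k)"
    and F: "\<And>x. x \<in> S \<Longrightarrow> (\<lambda>k. F k x) \<longlonglongrightarrow> G x"
    and g: "\<And>x. x \<in> S \<Longrightarrow> (\<lambda>k. g k x) \<longlonglongrightarrow> h x"
    and dom: "\<And>c d. c \<le> d \<Longrightarrow> {c..d} \<subseteq> S \<Longrightarrow>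
       \<exists>B. B integrable_on {c..d} \<and> (\<forall>k. \<forall>x\<in>{c..d}. norm (g k x) \<le> B x)"
  shows "primitive_on S G h"
  unfolding primitive_on_def
proof (intro allI impI)
  fix c d :: real assume cd: "c \<le> d" "{c..d} \<subseteq> S"
  obtain B where B: "B integrable_on {c..d}" "\<And>k x. x \<in> {c..d} \<Longrightarrow> norm (g k x) \<le> B x"
    using dom [OF cd] by blast
  have lim: "(\<lambda>k. g k x) \<longlonglongrightarrow> h x" if "x \<in> {c..d}" for x using g that cd(2) by blast
  have hB: "norm (h x) \<le> B x" if "x \<in> {c..d}" for x
    using tendsto_norm [OF lim [OF that]] B(2) [OF that] by (intro Lim_bounded) auto
  have "h absolutely_integrable_on {c..d}"
    by (rule dominated_convergence_absolutely_integrable [OF primitive_onD(1) [OF prim cd] B(1) hB lim])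
  moreover have "(\<lambda>k. integral {c..d} (g k)) \<longlonglongrightarrow> integral {c..d} h"
    by (rule dominated_convergence(2) [OF primitive_onD(2) [OF prim cd] B lim])
  moreover have "(\<lambda>k. integral {c..d} (g k)) \<longlonglongrightarrow> G d - G c"
    using tendsto_diff [OF F [of d] F [of c]] cd by (simp add: primitive_onD(3) [OF prim cd] subset_iff)
  ultimately show "h absolutely_integrable_on {c..d} \<and> G d - G c = integral {c..d} h"
    using LIMSEQ_unique by blast
qed

lemma primitive_on_power:
  assumes F: "primitive_on S F f" and S: "open S"
  shows "primitive_on S (\<lambda>x. F x ^ Suc n) (\<lambda>x. of_nat (Suc n) * (F x ^ n * f x))"
proof (induction n)
  case 0
  then show ?case using F by simp
next
  case (Suc n)
  have "primitive_on S (\<lambda>x. F x * F x ^ Suc n) (\<lambda>x. f x * F x ^ Suc n + F x * (of_nat (Suc n) * (F x ^ n * f x)))"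
    by (rule primitive_on_mult [OF F Suc S])
  moreover have "f x * F x ^ Suc n + F x * (of_nat (Suc n) * (F x ^ n * f x)) = of_nat (Suc (Suc n)) * (F x ^ Suc n * f x)" for x
    by (simp add: algebra_simps)
  ultimately show ?case by simp
qed

text \<open>The system \<open>y' = \<alpha> h\<close>, \<open>h' = \<beta> y\<close> with initial
  values \<open>y0\<close>, \<open>h0\<close> at \<open>x0\<close>. The equation
  \<open>\<ell> y = z y\<close> is the case \<open>\<alpha> = 1/p\<close>,
  \<open>\<beta> = - (q + z w)\<close>, with \<open>h\<close> the quasi-derivative.\<close>

locale linear_system =
  fixes S :: "real set" and x0 :: real and \<alpha> \<beta> :: "real \<Rightarrow> complex" and y0 h0 :: complex
  assumes S: "open S" "is_interval S" "x0 \<in> S"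
    and \<alpha>: "locally_integrable_on S \<alpha>" and \<beta>: "locally_integrable_on S \<beta>"
begin

text \<open>These are the terms of the Picard series, not its partial sums: each term is the
  integral of the preceding one, and the solution is the sum of all terms.\<close>

fun picard :: "nat \<Rightarrow> (real \<Rightarrow> complex) \<times> (real \<Rightarrow> complex)" where
  "picard 0 = (\<lambda>_. y0, \<lambda>_. h0)"
| "picard (Suc n) = (oriented_integral x0 (\<lambda>x. \<alpha> x * snd (picard n) x),
                     oriented_integral x0 (\<lambda>x. \<beta> x * fst (picard n) x))"

lemma picard_continuous: "continuous_on S (fst (picard n)) \<and> continuous_on S (snd (picard n))"
proof (induction n)
  case (Suc n)
  then show ?case
    using S \<alpha> \<beta> 
    by (auto intro!: primitive_on_continuous primitive_on_oriented_integral locally_integrable_mult_continuous)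
qed auto

lemma picard_primitive:
  "primitive_on S (fst (picard (Suc n))) (\<lambda>x. \<alpha> x * snd (picard n) x)"
  "primitive_on S (snd (picard (Suc n))) (\<lambda>x. \<beta> x * fst (picard n) x)"
  using S \<alpha> \<beta> picard_continuous [of n]
  by (auto intro!: primitive_on_oriented_integral locally_integrable_mult_continuous)

definition mass :: "real \<Rightarrow> real" where "mass x = norm (\<alpha> x) + norm (\<beta> x)"

text \<open>A primitive of \<open>mass\<close> that vanishes at \<open>x0\<close> and is nonpositive
  to its left; \<open>Re\<close> appears because \<open>oriented_integral\<close> is
  complex-valued.\<close>

definition cumulative_mass :: "real \<Rightarrow> real" where
  "cumulative_mass x = Re (oriented_integral x0 (\<lambda>x. of_real (mass x)) x)"

lemma segment_subset: "c \<in> S \<Longrightarrow> d \<in> S \<Longrightarrow> {c..d} \<subseteq> S"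
  using S(2) by (rule is_interval_segment)

lemma mass_locally_integrable: "locally_integrable_on S (\<lambda>x. of_real (mass x))"
  unfolding locally_integrable_on_def
proof (intro allI impI)
  fix c d :: real assume cd: "c \<le> d" "{c..d} \<subseteq> S"
  have "(\<lambda>x. norm (\<alpha> x)) absolutely_integrable_on {c..d}" "(\<lambda>x. norm (\<beta> x)) absolutely_integrable_on {c..d}"
    using \<alpha> \<beta> cd by (auto simp: locally_integrable_on_def intro: set_integrable_norm)
  then have "mass absolutely_integrable_on {c..d}"
    unfolding mass_def by (rule set_integral_add(1))
  from absolutely_integrable_linear [OF this bounded_linear_of_real]
  show "(\<lambda>x. complex_of_real (mass x)) absolutely_integrable_on {c..d}" by (simp add: o_def)
qed

text \<open>The chain rule for powers of the cumulative mass. The factor \<open>s\<close> will be 1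
  to the right of \<open>x0\<close> and -1 to its left, which turns the cumulative mass into its
  absolute value.\<close>

lemma mass_power_integral:
  assumes cd: "c \<le> d" "{c..d} \<subseteq> S"
  shows "((\<lambda>x. real (Suc n) * ((s * cumulative_mass x) ^ n * (s * mass x))) has_integral
     (s * cumulative_mass d) ^ Suc n - (s * cumulative_mass c) ^ Suc n) {c..d}"
proof -
  have "Im (oriented_integral x0 (\<lambda>x. of_real (mass x)) x) = 0" if "x \<in> S" for x
  proof -
    have "primitive_on S (\<lambda>x. Im (oriented_integral x0 (\<lambda>x. of_real (mass x)) x)) (\<lambda>x. Im (of_real (mass x)))"
      using primitive_on_linear [OF primitive_on_oriented_integral [OF S(2,3) mass_locally_integrable], of "\<lambda>z. of_real (Im z)"]
      by (simp add: bounded_linear_compose [OF bounded_linear_of_real bounded_linear_Im])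
    then show ?thesis
      using primitive_onD(3) [of S _ _ x x0] primitive_onD(3) [of S _ _ x0 x] segment_subset [of x x0] segment_subset [of x0 x] that S
      by (cases "x \<le> x0") (force simp: complex_eq_iff)+
  qed
  then have eq: "of_real (cumulative_mass x) = oriented_integral x0 (\<lambda>x. of_real (mass x)) x" if "x \<in> S" for x
    using that by (simp add: cumulative_mass_def complex_eq_iff)
  have "primitive_on S (\<lambda>x. of_real (cumulative_mass x)) (\<lambda>x. of_real (mass x))"
    by (rule primitive_on_cong [OF primitive_on_oriented_integral [OF S(2,3) mass_locally_integrable]]) (simp add: eq)
  from primitive_on_power [OF primitive_on_cmult [OF this, of "of_real s"] S(1), of n]
  have "((\<lambda>x. of_nat (Suc n) * ((of_real s * of_real (cumulative_mass x)) ^ n * (of_real s * of_real (mass x))))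
    has_integral ((complex_of_real s * of_real (cumulative_mass d)) ^ Suc n - (of_real s * of_real (cumulative_mass c)) ^ Suc n)) {c..d}"
    using cd by (metis (no_types, lifting) has_integral_iff primitive_onD(2,3))
  then have "((\<lambda>x. complex_of_real (real (Suc n) * ((s * cumulative_mass x) ^ n * (s * mass x)))) has_integral
     complex_of_real ((s * cumulative_mass d) ^ Suc n - (s * cumulative_mass c) ^ Suc n)) {c..d}"
    by (simp only: of_real_mult of_real_power of_real_diff of_real_of_nat_eq)
  from has_integral_linear [OF this bounded_linear_Re]
  show ?thesis by (simp only: o_def Re_complex_of_real)
qed

lemma cumulative_mass_mono: "c \<in> S \<Longrightarrow> d \<in> S \<Longrightarrow> c \<le> d \<Longrightarrow> cumulative_mass c \<le> cumulative_mass d"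
  using mass_power_integral [of c d 0 1, THEN has_integral_nonneg] segment_subset by (auto simp: mass_def)

lemma cumulative_mass_x0 [simp]: "cumulative_mass x0 = 0"
  by (simp add: cumulative_mass_def)

text \<open>The Volterra estimate: with \<open>M\<close> the absolute cumulative mass, the integral
  of \<open>mass * M ^ n / fact n\<close> between \<open>x0\<close> and \<open>x\<close> is
  \<open>M ^ Suc n / fact (Suc n)\<close>. The factorials make the series converge on all of
  \<open>S\<close>, however large the mass.\<close>

lemma picard_bound:
  assumes x: "x \<in> S"
  shows "norm (fst (picard n) x) \<le> (norm y0 + norm h0) * (\<bar>cumulative_mass x\<bar> ^ n / fact n) \<and>
    norm (snd (picard n) x) \<le> (norm y0 + norm h0) * (\<bar>cumulative_mass x\<bar> ^ n / fact n)"
  using x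
proof (induction n arbitrary: x)
  case 0
  then show ?case by simp
next
  case (Suc n)
  let ?C = "norm y0 + norm h0"
  define \<sigma> :: real where "\<sigma> = (if x0 \<le> x then 1 else -1)"
  let ?c = "min x x0" and ?d = "max x x0"
  have cd: "?c \<le> ?d" "{?c..?d} \<subseteq> S" using segment_subset [of ?c ?d] Suc.prems S(3) by (auto simp: min_def max_def)
  have abs: "\<bar>cumulative_mass t\<bar> = \<sigma> * cumulative_mass t" if "t \<in> {?c..?d}" for t
  proof (cases "x0 \<le> x")
    case True
    then show ?thesis using cumulative_mass_mono [of x0 t] that cd S(3) by (auto simp: \<sigma>_def)
  next
    case False
    then show ?thesis using cumulative_mass_mono [of t x0] that cd S(3) by (auto simp: \<sigma>_def)
  qed
  have int: "((\<lambda>t. mass t * (?C * (\<bar>cumulative_mass t\<bar> ^ n / fact n))) has_integral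
      ?C * (\<bar>cumulative_mass x\<bar> ^ Suc n / fact (Suc n))) {?c..?d}"
  proof -
    have I: "((\<lambda>t. \<sigma> * ?C / fact (Suc n) * (real (Suc n) * ((\<sigma> * cumulative_mass t) ^ n * (\<sigma> * mass t)))) has_integral
      \<sigma> * ?C / fact (Suc n) * ((\<sigma> * cumulative_mass ?d) ^ Suc n - (\<sigma> * cumulative_mass ?c) ^ Suc n)) {?c..?d}"
      by (intro has_integral_mult_right mass_power_integral cd)
    have E: "\<sigma> * ?C / fact (Suc n) * ((\<sigma> * cumulative_mass ?d) ^ Suc n - (\<sigma> * cumulative_mass ?c) ^ Suc n)
       = ?C * (\<bar>cumulative_mass x\<bar> ^ Suc n / fact (Suc n))"
      using abs [of x] by (auto simp: \<sigma>_def min_def max_def)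
    have P: "\<sigma> * ?C / fact (Suc n) * (real (Suc n) * ((\<sigma> * cumulative_mass t) ^ n * (\<sigma> * mass t)))
       = mass t * (?C * (\<bar>cumulative_mass t\<bar> ^ n / fact n))" if "t \<in> {?c..?d}" for t
    proof -
      have "\<sigma> * \<sigma> = 1" by (simp add: \<sigma>_def)
      moreover have "real (Suc n) / fact (Suc n) = 1 / fact n" by (simp add: field_simps del: of_nat_Suc)
      moreover have "\<sigma> * ?C / fact (Suc n) * (real (Suc n) * ((\<sigma> * cumulative_mass t) ^ n * (\<sigma> * mass t)))
        = (\<sigma> * \<sigma>) * (real (Suc n) / fact (Suc n)) * (mass t * (?C * (\<sigma> * cumulative_mass t) ^ n))"
        by (simp only: divide_inverse mult_ac)
      ultimately show ?thesis unfolding abs [OF that] by simp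
    qed
    show ?thesis using I unfolding E by (rule has_integral_eq [rotated]) (rule P)
  qed
  have bound: "norm (F x) \<le> ?C * (\<bar>cumulative_mass x\<bar> ^ Suc n / fact (Suc n))"
    if F: "primitive_on S F (\<lambda>t. \<gamma> t * G t)" "F x0 = 0" and \<gamma>: "\<And>t. norm (\<gamma> t) \<le> mass t"
      and G: "\<And>t. t \<in> S \<Longrightarrow> norm (G t) \<le> ?C * (\<bar>cumulative_mass t\<bar> ^ n / fact n)" for F \<gamma> G
  proof -
    have "norm (F x) = norm (F ?d - F ?c)" using F(2) by (auto simp: min_def max_def)
    also have "\<dots> = norm (integral {?c..?d} (\<lambda>t. \<gamma> t * G t))" using primitive_onD(3) [OF F(1) cd] by simp
    also have "\<dots> \<le> integral {?c..?d} (\<lambda>t. mass t * (?C * (\<bar>cumulative_mass t\<bar> ^ n / fact n)))"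
    proof (rule integral_norm_bound_integral)
      show "(\<lambda>t. \<gamma> t * G t) integrable_on {?c..?d}" by (rule primitive_onD(2) [OF F(1) cd])
      show "(\<lambda>t. mass t * (?C * (\<bar>cumulative_mass t\<bar> ^ n / fact n))) integrable_on {?c..?d}" using int by blast
      show "norm (\<gamma> t * G t) \<le> mass t * (?C * (\<bar>cumulative_mass t\<bar> ^ n / fact n))" if "t \<in> {?c..?d}" for t
        unfolding norm_mult using \<gamma> [of t] G [of t] that cd(2)
        by (intro mult_mono) (auto simp: mass_def)
    qed
    finally show ?thesis using int by (simp only: integral_unique)
  qed
  show ?case
    using bound [OF picard_primitive(1) [of n]] bound [OF picard_primitive(2) [of n]] Suc.IH
    by (auto simp: mass_def)
qed

definition solution_y :: "real \<Rightarrow> complex" where "solution_y x = (\<Sum>n. fst (picard n) x)"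
definition solution_h :: "real \<Rightarrow> complex" where "solution_h x = (\<Sum>n. snd (picard n) x)"

lemma summable_bound: "summable (\<lambda>n. C * (B ^ n / fact n) :: real)"
  using summable_exp [of B] by (intro summable_mult) (simp add: field_simps)

lemma picard_sums:
  assumes "x \<in> S"
  shows "(\<lambda>n. fst (picard n) x) sums solution_y x" "(\<lambda>n. snd (picard n) x) sums solution_h x"
proof -
  note b = picard_bound [OF assms]
  have "summable (\<lambda>n. fst (picard n) x)"
    by (rule summable_comparison_test' [OF summable_bound]) (rule conjunct1 [OF b])
  then show "(\<lambda>n. fst (picard n) x) sums solution_y x"
    unfolding solution_y_def by (rule summable_sums)
  have "summable (\<lambda>n. snd (picard n) x)"
    by (rule summable_comparison_test' [OF summable_bound]) (rule conjunct2 [OF b])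
  then show "(\<lambda>n. snd (picard n) x) sums solution_h x"
    unfolding solution_h_def by (rule summable_sums)
qed

text \<open>Both equations have the same shape, so one statement covers a component \<open>F\<close>
  driven by the other component \<open>G\<close>. Partial sums are primitives, and dominated
  convergence carries this to the sum; the bound \<open>T\<close> is the exponential series at the
  largest absolute cumulative mass on the segment.\<close>

lemma solution_primitive_aux:
  assumes FG: "\<And>n. primitive_on S (F (Suc n)) (\<lambda>x. \<gamma> x * G n x)" and F0: "F 0 = (\<lambda>_. z)"
    and \<gamma>: "locally_integrable_on S \<gamma>"
    and sF: "\<And>x. x \<in> S \<Longrightarrow> (\<lambda>n. F n x) sums f x"
    and sG: "\<And>x. x \<in> S \<Longrightarrow> (\<lambda>n. G n x) sums g x"
    and bG: "\<And>n x. x \<in> S \<Longrightarrow> norm (G n x) \<le> (norm y0 + norm h0) * (\<bar>cumulative_mass x\<bar> ^ n / fact n)"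
  shows "primitive_on S f (\<lambda>x. \<gamma> x * g x)"
proof (rule primitive_on_limit)
  \<comment> \<open>The ranges differ by one: term \<open>Suc n\<close> of \<open>F\<close> is
    driven by term \<open>n\<close> of \<open>G\<close>, and the constant term 0 has integrand
    0.\<close>
  show "primitive_on S (\<lambda>x. \<Sum>n<Suc k. F n x) (\<lambda>x. \<gamma> x * (\<Sum>n<k. G n x))" for k
  proof (induction k)
    case 0
    then show ?case using primitive_on_const [of S z] by (simp add: F0)
  next
    case (Suc m)
    show ?case
      using primitive_on_add [OF Suc FG [of m]] by (simp add: algebra_simps)
  qed
  show "(\<lambda>k. \<Sum>n<Suc k. F n x) \<longlonglongrightarrow> f x" if "x \<in> S" for x
    using sF [OF that] unfolding sums_def by (rule LIMSEQ_Suc)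
  show "(\<lambda>k. \<gamma> x * (\<Sum>n<k. G n x)) \<longlonglongrightarrow> \<gamma> x * g x" if "x \<in> S" for x
    using sG [OF that] unfolding sums_def by (intro tendsto_intros)
  fix c d :: real assume cd: "c \<le> d" "{c..d} \<subseteq> S"
  define B where "B = max \<bar>cumulative_mass c\<bar> \<bar>cumulative_mass d\<bar>"
  define T where "T = (\<Sum>n. (norm y0 + norm h0) * (B ^ n / fact n))"
  have B: "\<bar>cumulative_mass x\<bar> \<le> B" if "x \<in> {c..d}" for x
    using cumulative_mass_mono [of c x] cumulative_mass_mono [of x d] that cd by (auto simp: B_def subset_iff)
  have B0: "0 \<le> B" by (simp add: B_def)
  have "norm (\<Sum>n<k. G n x) \<le> T" if x: "x \<in> {c..d}" for k x
  proof -
    have "norm (\<Sum>n<k. G n x) \<le> (\<Sum>n<k. (norm y0 + norm h0) * (B ^ n / fact n))"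
    proof (rule sum_norm_le)
      fix n
      have "norm (G n x) \<le> (norm y0 + norm h0) * (\<bar>cumulative_mass x\<bar> ^ n / fact n)" using bG x cd(2) by blast
      also have "\<dots> \<le> (norm y0 + norm h0) * (B ^ n / fact n)"
        using B [OF x] by (intro mult_left_mono divide_right_mono power_mono) auto
      finally show "norm (G n x) \<le> (norm y0 + norm h0) * (B ^ n / fact n)" .
    qed
    also have "\<dots> \<le> T" unfolding T_def using B0 by (intro sum_le_suminf summable_bound) auto
    finally show ?thesis .
  qed
  then have "norm (\<gamma> x * (\<Sum>n<k. G n x)) \<le> norm (\<gamma> x) * T" if "x \<in> {c..d}" for k x
    using that by (simp add: norm_mult mult_left_mono)
  moreover have "(\<lambda>x. norm (\<gamma> x) * T) integrable_on {c..d}"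
    using \<gamma> cd unfolding locally_integrable_on_def absolutely_integrable_on_def
    by (intro integrable_on_mult_left) auto
  ultimately show "\<exists>B. B integrable_on {c..d} \<and> (\<forall>k. \<forall>x\<in>{c..d}. norm (\<gamma> x * (\<Sum>n<k. G n x)) \<le> B x)"
    by blast
qed

lemma solution_primitive:
  "primitive_on S solution_y (\<lambda>x. \<alpha> x * solution_h x)" "primitive_on S solution_h (\<lambda>x. \<beta> x * solution_y x)"
proof -
  show "primitive_on S solution_y (\<lambda>x. \<alpha> x * solution_h x)"
    by (rule solution_primitive_aux [of "\<lambda>n. fst (picard n)" \<alpha> "\<lambda>n. snd (picard n)", OF picard_primitive(1)])
      (use \<alpha> picard_sums picard_bound in auto)
  show "primitive_on S solution_h (\<lambda>x. \<beta> x * solution_y x)"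
    by (rule solution_primitive_aux [of "\<lambda>n. snd (picard n)" \<beta> "\<lambda>n. fst (picard n)", OF picard_primitive(2)])
      (use \<beta> picard_sums picard_bound in auto)
qed

lemma solution_initial: "solution_y x0 = y0" "solution_h x0 = h0"
proof -
  have "(\<lambda>n. fst (picard n) x0) sums y0" "(\<lambda>n. snd (picard n) x0) sums h0"
    using sums_single [of 0 "\<lambda>_. y0"] sums_single [of 0 "\<lambda>_. h0"]
    by (auto elim!: sums_cong [THEN iffD1, rotated] simp: gr0_conv_Suc)
  then show "solution_y x0 = y0" "solution_h x0 = h0"
    using picard_sums [OF S(3)] sums_unique2 by blast+
qed

end


section \<open>The space of square integrable functions\<close>

definition sq_int :: "'a measure \<Rightarrow> ('a \<Rightarrow> complex) \<Rightarrow> bool" where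
  "sq_int M f \<longleftrightarrow> f \<in> borel_measurable M \<and> integrable M (\<lambda>x. (norm (f x))\<^sup>2)"

definition ip :: "'a measure \<Rightarrow> ('a \<Rightarrow> complex) \<Rightarrow> ('a \<Rightarrow> complex) \<Rightarrow> complex" where
  "ip M f g = (\<integral>x. f x * cnj (g x) \<partial>M)"

text \<open>The squared norm. Rates of convergence and the parallelogram law are stated for it,
  which keeps square roots away until \<open>wnorm_nsq\<close>.\<close>

definition nsq :: "'a measure \<Rightarrow> ('a \<Rightarrow> complex) \<Rightarrow> real" where
  "nsq M f = (\<integral>x. (norm (f x))\<^sup>2 \<partial>M)"

lemma borel_measurable_cnj [measurable (raw)]:
  "f \<in> borel_measurable M \<Longrightarrow> (\<lambda>x. cnj (f x)) \<in> borel_measurable M"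
  by (rule borel_measurable_continuous_on [OF continuous_on_cnj [OF continuous_on_id]])

lemma sq_intD: "sq_int M f \<Longrightarrow> f \<in> borel_measurable M" "sq_int M f \<Longrightarrow> integrable M (\<lambda>x. (norm (f x))\<^sup>2)"
  by (auto simp: sq_int_def)

lemma sq_int_integrable_mult:
  assumes "sq_int M f" "sq_int M g"
  shows "integrable M (\<lambda>x. f x * g x)"
proof (rule Bochner_Integration.integrable_bound)
  show "integrable M (\<lambda>x. (norm (f x))\<^sup>2 + (norm (g x))\<^sup>2)" using assms by (auto simp: sq_int_def)
  show "(\<lambda>x. f x * g x) \<in> borel_measurable M" using assms by (auto simp: sq_int_def)
  have "norm (u * v) \<le> norm ((norm u)\<^sup>2 + (norm v)\<^sup>2)" for u v :: complex
  proof -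
    have "2 * (norm u * norm v) \<le> (norm u)\<^sup>2 + (norm v)\<^sup>2"
      using sum_squares_bound [of "norm u" "norm v"] by (simp add: mult.assoc)
    moreover have "0 \<le> norm u * norm v" by simp
    ultimately show ?thesis by (simp add: norm_mult del: mult_nonneg_nonneg)
  qed
  then show "AE x in M. norm (f x * g x) \<le> norm ((norm (f x))\<^sup>2 + (norm (g x))\<^sup>2)" by simp
qed

lemma sq_int_cnj: "sq_int M f \<Longrightarrow> sq_int M (\<lambda>x. cnj (f x))"
  by (auto simp: sq_int_def)

lemma sq_int_add:
  assumes "sq_int M f" "sq_int M g"
  shows "sq_int M (\<lambda>x. f x + g x)"
  unfolding sq_int_def
proof
  show [measurable]: "(\<lambda>x. f x + g x) \<in> borel_measurable M" using assms by (auto simp: sq_int_def)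
  show "integrable M (\<lambda>x. (norm (f x + g x))\<^sup>2)"
  proof (rule Bochner_Integration.integrable_bound)
    show "integrable M (\<lambda>x. 2 * (norm (f x))\<^sup>2 + 2 * (norm (g x))\<^sup>2)" using assms by (auto simp: sq_int_def)
    have "(norm (u + v))\<^sup>2 \<le> 2 * (norm u)\<^sup>2 + 2 * (norm v)\<^sup>2" for u v :: complex
    proof -
      have "(norm (u + v))\<^sup>2 \<le> (norm u + norm v)\<^sup>2" by (intro power_mono norm_triangle_ineq) auto
      also have "\<dots> \<le> 2 * (norm u)\<^sup>2 + 2 * (norm v)\<^sup>2"
        using sum_squares_bound [of "norm u" "norm v"] by (simp add: power2_sum)
      finally show ?thesis .
    qed
    then show "AE x in M. norm ((norm (f x + g x))\<^sup>2) \<le> norm (2 * (norm (f x))\<^sup>2 + 2 * (norm (g x))\<^sup>2)"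
      by simp
  qed measurable
qed

lemma sq_int_cmult: "sq_int M f \<Longrightarrow> sq_int M (\<lambda>x. c * f x)"
  by (auto simp: sq_int_def norm_mult power_mult_distrib)

lemma sq_int_diff:
  assumes "sq_int M f" "sq_int M g"
  shows "sq_int M (\<lambda>x. f x - g x)"
  using sq_int_add [OF assms(1) sq_int_cmult [OF assms(2), of "-1"]] by simp

lemma sq_int_zero [simp]: "sq_int M (\<lambda>x. 0)"
  by (simp add: sq_int_def)

lemma nsq_nonneg [simp]: "0 \<le> nsq M f"
  by (simp add: nsq_def)

lemma ip_self: "ip M f f = of_real (nsq M f)"
  unfolding ip_def nsq_def by (simp only: complex_norm_square [symmetric] integral_complex_of_real)

lemma ip_integrable: "sq_int M f \<Longrightarrow> sq_int M g \<Longrightarrow> integrable M (\<lambda>x. f x * cnj (g x))"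
  by (intro sq_int_integrable_mult sq_int_cnj)

lemma ip_add_left:
  assumes "sq_int M f" "sq_int M g" "sq_int M h"
  shows "ip M (\<lambda>x. f x + g x) h = ip M f h + ip M g h"
  unfolding ip_def using ip_integrable [OF assms(1,3)] ip_integrable [OF assms(2,3)]
  by (simp add: distrib_right)

lemma ip_add_right:
  assumes "sq_int M f" "sq_int M g" "sq_int M h"
  shows "ip M h (\<lambda>x. f x + g x) = ip M h f + ip M h g"
  unfolding ip_def using ip_integrable [OF assms(3,1)] ip_integrable [OF assms(3,2)]
  by (simp add: distrib_left)

lemma ip_diff_left:
  assumes "sq_int M f" "sq_int M g" "sq_int M h"
  shows "ip M (\<lambda>x. f x - g x) h = ip M f h - ip M g h"
  unfolding ip_def using ip_integrable [OF assms(1,3)] ip_integrable [OF assms(2,3)]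
  by (simp add: left_diff_distrib)

lemma ip_diff_right:
  assumes "sq_int M f" "sq_int M g" "sq_int M h"
  shows "ip M h (\<lambda>x. f x - g x) = ip M h f - ip M h g"
  unfolding ip_def using ip_integrable [OF assms(3,1)] ip_integrable [OF assms(3,2)]
  by (simp add: right_diff_distrib)

lemma ip_cmult_left: "ip M (\<lambda>x. c * f x) h = c * ip M f h"
  unfolding ip_def by (simp add: mult.assoc)

lemma ip_cmult_right: "ip M h (\<lambda>x. c * f x) = cnj c * ip M h f"
  unfolding ip_def by (simp add: mult.left_commute)

lemma ip_cnj: "ip M f g = cnj (ip M g f)"
  unfolding ip_def using Bochner_Integration.integral_cnj [of M "\<lambda>x. g x * cnj (f x)"]
  by (simp add: mult.commute)

lemma nsq_add:
  assumes "sq_int M f" "sq_int M g"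
  shows "nsq M (\<lambda>x. f x + g x) = nsq M f + nsq M g + 2 * Re (ip M f g)"
proof -
  have "complex_of_real (nsq M (\<lambda>x. f x + g x)) = ip M f f + ip M g f + (ip M f g + ip M g g)"
    using assms by (simp add: ip_self [symmetric] ip_add_left ip_add_right sq_int_add)
  then have "nsq M (\<lambda>x. f x + g x) = Re (ip M f f + ip M g f + (ip M f g + ip M g g))"
    by (metis Re_complex_of_real)
  then show ?thesis using ip_cnj [of M g f] by (simp add: ip_self)
qed

lemma nsq_diff:
  assumes "sq_int M f" "sq_int M g"
  shows "nsq M (\<lambda>x. f x - g x) = nsq M f + nsq M g - 2 * Re (ip M f g)"
proof -
  have "sq_int M (\<lambda>x. - g x)" using sq_int_cmult [OF assms(2), of "-1"] by simp
  from nsq_add [OF assms(1) this] show ?thesis by (simp add: nsq_def ip_def)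
qed

lemma nsq_cmult: "nsq M (\<lambda>x. c * f x) = (norm c)\<^sup>2 * nsq M f"
  unfolding nsq_def by (simp add: norm_mult power_mult_distrib)

lemma nsq_add_cmult:
  assumes "sq_int M f" "sq_int M g"
  shows "nsq M (\<lambda>x. f x + c * g x) = nsq M f + (norm c)\<^sup>2 * nsq M g + 2 * Re (cnj c * ip M f g)"
  using nsq_add [OF assms(1) sq_int_cmult [OF assms(2)]] by (simp add: nsq_cmult ip_cmult_right)

lemma nsq_minus: "nsq M (\<lambda>x. f x - g x) = nsq M (\<lambda>x. g x - f x)"
  unfolding nsq_def by (simp add: norm_minus_commute)

lemma nsq_eq_0:
  assumes "sq_int M f" "nsq M f = 0"
  shows "AE x in M. f x = 0"
  using assms integral_nonneg_eq_0_iff_AE [of M "\<lambda>x. (norm (f x))\<^sup>2"] by (simp add: nsq_def sq_int_def)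

text \<open>Expansion of the nonnegative squared norms of
  \<open>sqrt \<eta> f + g / sqrt \<eta>\<close> and \<open>sqrt \<eta> f - g / sqrt \<eta>\<close>.
  The free parameter \<open>\<eta>\<close> balances the two terms when one factor tends to
  0.\<close>

lemma ip_bound:
  assumes "sq_int M f" "sq_int M g" "\<eta> > 0"
  shows "2 * \<bar>Re (ip M f g)\<bar> \<le> \<eta> * nsq M f + nsq M g / \<eta>"
proof -
  let ?s = "sqrt \<eta>"
  have s: "?s > 0" "?s * ?s = \<eta>" using assms(3) by auto
  have "0 \<le> nsq M (\<lambda>x. of_real ?s * f x + of_real (\<sigma> / ?s) * g x)" for \<sigma> by simp
  then have "0 \<le> \<eta> * nsq M f + \<sigma>\<^sup>2 / \<eta> * nsq M g + 2 * \<sigma> * Re (ip M f g)" for \<sigma>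
    using s assms by (simp add: nsq_add sq_int_cmult nsq_cmult ip_cmult_left ip_cmult_right power_divide
        power2_eq_square abs_mult mult.assoc flip: of_real_divide)
  from this [of 1] this [of "-1"] show ?thesis by (simp add: abs_if)
qed

text \<open>Riesz-Fischer at a geometric rate. The increments satisfy
  \<open>nsq M (d n) \<le> 2 * C * (1/8) ^ n\<close>, so with weights \<open>4 ^ n\<close> their sum
  is still finite. Hence \<open>norm (d n x)\<close> is a.e. at most a constant times
  \<open>(1/2) ^ n\<close>, and the sequence converges a.e. Fatou's lemma transfers the rate to the
  limit.\<close>

lemma L2_Cauchy_limit:
  assumes f: "\<And>n. sq_int M (f n)"
    and cauchy: "\<And>n m. nsq M (\<lambda>x. f n x - f m x) \<le> C * ((1/8) ^ n + (1/8) ^ m)"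
  obtains F where "sq_int M F" "\<And>n. nsq M (\<lambda>x. f n x - F x) \<le> C * (1/8) ^ n"
proof -
  note [measurable] = sq_intD(1) [OF f]
  define d where "d n x = f (Suc n) x - f n x" for n x
  have d: "sq_int M (d n)" for n unfolding d_def by (intro sq_int_diff f)
  note [measurable] = sq_intD(1) [OF d]
  have C: "0 \<le> C"
    using order_trans [OF nsq_nonneg cauchy [of 0 0]] by simp
  have dn: "nsq M (d n) \<le> 2 * C * (1/8) ^ n" for n
  proof -
    have "C * ((1/8) ^ Suc n + (1/8) ^ n) \<le> 2 * C * (1/8) ^ n" using C by (simp add: mult_left_mono)
    then show ?thesis using cauchy [of "Suc n" n] unfolding d_def by linarith
  qed
  have "(\<integral>\<^sup>+x. (\<Sum>n. ennreal (4 ^ n * (norm (d n x))\<^sup>2)) \<partial>M) = (\<Sum>n. \<integral>\<^sup>+x. ennreal (4 ^ n * (norm (d n x))\<^sup>2) \<partial>M)"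
    by (rule nn_integral_suminf) measurable
  also have "\<dots> = (\<Sum>n. ennreal (4 ^ n * nsq M (d n)))"
    using sq_intD(2) [OF d] by (subst nn_integral_eq_integral) (auto simp: nsq_def)
  also have "\<dots> \<le> (\<Sum>n. ennreal (2 * C * (1/2) ^ n))"
  proof (intro suminf_le ennreal_leI)
    fix n
    have "4 ^ n * nsq M (d n) \<le> 4 ^ n * (2 * C * (1/8) ^ n)" using dn by (intro mult_left_mono) auto
    also have "\<dots> = 2 * C * (4 * (1/8)) ^ n" by (simp only: power_mult_distrib) simp
    finally show "4 ^ n * nsq M (d n) \<le> 2 * C * (1/2) ^ n" by simp
  qed auto
  also have "\<dots> = ennreal (\<Sum>n. 2 * C * (1/2) ^ n)"
    using C by (intro suminf_ennreal2) (auto intro!: summable_mult summable_geometric)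
  also have "\<dots> < \<infinity>" by simp
  finally have "AE x in M. (\<Sum>n. ennreal (4 ^ n * (norm (d n x))\<^sup>2)) \<noteq> \<infinity>"
    by (intro nn_integral_noteq_infinite) auto
  then have conv: "AE x in M. convergent (\<lambda>n. f n x)"
  proof eventually_elim
    case (elim x)
    then have "summable (\<lambda>n. 4 ^ n * (norm (d n x))\<^sup>2)"
      by (intro summable_suminf_not_top) (auto simp: top_ennreal_def infinity_ennreal_def)
    then have "bounded (range (\<lambda>n. 4 ^ n * (norm (d n x))\<^sup>2))"
      using summable_LIMSEQ_zero convergent_imp_bounded by blast
    then obtain B where B: "B > 0" "\<And>n. 4 ^ n * (norm (d n x))\<^sup>2 \<le> B"
      unfolding bounded_pos by (auto simp: abs_mult)
    have dB: "norm (d n x) \<le> sqrt B * (1/2) ^ n" for n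
    proof -
      have "(2 ^ n * norm (d n x))\<^sup>2 \<le> B"
        using B(2) [of n] by (simp add: power_mult_distrib power_mult [symmetric] mult.commute [of n] power_mult)
      then have "2 ^ n * norm (d n x) \<le> sqrt B" by (rule real_le_rsqrt)
      then show ?thesis by (simp add: field_simps power_divide)
    qed
    have "summable (\<lambda>n. sqrt B * (1/2) ^ n)" by (intro summable_mult summable_geometric) auto
    then have "summable (\<lambda>n. d n x)" by (rule summable_comparison_test') (rule dB)
    then have "(\<lambda>k. \<Sum>n<k. d n x) \<longlonglongrightarrow> suminf (\<lambda>n. d n x)" by (rule summable_LIMSEQ)
    moreover have "(\<Sum>n<k. d n x) = f k x - f 0 x" for k unfolding d_def by (rule sum_lessThan_telescope)
    ultimately have "(\<lambda>k. f k x) \<longlonglongrightarrow> suminf (\<lambda>n. d n x) + f 0 x"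
      using tendsto_add [OF _ tendsto_const, of "\<lambda>k. f k x - f 0 x" _ sequentially "f 0 x"] by simp
    then show ?case by (rule convergentI)
  qed
  define F where "F x = lim (\<lambda>n. f n x)" for x
  have F_meas [measurable]: "F \<in> borel_measurable M" unfolding F_def by (rule borel_measurable_lim_metric) measurable
  have lim: "AE x in M. (\<lambda>n. f n x) \<longlonglongrightarrow> F x"
    using conv unfolding F_def by eventually_elim (rule convergent_LIMSEQ_iff [THEN iffD1])
  have le: "(\<integral>\<^sup>+x. ennreal ((norm (f n x - F x))\<^sup>2) \<partial>M) \<le> ennreal (C * (1/8) ^ n)" for n
  proof -
    have "(\<integral>\<^sup>+x. ennreal ((norm (f n x - F x))\<^sup>2) \<partial>M) = (\<integral>\<^sup>+x. liminf (\<lambda>m. ennreal ((norm (f n x - f m x))\<^sup>2)) \<partial>M)"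
    proof (rule nn_integral_cong_AE)
      show "AE x in M. ennreal ((norm (f n x - F x))\<^sup>2) = liminf (\<lambda>m. ennreal ((norm (f n x - f m x))\<^sup>2))"
        using lim
      proof eventually_elim
        case (elim x)
        then have "(\<lambda>m. ennreal ((norm (f n x - f m x))\<^sup>2)) \<longlonglongrightarrow> ennreal ((norm (f n x - F x))\<^sup>2)"
          by (intro tendsto_intros)
        then show ?case by (intro lim_imp_Liminf [symmetric]) auto
      qed
    qed
    also have "\<dots> \<le> liminf (\<lambda>m. \<integral>\<^sup>+x. ennreal ((norm (f n x - f m x))\<^sup>2) \<partial>M)"
      by (rule nn_integral_liminf) measurable
    also have "\<dots> \<le> liminf (\<lambda>m. ennreal (C * ((1/8) ^ n + (1/8) ^ m)))"
    proof (intro Liminf_mono always_eventually allI)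
      fix m
      have "(\<integral>\<^sup>+x. ennreal ((norm (f n x - f m x))\<^sup>2) \<partial>M) = ennreal (nsq M (\<lambda>x. f n x - f m x))"
        unfolding nsq_def using sq_intD(2) [OF sq_int_diff [OF f f]] by (intro nn_integral_eq_integral) auto
      then show "(\<integral>\<^sup>+x. ennreal ((norm (f n x - f m x))\<^sup>2) \<partial>M) \<le> ennreal (C * ((1/8) ^ n + (1/8) ^ m))"
        using cauchy by (simp add: ennreal_leI)
    qed
    also have "\<dots> = ennreal (C * (1/8) ^ n)"
    proof (rule lim_imp_Liminf)
      have "(\<lambda>m. C * ((1/8) ^ n + (1/8) ^ m)) \<longlonglongrightarrow> C * ((1/8) ^ n + 0)"
        by (intro tendsto_intros LIMSEQ_power_zero) auto
      then show "(\<lambda>m. ennreal (C * ((1/8) ^ n + (1/8) ^ m))) \<longlonglongrightarrow> ennreal (C * (1/8) ^ n)"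
        by (intro tendsto_ennrealI) simp
    qed auto
    finally show ?thesis .
  qed
  have sq: "sq_int M (\<lambda>x. f n x - F x)" for n
    unfolding sq_int_def
  proof
    show "integrable M (\<lambda>x. (norm (f n x - F x))\<^sup>2)"
      using le_less_trans [OF le [of n] ennreal_less_top] by (intro integrableI_nonneg) auto
  qed measurable
  show thesis
  proof (rule that)
    show "sq_int M F" using sq_int_diff [OF f [of 0] sq [of 0]] by simp
    fix n
    have "ennreal (nsq M (\<lambda>x. f n x - F x)) \<le> ennreal (C * (1/8) ^ n)"
      using le [of n] sq_intD(2) [OF sq [of n]] by (simp add: nsq_def nn_integral_eq_integral)
    then show "nsq M (\<lambda>x. f n x - F x) \<le> C * (1/8) ^ n" using C by (simp add: ennreal_le_iff)
  qed
qed

text \<open>In \<open>ip_bound\<close> the parameter \<open>(1/2) ^ n\<close> is taken: it tends to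
  0 itself, and dividing the rate \<open>(1/8) ^ n\<close> by it leaves
  \<open>(1/4) ^ n\<close>.\<close>

lemma nsq_add_limit:
  assumes k: "sq_int M k" and g: "\<And>n. sq_int M (g n)" "\<And>n. nsq M (g n) \<le> C * (1/8) ^ n"
  shows "(\<lambda>n. nsq M (\<lambda>x. k x + g n x)) \<longlonglongrightarrow> nsq M k"
proof (rule LIM_zero_cancel, rule Lim_null_comparison)
  have C: "0 \<le> C" using order_trans [OF nsq_nonneg g(2) [of 0]] by simp
  show "\<forall>\<^sub>F n in sequentially. norm (nsq M (\<lambda>x. k x + g n x) - nsq M k) \<le> (1/2) ^ n * nsq M k + C * (1/4) ^ n + C * (1/8) ^ n"
  proof (rule always_eventually, rule allI)
    fix n
    have "2 * \<bar>Re (ip M k (g n))\<bar> \<le> (1/2) ^ n * nsq M k + nsq M (g n) / (1/2) ^ n"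
      by (intro ip_bound k g) auto
    also have "nsq M (g n) / (1/2) ^ n \<le> C * (1/8) ^ n / (1/2) ^ n" by (intro divide_right_mono g) auto
    also have "C * (1/8) ^ n / (1/2) ^ n = C * ((1/8) / (1/2)) ^ n" by (simp only: power_divide) simp
    finally have "2 * \<bar>Re (ip M k (g n))\<bar> \<le> (1/2) ^ n * nsq M k + C * (1/4) ^ n" by simp
    then show "norm (nsq M (\<lambda>x. k x + g n x) - nsq M k) \<le> (1/2) ^ n * nsq M k + C * (1/4) ^ n + C * (1/8) ^ n"
      using nsq_add [OF k g(1) [of n]] g(2) [of n] nsq_nonneg [of M "g n"] unfolding real_norm_def by linarith
  qed
  have "(\<lambda>n. (1/2) ^ n * nsq M k + C * (1/4) ^ n + C * (1/8) ^ n) \<longlonglongrightarrow> 0 * nsq M k + C * 0 + C * 0"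
    by (intro tendsto_intros LIMSEQ_power_zero) auto
  then show "(\<lambda>n. (1/2) ^ n * nsq M k + C * (1/4) ^ n + C * (1/8) ^ n) \<longlonglongrightarrow> 0" by simp
qed

text \<open>The projection argument for a subspace that need not be closed. A minimising sequence in
  \<open>D\<close> converges to some \<open>F\<close>, the residual \<open>k = h - F\<close> is
  orthogonal to \<open>D\<close>, and so \<open>k\<close> vanishes a.e. The infimum of the squared
  distances is then 0.\<close>

lemma L2_dense_of_trivial_complement:
  assumes D: "\<And>f. f \<in> D \<Longrightarrow> sq_int M f" "(\<lambda>x. 0) \<in> D"
    "\<And>f g. f \<in> D \<Longrightarrow> g \<in> D \<Longrightarrow> (\<lambda>x. f x + g x) \<in> D" "\<And>c f. f \<in> D \<Longrightarrow> (\<lambda>x. c * f x) \<in> D"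
    and perp: "\<And>k. sq_int M k \<Longrightarrow> (\<And>f. f \<in> D \<Longrightarrow> ip M k f = 0) \<Longrightarrow> AE x in M. k x = 0"
    and h: "sq_int M h" and \<epsilon>: "0 < \<epsilon>"
  shows "\<exists>f\<in>D. nsq M (\<lambda>x. h x - f x) < \<epsilon>"
proof -
  define \<delta> where "\<delta> = (INF f\<in>D. nsq M (\<lambda>x. h x - f x))"
  have bdd: "bdd_below ((\<lambda>f. nsq M (\<lambda>x. h x - f x)) ` D)" by (intro bdd_belowI2 [where m = 0]) auto
  have \<delta>: "\<delta> \<le> nsq M (\<lambda>x. h x - f x)" if "f \<in> D" for f
    unfolding \<delta>_def by (rule cINF_lower [OF bdd that])
  \<comment> \<open>The rate \<open>(1/8) ^ n\<close> is the one required by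
    \<open>L2_Cauchy_limit\<close>.\<close>
  have "\<exists>f\<in>D. nsq M (\<lambda>x. h x - f x) < \<delta> + (1/8) ^ n" for n :: nat
  proof (rule ccontr)
    assume "\<not> ?thesis"
    then have "\<And>f. f \<in> D \<Longrightarrow> \<delta> + (1/8) ^ n \<le> nsq M (\<lambda>x. h x - f x)" by force
    then have "\<delta> + (1/8) ^ n \<le> \<delta>" using D(2) by (subst (2) \<delta>_def) (rule cINF_greatest, auto)
    moreover have "(0::real) < (1/8) ^ n" by simp
    ultimately show False by linarith
  qed
  then obtain f where f: "\<And>n. f n \<in> D" "\<And>n::nat. nsq M (\<lambda>x. h x - f n x) < \<delta> + (1/8) ^ n" by metis
  have hf: "sq_int M (\<lambda>x. h x - f n x)" for n by (intro sq_int_diff h D f)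
  have "nsq M (\<lambda>x. f n x - f m x) \<le> 2 * ((1/8) ^ n + (1/8) ^ m)" for n m
  proof -
    let ?u = "\<lambda>x. h x - f n x" and ?v = "\<lambda>x. h x - f m x"
    have 1: "nsq M (\<lambda>x. ?v x - ?u x) = nsq M ?v + nsq M ?u - 2 * Re (ip M ?v ?u)"
      by (rule nsq_diff [OF hf hf])
    have 2: "nsq M (\<lambda>x. ?v x + ?u x) = nsq M ?v + nsq M ?u + 2 * Re (ip M ?v ?u)"
      by (rule nsq_add [OF hf hf])
    \<comment> \<open>The midpoint of two approximants lies in \<open>D\<close>. The sum of their
      residuals is twice the residual of the midpoint, so its squared norm is at least
      \<open>4 * \<delta>\<close>, and the parallelogram law bounds the difference.\<close>
    have "(\<lambda>x. (1/2) * (f n x + f m x)) \<in> D" by (intro D f)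
    from \<delta> [OF this] have "4 * \<delta> \<le> 4 * nsq M (\<lambda>x. h x - (1/2) * (f n x + f m x))" by simp
    also have "\<dots> = nsq M (\<lambda>x. 2 * (h x - (1/2) * (f n x + f m x)))" by (subst nsq_cmult) simp
    also have "(\<lambda>x. 2 * (h x - (1/2) * (f n x + f m x))) = (\<lambda>x. ?v x + ?u x)" by (auto simp: algebra_simps)
    finally have 3: "4 * \<delta> \<le> nsq M (\<lambda>x. ?v x + ?u x)" .
    have "(\<lambda>x. ?v x - ?u x) = (\<lambda>x. f n x - f m x)" by auto
    then show ?thesis using 1 2 3 f(2) [of n] f(2) [of m] by simp
  qed
  then obtain F where F: "sq_int M F" "\<And>n. nsq M (\<lambda>x. f n x - F x) \<le> 2 * (1/8) ^ n"
    using L2_Cauchy_limit [of M f 2] D(1) f(1) by blast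
  define k where "k x = h x - F x" for x
  have k: "sq_int M k" unfolding k_def by (intro sq_int_diff h F)
  have g: "sq_int M (\<lambda>x. F x - f n x)" "nsq M (\<lambda>x. F x - f n x) \<le> 2 * (1/8) ^ n" for n
    using F D(1) f(1) by (auto intro: sq_int_diff simp: nsq_minus [of M F])
  have lim: "(\<lambda>n. nsq M (\<lambda>x. h x - f n x + c * \<phi> x)) \<longlonglongrightarrow> nsq M (\<lambda>x. k x + c * \<phi> x)"
    if "\<phi> \<in> D" for c \<phi>
  proof -
    have "sq_int M (\<lambda>x. k x + c * \<phi> x)" by (intro sq_int_add sq_int_cmult k D that)
    from nsq_add_limit [OF this g] show ?thesis by (simp add: k_def algebra_simps)
  qed
  have k_le: "nsq M k \<le> \<delta>"
  proof (rule LIMSEQ_le)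
    show "(\<lambda>n. nsq M (\<lambda>x. h x - f n x)) \<longlonglongrightarrow> nsq M k" using lim [OF D(2), of 0] by simp
    have "(\<lambda>n. \<delta> + (1/8) ^ n) \<longlonglongrightarrow> \<delta> + 0" by (intro tendsto_intros LIMSEQ_power_zero) auto
    then show "(\<lambda>n. \<delta> + (1/8) ^ n) \<longlonglongrightarrow> \<delta>" by simp
  qed (use f(2) in \<open>auto intro!: exI [of _ 0] less_imp_le\<close>)
  have "ip M k \<phi> = 0" if \<phi>: "\<phi> \<in> D" for \<phi>
  proof -
    have ge: "nsq M k \<le> nsq M (\<lambda>x. k x + c * \<phi> x)" for c
    proof -
      have "\<delta> \<le> nsq M (\<lambda>x. h x - f n x + c * \<phi> x)" for n
      proof -
        have "(\<lambda>x. f n x + (- c) * \<phi> x) \<in> D" by (intro D f \<phi>)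
        from \<delta> [OF this] show ?thesis by (simp add: algebra_simps)
      qed
      then have "\<delta> \<le> nsq M (\<lambda>x. k x + c * \<phi> x)" using lim [OF \<phi>, of c] by (intro LIMSEQ_le_const) auto
      with k_le show ?thesis by simp
    qed
    \<comment> \<open>Moving \<open>k\<close> by \<open>- s * ip M k \<phi>\<close> times
      \<open>\<phi>\<close> changes its squared norm by
      \<open>s * (norm (ip M k \<phi>))\<^sup>2 * (s * nsq M \<phi> - 2)\<close>. This
      \<open>s\<close> makes the last factor negative, and the \<open>+ 1\<close> covers
      \<open>nsq M \<phi> = 0\<close>.\<close>
    define s where "s = 1 / (nsq M \<phi> + 1)"
    have "0 < nsq M \<phi> + 1" using nsq_nonneg [of M \<phi>] by linarith
    then have s: "s > 0" "s * (nsq M \<phi> + 1) = 1" by (auto simp: s_def)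
    let ?z = "ip M k \<phi>"
    have "nsq M k \<le> nsq M k + (s * norm ?z)\<^sup>2 * nsq M \<phi> - 2 * (s * (norm ?z)\<^sup>2)"
    proof -
      have "nsq M (\<lambda>x. k x + (- of_real s * ?z) * \<phi> x)
        = nsq M k + (s * norm ?z)\<^sup>2 * nsq M \<phi> + 2 * Re (cnj (- of_real s * ?z) * ?z)"
        using s(1) by (subst nsq_add_cmult [OF k D(1) [OF \<phi>]]) (simp add: norm_mult)
      also have "cnj (- of_real s * ?z) * ?z = - of_real (s * (norm ?z)\<^sup>2)"
        using complex_norm_square [of ?z] by (simp add: mult.commute mult.left_commute)
      finally show ?thesis using ge [of "- of_real s * ?z"] by simp
    qed
    then have "0 \<le> s * (norm ?z)\<^sup>2 * (s * nsq M \<phi> - 2)" by (simp add: power2_eq_square algebra_simps)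
    moreover have "s * nsq M \<phi> - 2 < 0" using s by (simp add: algebra_simps)
    ultimately have "s * (norm ?z)\<^sup>2 \<le> 0" by (simp add: zero_le_mult_iff mult_le_0_iff)
    then show ?thesis using s(1) by (simp add: mult_le_0_iff)
  qed
  then have "AE x in M. k x = 0" using perp [OF k] by blast
  then have "nsq M k = 0" unfolding nsq_def using k by (subst integral_cong_AE [where g = "\<lambda>_. 0"]) (auto simp: sq_int_def)
  then have "(\<lambda>n. nsq M (\<lambda>x. h x - f n x)) \<longlonglongrightarrow> 0" using lim [OF D(2), of 0] by simp
  then have "\<forall>\<^sub>F n in sequentially. nsq M (\<lambda>x. h x - f n x) < \<epsilon>" using \<epsilon> by (rule order_tendstoD)
  then show ?thesis using f(1) by (auto simp: eventually_sequentially)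
qed


section \<open>Quasi-derivatives and solutions\<close>

text \<open>Continuous functions that differ at a point of an open set differ on a nonempty open
  set, which is not negligible. This is why quasi-derivatives and elements of a domain are
  determined as functions.\<close>

lemma continuous_AE_eq:
  fixes f g :: "real \<Rightarrow> complex"
  assumes S: "open S" and f: "continuous_on S f" and g: "continuous_on S g"
    and eq: "AE x in lebesgue_on S. f x = g x" and x: "x \<in> S"
  shows "f x = g x"
proof (rule ccontr)
  assume neq: "f x \<noteq> g x"
  let ?U = "S \<inter> (\<lambda>x. f x - g x) -` (- {0})"
  have "open ?U" by (rule continuous_open_preimage) (auto intro!: continuous_intros f g S)
  moreover have "x \<in> ?U" using x neq by simp
  ultimately have "\<not> negligible ?U" using open_not_negligible by blast
  moreover have "?U = {x\<in>S. \<not> f x = g x}" by auto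
  ultimately show False using eq AE_lebesgue_on_iff_negligible [of S "\<lambda>x. f x = g x"] S by auto
qed

locale sturm_liouville = sl_expression +
  assumes coef: coefficients
begin

lemma I_open: "open I" by simp

lemma I_lebesgue: "I \<in> sets lebesgue" using I_open by auto

lemma I_interval: "is_interval I"
  unfolding is_interval_1 einterval_def
  by (clarsimp, metis ereal_less_eq(3) le_less_trans less_le_trans)

lemma I_segment: "c \<in> I \<Longrightarrow> d \<in> I \<Longrightarrow> {c..d} \<subseteq> I"
  using is_interval_segment [OF I_interval] .

lemma base_point: obtains x0 where "x0 \<in> I"
  using coef ereal_dense2 [of a b] unfolding coefficients_def einterval_def by auto

lemma p_pos: "AE x in lebesgue_on I. 0 < p x" and w_pos: "AE x in lebesgue_on I. 0 < w x"
  using coef unfolding coefficients_def by auto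

lemma l1_loc_imp: "l1_loc f \<Longrightarrow> locally_integrable_on I (\<lambda>x. complex_of_real (f x))"
  unfolding l1_loc_def locally_integrable_on_def
  using absolutely_integrable_linear [OF _ bounded_linear_of_real] by (fastforce simp: o_def)

lemma inv_p_loc: "locally_integrable_on I (\<lambda>x. complex_of_real (1 / p x))"
  and q_loc: "locally_integrable_on I (\<lambda>x. complex_of_real (q x))"
  and w_loc: "locally_integrable_on I (\<lambda>x. complex_of_real (w x))"
  by (rule l1_loc_imp, use coef in \<open>simp add: coefficients_def\<close>)+

lemma ac_loc_primitive: "ac_loc F \<Longrightarrow> primitive_on I F (\<lambda>x. vector_derivative F (at x))"
  unfolding ac_loc_def by (intro ac_on_imp_primitive_on I_open) auto

lemma primitive_ac_loc: "primitive_on I F g \<Longrightarrow> ac_loc F"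
  unfolding ac_loc_def using primitive_on_imp_ac_on by blast

lemma ac_loc_continuous: "ac_loc F \<Longrightarrow> continuous_on I F"
  using ac_loc_primitive primitive_on_continuous I_open by blast

lemma is_qderiv_unique:
  assumes "is_qderiv f h" "is_qderiv f k"
  shows "h = k"
proof
  fix x
  show "h x = k x"
  proof (cases "x \<in> I")
    case True
    have "AE x in lebesgue_on I. h x = k x"
      using assms unfolding is_qderiv_def ae_eq_def by (auto elim: eventually_elim2)
    then show ?thesis
      using assms True by (intro continuous_AE_eq [OF I_open]) (auto simp: is_qderiv_def ac_loc_continuous)
  qed (use assms in \<open>auto simp: is_qderiv_def\<close>)
qed

lemma qderiv_eq: "is_qderiv f h \<Longrightarrow> qderiv f = h"
  unfolding qderiv_def using is_qderiv_unique by blast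

lemma regular_fun_qderiv: "regular_fun f \<Longrightarrow> is_qderiv f (qderiv f)"
  unfolding regular_fun_def using qderiv_eq by metis

lemma regular_primitive:
  assumes "regular_fun f"
  shows "primitive_on I f (\<lambda>x. qderiv f x / of_real (p x))"
proof (rule primitive_on_cong_AE [OF ac_loc_primitive I_lebesgue])
  show "ac_loc f" using assms by (simp add: regular_fun_def)
  have "AE x in lebesgue_on I. qderiv f x = of_real (p x) * vector_derivative f (at x)"
    using regular_fun_qderiv [OF assms] by (simp add: is_qderiv_def ae_eq_def)
  with p_pos show "AE x in lebesgue_on I. vector_derivative f (at x) = qderiv f x / of_real (p x)"
    by eventually_elim simp
qed

lemma regular_primitive_qderiv:
  assumes "regular_fun f"
  shows "primitive_on I (qderiv f) (\<lambda>x. - (of_real (q x) * f x + of_real (w x) * sl_ell f x))"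
proof (rule primitive_on_cong_AE [OF ac_loc_primitive I_lebesgue])
  show "ac_loc (qderiv f)" using regular_fun_qderiv [OF assms] by (simp add: is_qderiv_def)
  show "AE x in lebesgue_on I. vector_derivative (qderiv f) (at x) = - (of_real (q x) * f x + of_real (w x) * sl_ell f x)"
    using w_pos by eventually_elim (simp add: sl_ell_def)
qed

lemma regular_continuous: "regular_fun f \<Longrightarrow> continuous_on I f"
  "regular_fun f \<Longrightarrow> continuous_on I (qderiv f)"
  using regular_primitive regular_primitive_qderiv primitive_on_continuous I_open by blast+

text \<open>The converse of \<open>regular_primitive\<close> and
  \<open>regular_primitive_qderiv\<close>: new regular functions are produced by exhibiting such a
  pair of primitives. The second claim is restricted to \<open>I\<close> because a quasi-derivative
  is 0 elsewhere by definition.\<close>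

lemma regular_funI:
  assumes f: "primitive_on I f (\<lambda>x. h x / of_real (p x))" and h: "primitive_on I h k"
  shows "regular_fun f" "\<And>x. x \<in> I \<Longrightarrow> qderiv f x = h x"
    "AE x in lebesgue_on I. sl_ell f x = - (1 / of_real (w x)) * (k x + of_real (q x) * f x)"
proof -
  define h' where "h' x = (if x \<in> I then h x else 0)" for x
  have h': "primitive_on I h' k" by (rule primitive_on_cong [OF h]) (simp add: h'_def)
  have "AE x in lebesgue_on I. vector_derivative f (at x) = h x / of_real (p x)"
    by (rule primitive_on_derivative [OF f I_open])
  with p_pos have "AE x in lebesgue_on I. x \<in> I \<longrightarrow> h' x = of_real (p x) * vector_derivative f (at x)"
    by eventually_elim (simp add: h'_def)
  then have "ae_eq h' (\<lambda>x. of_real (p x) * vector_derivative f (at x))"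
    unfolding ae_eq_def by (rule AE_mp) (auto intro!: AE_I2)
  then have isq: "is_qderiv f h'"
    unfolding is_qderiv_def using primitive_ac_loc [OF h'] by (auto simp: h'_def)
  then show "regular_fun f" unfolding regular_fun_def using primitive_ac_loc [OF f] isq by blast
  have eq: "qderiv f = h'" by (rule qderiv_eq [OF isq])
  then show "\<And>x. x \<in> I \<Longrightarrow> qderiv f x = h x" by (simp add: h'_def)
  show "AE x in lebesgue_on I. sl_ell f x = - (1 / of_real (w x)) * (k x + of_real (q x) * f x)"
    using primitive_on_derivative [OF h' I_open] by eventually_elim (simp add: sl_ell_def eq)
qed

section \<open>Algebra of regular functions and their Wronskians\<close>

lemma regular_cong:
  assumes f: "regular_fun f" and eq: "\<And>x. x \<in> I \<Longrightarrow> f x = g x"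
  shows "regular_fun g" "qderiv g = qderiv f" "AE x in lebesgue_on I. sl_ell g x = sl_ell f x"
proof -
  have g: "primitive_on I g (\<lambda>x. qderiv f x / of_real (p x))"
    by (rule primitive_on_cong [OF regular_primitive [OF f] eq])
  note * = regular_funI [OF g regular_primitive_qderiv [OF f]]
  show reg: "regular_fun g" by (rule *)
  show "qderiv g = qderiv f"
  proof
    fix x show "qderiv g x = qderiv f x"
      using *(2) [of x] regular_fun_qderiv [OF f] regular_fun_qderiv [OF reg]
      by (cases "x \<in> I") (auto simp: is_qderiv_def)
  qed
  have "AE x in lebesgue_on I. x \<in> I \<longrightarrow> sl_ell g x = sl_ell f x"
    using *(3) w_pos by eventually_elim (simp add: eq)
  then show "AE x in lebesgue_on I. sl_ell g x = sl_ell f x"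
    by (rule AE_mp) (auto intro!: AE_I2)
qed

lemma regular_lincomb:
  assumes f: "regular_fun f" and g: "regular_fun g"
  shows "regular_fun (\<lambda>x. c * f x + d * g x)"
    "qderiv (\<lambda>x. c * f x + d * g x) = (\<lambda>x. c * qderiv f x + d * qderiv g x)"
    "AE x in lebesgue_on I. sl_ell (\<lambda>x. c * f x + d * g x) x = c * sl_ell f x + d * sl_ell g x"
proof -
  have 1: "primitive_on I (\<lambda>x. c * f x + d * g x) (\<lambda>x. (c * qderiv f x + d * qderiv g x) / of_real (p x))"
    using primitive_on_add [OF primitive_on_cmult [OF regular_primitive [OF f], of c] primitive_on_cmult [OF regular_primitive [OF g], of d]]
    by (simp add: add_divide_distrib)
  note 2 = primitive_on_add [OF primitive_on_cmult [OF regular_primitive_qderiv [OF f], of c] primitive_on_cmult [OF regular_primitive_qderiv [OF g], of d]]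
  note * = regular_funI [OF 1 2]
  show reg: "regular_fun (\<lambda>x. c * f x + d * g x)" by (rule *)
  show "qderiv (\<lambda>x. c * f x + d * g x) = (\<lambda>x. c * qderiv f x + d * qderiv g x)"
  proof
    fix x show "qderiv (\<lambda>x. c * f x + d * g x) x = c * qderiv f x + d * qderiv g x"
      using *(2) [of x] regular_fun_qderiv [OF f] regular_fun_qderiv [OF g] regular_fun_qderiv [OF reg]
      by (cases "x \<in> I") (auto simp: is_qderiv_def)
  qed
  show "AE x in lebesgue_on I. sl_ell (\<lambda>x. c * f x + d * g x) x = c * sl_ell f x + d * sl_ell g x"
    using *(3) w_pos
  proof eventually_elim
    case (elim x)
    have "c * - (of_real (q x) * f x + of_real (w x) * sl_ell f x) + d * - (of_real (q x) * g x + of_real (w x) * sl_ell g x)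
        + of_real (q x) * (c * f x + d * g x) = - (of_real (w x) * (c * sl_ell f x + d * sl_ell g x))"
      by (simp add: algebra_simps)
    then show ?case using elim by simp
  qed
qed

lemma regular_cnj:
  assumes f: "regular_fun f"
  shows "regular_fun (\<lambda>x. cnj (f x))" "qderiv (\<lambda>x. cnj (f x)) = (\<lambda>x. cnj (qderiv f x))"
    "AE x in lebesgue_on I. sl_ell (\<lambda>x. cnj (f x)) x = cnj (sl_ell f x)"
proof -
  have 1: "primitive_on I (\<lambda>x. cnj (f x)) (\<lambda>x. cnj (qderiv f x) / of_real (p x))"
    using primitive_on_cnj [OF regular_primitive [OF f]] by simp
  note 2 = primitive_on_cnj [OF regular_primitive_qderiv [OF f]]
  note * = regular_funI [OF 1 2]
  show reg: "regular_fun (\<lambda>x. cnj (f x))" by (rule *)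
  show "qderiv (\<lambda>x. cnj (f x)) = (\<lambda>x. cnj (qderiv f x))"
  proof
    fix x show "qderiv (\<lambda>x. cnj (f x)) x = cnj (qderiv f x)"
      using *(2) [of x] regular_fun_qderiv [OF f] regular_fun_qderiv [OF reg]
      by (cases "x \<in> I") (auto simp: is_qderiv_def)
  qed
  show "AE x in lebesgue_on I. sl_ell (\<lambda>x. cnj (f x)) x = cnj (sl_ell f x)"
    using *(3) w_pos by eventually_elim (simp add: field_simps)
qed

text \<open>The bracket without conjugation. Being bilinear and antisymmetric, it is constant on
  pairs of solutions for the same \<open>z\<close>; conjugates are inserted only when the bracket
  itself is needed (\<open>bracket_wronskian\<close>).\<close>

definition wronskian :: "(real \<Rightarrow> complex) \<Rightarrow> (real \<Rightarrow> complex) \<Rightarrow> real \<Rightarrow> complex" where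
  "wronskian f g x = f x * qderiv g x - qderiv f x * g x"

lemma bracket_wronskian: "regular_fun g \<Longrightarrow> bracket f g = wronskian f (\<lambda>x. cnj (g x))"
  by (auto simp: bracket_def wronskian_def regular_cnj)

text \<open>Lagrange's identity: in the product rule the terms with \<open>1/p\<close> and those
  with \<open>q\<close> cancel.\<close>

lemma wronskian_primitive:
  assumes f: "regular_fun f" and g: "regular_fun g"
  shows "primitive_on I (wronskian f g) (\<lambda>x. (sl_ell f x * g x - f x * sl_ell g x) * of_real (w x))"
proof -
  have "primitive_on I (\<lambda>x. f x * qderiv g x - qderiv f x * g x)
   (\<lambda>x. (qderiv f x / of_real (p x) * qderiv g x + f x * - (of_real (q x) * g x + of_real (w x) * sl_ell g x))
     - (- (of_real (q x) * f x + of_real (w x) * sl_ell f x) * g x + qderiv f x * (qderiv g x / of_real (p x))))"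
    by (intro primitive_on_diff primitive_on_mult regular_primitive regular_primitive_qderiv f g I_open)
  then show ?thesis
    by (simp add: algebra_simps wronskian_def [abs_def])
qed

text \<open>Values \<open>(1, 0)\<close> and \<open>(0, 1)\<close> of function and quasi-derivative
  at a base point give Wronskian 1 there, and by Lagrange's identity it is constant. Extension by 0
  outside \<open>I\<close> is the convention of \<open>dmax\<close>.\<close>

lemma solution_pair:
  obtains \<phi> \<psi> where "solution z \<phi>" "solution z \<psi>" "\<And>x. x \<notin> I \<Longrightarrow> \<phi> x = 0" "\<And>x. x \<notin> I \<Longrightarrow> \<psi> x = 0"
    "\<And>x. x \<in> I \<Longrightarrow> wronskian \<phi> \<psi> x = 1"
proof -
  obtain x0 where x0: "x0 \<in> I" by (rule base_point)
  have "locally_integrable_on I (\<lambda>x. - (of_real (q x) + z * of_real (w x)))"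
    unfolding locally_integrable_on_def
  proof (intro allI impI)
    fix c d :: real assume cd: "c \<le> d" "{c..d} \<subseteq> I"
    have "(\<lambda>x. complex_of_real (q x)) absolutely_integrable_on {c..d}" "(\<lambda>x. z * complex_of_real (w x)) absolutely_integrable_on {c..d}"
      using q_loc w_loc cd by (auto simp: locally_integrable_on_def intro: set_integrable_mult_right)
    from set_integral_add(1) [OF this] 
    have "(\<lambda>x. (-1) * (of_real (q x) + z * of_real (w x))) absolutely_integrable_on {c..d}"
      by (rule set_integrable_mult_right)
    then show "(\<lambda>x. - (of_real (q x) + z * of_real (w x))) absolutely_integrable_on {c..d}" by simp
  qed
  then have sys: "linear_system I x0 (\<lambda>x. of_real (1 / p x)) (\<lambda>x. - (of_real (q x) + z * of_real (w x)))"
    using x0 I_interval I_open inv_p_loc by unfold_locales auto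
  have ex: "\<exists>y. solution z y \<and> (\<forall>x. x \<notin> I \<longrightarrow> y x = 0) \<and> y x0 = y0 \<and> qderiv y x0 = h0" for y0 h0
  proof -
    interpret linear_system I x0 "\<lambda>x. of_real (1 / p x)" "\<lambda>x. - (of_real (q x) + z * of_real (w x))" y0 h0
      by (rule sys)
    define y where "y x = (if x \<in> I then solution_y x else 0)" for x
    have 1: "primitive_on I y (\<lambda>x. solution_h x / of_real (p x))"
      by (rule primitive_on_cong [of _ solution_y]) (use solution_primitive(1) in \<open>simp_all add: y_def\<close>)
    note * = regular_funI [OF 1 solution_primitive(2)]
    have "AE x in lebesgue_on I. x \<in> I \<longrightarrow> sl_ell y x = z * y x"
      using *(3) w_pos
    proof eventually_elim
      case (elim x)
      show ?case
      proof
        assume "x \<in> I"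
        then have "- (of_real (q x) + z * of_real (w x)) * solution_y x + of_real (q x) * y x = - (of_real (w x) * (z * y x))"
          by (simp add: y_def algebra_simps)
        then show "sl_ell y x = z * y x" using elim by simp
      qed
    qed
    then have "AE x in lebesgue_on I. sl_ell y x = z * y x"
      by (rule AE_mp) (auto intro!: AE_I2)
    then have "solution z y" using *(1) by (simp add: solution_def ae_eq_def)
    moreover have "y x0 = y0" "qderiv y x0 = h0" using *(2) [of x0] x0 solution_initial by (simp_all add: y_def)
    moreover have "\<forall>x. x \<notin> I \<longrightarrow> y x = 0" by (simp add: y_def)
    ultimately show ?thesis by blast
  qed
  obtain \<phi> where \<phi>: "solution z \<phi>" "\<And>x. x \<notin> I \<Longrightarrow> \<phi> x = 0" "\<phi> x0 = 1" "qderiv \<phi> x0 = 0"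
    using ex [of 1 0] by blast
  obtain \<psi> where \<psi>: "solution z \<psi>" "\<And>x. x \<notin> I \<Longrightarrow> \<psi> x = 0" "\<psi> x0 = 0" "qderiv \<psi> x0 = 1"
    using ex [of 0 1] by blast
  have reg: "regular_fun \<phi>" "regular_fun \<psi>" using \<phi> \<psi> by (auto simp: solution_def)
  have "AE x in lebesgue_on I. sl_ell \<phi> x = z * \<phi> x" "AE x in lebesgue_on I. sl_ell \<psi> x = z * \<psi> x"
    using \<phi>(1) \<psi>(1) by (auto simp: solution_def ae_eq_def)
  then have "AE x in lebesgue_on I. (sl_ell \<phi> x * \<psi> x - \<phi> x * sl_ell \<psi> x) * of_real (w x) = 0"
    by eventually_elim simp
  then have W: "primitive_on I (wronskian \<phi> \<psi>) (\<lambda>_. 0)"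
    using wronskian_primitive [OF reg] by (rule_tac primitive_on_cong_AE [OF _ I_lebesgue]) 
  have "wronskian \<phi> \<psi> x = 1" if x: "x \<in> I" for x
  proof -
    have "wronskian \<phi> \<psi> x = wronskian \<phi> \<psi> x0"
      using primitive_onD(3) [OF W, of x x0] primitive_onD(3) [OF W, of x0 x] I_segment [OF x x0] I_segment [OF x0 x]
      by (cases "x \<le> x0") auto
    then show ?thesis using \<phi> \<psi> by (simp add: wronskian_def)
  qed
  then show thesis using that \<phi> \<psi> by blast
qed

end


section \<open>Behaviour at the endpoints\<close>

text \<open>Treats both endpoints at once: \<open>T n\<close> are tails that shrink to the endpoint,
  and \<open>Fl\<close> is the filter of approach to it through real points, also when the endpoint
  is infinite.\<close>

locale interval_tail =
  fixes S :: "real set" and T :: "nat \<Rightarrow> real set" and Fl :: "real filter"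
  assumes T_sub: "T n \<subseteq> S" and T_leb: "T n \<in> sets lebesgue" and T_int: "is_interval (T n)"
    and T_dec: "n \<le> m \<Longrightarrow> T m \<subseteq> T n" and T_empty: "(\<Inter>n. T n) = {}" and T_ne: "T n \<noteq> {}"
    and T_ev: "eventually (\<lambda>x. x \<in> T n) Fl" and Fl_nontriv: "Fl \<noteq> bot"
begin

lemma absolutely_integrable_tail:
  fixes k :: "real \<Rightarrow> 'b::euclidean_space"
  assumes "k absolutely_integrable_on T m" "m \<le> n"
  shows "k absolutely_integrable_on T n"
  using assms T_leb T_dec by (blast intro: set_integrable_subset)

text \<open>The tails have empty intersection, so \<open>k\<close> restricted to them tends to 0
  pointwise and dominated convergence applies.\<close>

lemma small_tail:
  fixes k :: "real \<Rightarrow> 'b::euclidean_space"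
  assumes k: "k absolutely_integrable_on T m" and \<epsilon>: "0 < \<epsilon>"
  obtains n where "m \<le> n" "integral (T n) (\<lambda>x. norm (k x)) < \<epsilon>"
proof -
  let ?f = "\<lambda>n x. if x \<in> T (n + m) then norm (k x) else 0"
  have nk: "(\<lambda>x. norm (k x)) integrable_on T n" if "m \<le> n" for n
    using absolutely_integrable_tail [OF k that] by (simp add: absolutely_integrable_on_def)
  have inter: "T (n + m) \<inter> T m = T (n + m)" for n using T_dec [of m "n + m"] by auto
  have "(\<lambda>n. integral (T m) (?f n)) \<longlonglongrightarrow> integral (T m) (\<lambda>x. 0)"
  proof (rule dominated_convergence(2))
    show "?f n integrable_on T m" for n
      unfolding Henstock_Kurzweil_Integration.integrable_restrict_Int inter by (rule nk) simp
    show "(\<lambda>x. norm (k x)) integrable_on T m" by (rule nk) simp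
    show "norm (?f n x) \<le> norm (k x)" for n x by simp
    fix x
    obtain N where N: "x \<notin> T N" using T_empty by blast
    then have "x \<notin> T (n + m)" if "N \<le> n" for n using T_dec [of N "n + m"] that by auto
    then have "\<forall>\<^sub>F n in sequentially. ?f n x = 0" unfolding eventually_sequentially by auto
    then show "(\<lambda>n. ?f n x) \<longlonglongrightarrow> 0" by (rule tendsto_eventually)
  qed
  then have "(\<lambda>n. integral (T (n + m)) (\<lambda>x. norm (k x))) \<longlonglongrightarrow> 0"
    unfolding Henstock_Kurzweil_Integration.integral_restrict_Int inter by simp
  then have "\<forall>\<^sub>F n in sequentially. integral (T (n + m)) (\<lambda>x. norm (k x)) < \<epsilon>"
    using \<epsilon> by (rule order_tendstoD)
  then obtain n where "integral (T (n + m)) (\<lambda>x. norm (k x)) < \<epsilon>" by (auto simp: eventually_sequentially)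
  then show thesis using that [of "n + m"] by simp
qed

lemma segment_tail: "x \<in> T n \<Longrightarrow> y \<in> T n \<Longrightarrow> {x..y} \<subseteq> T n"
  using is_interval_segment [OF T_int] .

lemma primitive_oscillation:
  assumes F: "primitive_on S F g" and g: "g absolutely_integrable_on T n" and xy: "x \<in> T n" "y \<in> T n"
  shows "norm (F x - F y) \<le> integral (T n) (\<lambda>x. norm (g x))"
  using xy
proof (induction x y rule: linorder_wlog)
  case (le x y)
  then have sub: "{x..y} \<subseteq> T n" "{x..y} \<subseteq> S" using segment_tail [of x n y] T_sub by auto
  have gi: "(\<lambda>x. norm (g x)) integrable_on T n" using g by (simp add: absolutely_integrable_on_def)
  have gi': "(\<lambda>x. norm (g x)) integrable_on {x..y}" 
    using primitive_onD(1) [OF F le(1) sub(2)] by (simp add: absolutely_integrable_on_def)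
  have "norm (F x - F y) = norm (integral {x..y} g)"
    using primitive_onD(3) [OF F le(1) sub(2)] norm_minus_commute [of "F x" "F y"] by simp
  also have "\<dots> \<le> integral {x..y} (\<lambda>x. norm (g x))"
    by (rule integral_norm_bound_integral [OF primitive_onD(2) [OF F le(1) sub(2)] gi']) simp
  also have "\<dots> \<le> integral (T n) (\<lambda>x. norm (g x))" by (rule integral_subset_le [OF sub(1) gi' gi]) simp
  finally show ?case .
next
  case (sym x y)
  then show ?case by (simp add: norm_minus_commute)
qed

text \<open>The oscillation of \<open>F\<close> on a tail is at most the mass of \<open>g\<close>
  there, which tends to 0: this is Cauchy's criterion, with a bound that is uniform on each
  tail.\<close>

lemma primitive_tail_limit:
  assumes F: "primitive_on S F g" and g: "g absolutely_integrable_on T m"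
  obtains L where "(F \<longlongrightarrow> L) Fl"
    "\<And>n x. m \<le> n \<Longrightarrow> x \<in> T n \<Longrightarrow> norm (F x - L) \<le> integral (T n) (\<lambda>x. norm (g x))"
proof -
  have "\<forall>n. \<exists>x. x \<in> T n" using T_ne by blast
  then obtain z where z: "\<And>n. z n \<in> T n" by metis
  have zT: "z k \<in> T n" if "n \<le> k" for n k using z [of k] T_dec [OF that] by auto
  have osc: "norm (F x - F y) \<le> integral (T n) (\<lambda>x. norm (g x))" if "m \<le> n" "x \<in> T n" "y \<in> T n" for n x y
    by (rule primitive_oscillation [OF F absolutely_integrable_tail [OF g that(1)] that(2,3)])
  have "Cauchy (\<lambda>n. F (z n))"
    unfolding Cauchy_def
  proof (intro allI impI)
    fix \<epsilon> :: real assume "0 < \<epsilon>"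
    then obtain n where n: "m \<le> n" "integral (T n) (\<lambda>x. norm (g x)) < \<epsilon>" using small_tail [OF g] by blast
    then show "\<exists>M. \<forall>i\<ge>M. \<forall>j\<ge>M. dist (F (z i)) (F (z j)) < \<epsilon>"
      using osc [OF n(1) zT zT] by (intro exI [of _ n]) (auto simp: dist_norm intro: le_less_trans)
  qed
  then obtain L where L: "(\<lambda>n. F (z n)) \<longlonglongrightarrow> L" using Cauchy_convergent convergent_def by blast
  have bound: "norm (F x - L) \<le> integral (T n) (\<lambda>x. norm (g x))" if "m \<le> n" "x \<in> T n" for n x
  proof (rule Lim_bounded)
    show "(\<lambda>k. norm (F x - F (z k))) \<longlonglongrightarrow> norm (F x - L)" by (intro tendsto_intros L)
    show "\<forall>k\<ge>n. norm (F x - F (z k)) \<le> integral (T n) (\<lambda>x. norm (g x))"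
      using osc [OF that zT] by blast
  qed
  have "(F \<longlongrightarrow> L) Fl"
  proof (rule tendstoI)
    fix \<epsilon> :: real assume "0 < \<epsilon>"
    then obtain n where n: "m \<le> n" "integral (T n) (\<lambda>x. norm (g x)) < \<epsilon>" using small_tail [OF g] by blast
    show "\<forall>\<^sub>F x in Fl. dist (F x) L < \<epsilon>"
      using T_ev [of n] by eventually_elim (use bound [OF n(1)] n(2) in \<open>auto simp: dist_norm intro: le_less_trans\<close>)
  qed
  then show thesis using bound that by blast
qed

end

context sturm_liouville
begin

section \<open>The endpoints as filters, and solutions near them\<close>

definition end_a :: "real filter" where "end_a = filtermap real_of_ereal (at_right a)"
definition end_b :: "real filter" where "end_b = filtermap real_of_ereal (at_left b)"

lemma ab: "a < b" using coef by (simp add: coefficients_def)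

lemma end_a_nontriv: "end_a \<noteq> bot"
proof -
  have "\<not> (\<forall>y>a. y < c \<longrightarrow> False)" if "a < c" for c using dense [OF that] by blast
  then have "\<not> eventually (\<lambda>_. False) (at_right a)" unfolding eventually_at_right [OF ab] by blast
  then show ?thesis by (simp add: end_a_def trivial_limit_def eventually_filtermap)
qed

lemma end_b_nontriv: "end_b \<noteq> bot"
proof -
  have "\<not> (\<forall>y>c. y < b \<longrightarrow> False)" if "c < b" for c using dense [OF that] by blast
  then have "\<not> eventually (\<lambda>_. False) (at_left b)" unfolding eventually_at_left [OF ab] by blast
  then show ?thesis by (simp add: end_b_def trivial_limit_def eventually_filtermap)
qed

lemma eventually_end_a: "c \<in> I \<Longrightarrow> eventually (\<lambda>x. x \<in> I \<and> x < c) end_a"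
  unfolding end_a_def eventually_filtermap
proof (rule eventually_at_rightI [of a "ereal c"])
  fix x assume c: "c \<in> I" and x: "x \<in> {a<..<ereal c}"
  then have "\<bar>x\<bar> \<noteq> \<infinity>" by (cases x) auto
  then have "ereal (real_of_ereal x) = x" by (simp add: ereal_real)
  then show "real_of_ereal x \<in> I \<and> real_of_ereal x < c"
    using x c unfolding einterval_def by (metis (mono_tags, lifting) greaterThanLessThan_iff less_ereal.simps(1) less_trans mem_Collect_eq)
qed (auto simp: einterval_def)

lemma eventually_end_b: "c \<in> I \<Longrightarrow> eventually (\<lambda>x. x \<in> I \<and> c < x) end_b"
  unfolding end_b_def eventually_filtermap
proof (rule eventually_at_leftI [of "ereal c"])
  fix x assume c: "c \<in> I" and x: "x \<in> {ereal c<..<b}"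
  then have "\<bar>x\<bar> \<noteq> \<infinity>" by (cases x) auto
  then have "ereal (real_of_ereal x) = x" by (simp add: ereal_real)
  then show "real_of_ereal x \<in> I \<and> c < real_of_ereal x"
    using x c unfolding einterval_def by (metis (mono_tags, lifting) greaterThanLessThan_iff less_ereal.simps(1) less_trans mem_Collect_eq)
qed (auto simp: einterval_def)

lemma I_tail_interval: "is_interval {x \<in> I. x < c}" "is_interval {x \<in> I. c < x}"
  using is_interval_Int [OF I_interval is_interval_io, of c] is_interval_Int [OF I_interval is_interval_oi, of c]
  by (simp_all add: Int_def)

lemma I_tail_lebesgue: "{x \<in> I. x < c} \<in> sets lebesgue" "{x \<in> I. c < x} \<in> sets lebesgue"
proof -
  have "open (I \<inter> {..<c})" "open (I \<inter> {c<..})" using I_open by (intro open_Int; simp)+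
  then show "{x \<in> I. x < c} \<in> sets lebesgue" "{x \<in> I. c < x} \<in> sets lebesgue"
    by (auto simp: Int_def)
qed

lemma exhaustion:
  obtains l u :: "nat \<Rightarrow> real" where "\<And>n. l n \<in> I" "\<And>n. u n \<in> I" "\<And>n. l n < u n"
    "interval_tail I (\<lambda>n. {x\<in>I. x < l n}) end_a" "interval_tail I (\<lambda>n. {x\<in>I. u n < x}) end_b"
    "I = (\<Union>i. {l i..u i})" "incseq (\<lambda>i. {l i..u i})"
proof (rule einterval_Icc_approximation [OF ab])
  fix u l :: "nat \<Rightarrow> real"
  assume lu: "I = (\<Union>i. {l i..u i})" "incseq u" "decseq l"
    "\<And>i. l i < u i" "\<And>i. a < ereal (l i)" "\<And>i. ereal (u i) < b"
  have lI: "l n \<in> I" "u n \<in> I" for n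
  proof -
    have "l n \<in> {l n..u n}" "u n \<in> {l n..u n}" using lu(4) [of n] by auto
    then show "l n \<in> I" "u n \<in> I" using lu(1) by blast+
  qed
  have out: "\<exists>i. l i \<le> x \<and> x \<le> u i" if "x \<in> I" for x using that lu(1) by auto
  have "interval_tail I (\<lambda>n. {x\<in>I. x < l n}) end_a"
  proof
    fix n m :: nat
    show "{x \<in> I. x < l m} \<subseteq> {x \<in> I. x < l n}" if "n \<le> m" using decseqD [OF lu(3) that] by auto
    show "{x \<in> I. x < l n} \<noteq> {}" 
    proof -
      obtain y where y: "a < ereal y" "ereal y < ereal (l n)" using ereal_dense2 [OF lu(5) [of n]] by blast
      have "ereal (l n) < b" using lI(1) [of n] by (simp add: einterval_def)
      with y(2) have "ereal y < b" by (rule less_trans)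
      with y have "y \<in> I" "y < l n" by (auto simp: einterval_def)
      then show ?thesis by blast
    qed
    show "(\<Inter>n. {x \<in> I. x < l n}) = {}"
    proof (rule equals0I)
      fix x assume "x \<in> (\<Inter>n. {x \<in> I. x < l n})"
      then have "x \<in> I" "\<And>n. x < l n" by auto
      then show False using out [of x] by (meson not_less)
    qed
    show "eventually (\<lambda>x. x \<in> {x \<in> I. x < l n}) end_a" using eventually_end_a [OF lI(1)] by simp
  qed (auto simp: end_a_nontriv I_tail_interval I_tail_lebesgue)
  moreover have "interval_tail I (\<lambda>n. {x\<in>I. u n < x}) end_b"
  proof
    fix n m :: nat
    show "{x \<in> I. u m < x} \<subseteq> {x \<in> I. u n < x}" if "n \<le> m" using incseqD [OF lu(2) that] by auto
    show "{x \<in> I. u n < x} \<noteq> {}" 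
    proof -
      obtain y where y: "ereal (u n) < ereal y" "ereal y < b" using ereal_dense2 [OF lu(6) [of n]] by blast
      have "a < ereal (u n)" using lI(2) [of n] by (simp add: einterval_def)
      from this y(1) have "a < ereal y" by (rule less_trans)
      with y have "y \<in> I" "u n < y" by (auto simp: einterval_def)
      then show ?thesis by blast
    qed
    show "(\<Inter>n. {x \<in> I. u n < x}) = {}"
    proof (rule equals0I)
      fix x assume "x \<in> (\<Inter>n. {x \<in> I. u n < x})"
      then have "x \<in> I" "\<And>n. u n < x" by auto
      then show False using out [of x] by (meson not_less)
    qed
    show "eventually (\<lambda>x. x \<in> {x \<in> I. u n < x}) end_b" using eventually_end_b [OF lI(2)] by simp
  qed (auto simp: end_b_nontriv I_tail_interval I_tail_lebesgue)
  moreover have "incseq (\<lambda>i. {l i..u i})"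
    using lu(2,3) by (auto simp: incseq_def decseq_def intro: order_trans)
  ultimately show thesis by (intro that [of l u] lI lu(4) lu(1))
qed

text \<open>Local integrability gives measurability on segments; \<open>w\<close> is the pointwise
  limit of its restrictions to the segments of an exhaustion.\<close>

lemma w_measurable: "w \<in> borel_measurable (lebesgue_on I)"
proof -
  obtain l u where lu: "I = (\<Union>i. {l i..u i})" "incseq (\<lambda>i. {l i..u i})" by (rule exhaustion)
  have w_int: "w absolutely_integrable_on {l i..u i}" for i
    using coef lu(1) unfolding coefficients_def l1_loc_def by blast
  show ?thesis
  proof (rule borel_measurable_LIMSEQ_real)
    show "(\<lambda>x. indicator {l i..u i} x *\<^sub>R w x) \<in> borel_measurable (lebesgue_on I)" for i
      using w_int [of i] unfolding set_integrable_def by (intro measurable_restrict_space1) auto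
    fix x assume "x \<in> space (lebesgue_on I)"
    then have "x \<in> I" by simp
    then obtain N where "x \<in> {l N..u N}" using lu(1) by blast
    then have "x \<in> {l i..u i}" if "N \<le> i" for i using lu(2) that unfolding incseq_def by blast
    then have "\<forall>\<^sub>F i in sequentially. indicator {l i..u i} x *\<^sub>R w x = w x"
      unfolding eventually_sequentially by (intro exI [of _ N]) auto
    then show "(\<lambda>i. indicator {l i..u i} x *\<^sub>R w x) \<longlonglongrightarrow> w x" by (rule tendsto_eventually)
  qed
qed

lemma measurable_subset: 
  assumes "f \<in> borel_measurable (lebesgue_on I)" "S \<subseteq> I"
  shows "f \<in> borel_measurable (lebesgue_on S)"
  using measurable_restrict_mono [OF assms] .

lemma regular_measurable:
  assumes "regular_fun f" "S \<subseteq> I"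
  shows "f \<in> borel_measurable (lebesgue_on S)"
  by (rule measurable_subset [OF continuous_imp_measurable_on_sets_lebesgue
        [OF regular_continuous(1) [OF assms(1)] I_lebesgue] assms(2)])

lemma l2_on_bounded:
  assumes y: "regular_fun y" and S: "S \<subseteq> I" "S \<in> sets lebesgue"
    and fg: "l2_on S f" "l2_on S g"
    and bound: "\<And>x. x \<in> S \<Longrightarrow> norm (y x) \<le> B * (norm (f x) + norm (g x))"
  shows "l2_on S y"
  unfolding l2_on_def
proof
  show y': "y \<in> borel_measurable (lebesgue_on S)" by (rule regular_measurable [OF y S(1)])
  have [measurable]: "w \<in> borel_measurable (lebesgue_on S)" by (rule measurable_subset [OF w_measurable S(1)])
  let ?k = "\<lambda>x. norm ((norm (f x))\<^sup>2 * w x) + norm ((norm (g x))\<^sup>2 * w x)"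
  have "?k absolutely_integrable_on S"
    using fg unfolding l2_on_def by (intro set_integral_add(1) set_integrable_norm) auto
  then have k: "(\<lambda>x. 2 * B\<^sup>2 * ?k x) integrable_on S" by (simp add: absolutely_integrable_on_def integrable_on_mult_right)
  show "(\<lambda>x. (norm (y x))\<^sup>2 * w x) absolutely_integrable_on S"
  proof (rule measurable_bounded_by_integrable_imp_absolutely_integrable [OF _ S(2) k])
    show "(\<lambda>x. (norm (y x))\<^sup>2 * w x) \<in> borel_measurable (lebesgue_on S)" using y' by measurable
    fix x assume "x \<in> S"
    then have "(norm (y x))\<^sup>2 \<le> (B * (norm (f x) + norm (g x)))\<^sup>2" by (intro power_mono bound) auto
    also have "\<dots> \<le> B\<^sup>2 * (2 * (norm (f x))\<^sup>2 + 2 * (norm (g x))\<^sup>2)"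
      unfolding power_mult_distrib using sum_squares_bound [of "norm (f x)" "norm (g x)"]
      by (intro mult_left_mono) (auto simp: power2_sum)
    finally have "(norm (y x))\<^sup>2 * \<bar>w x\<bar> \<le> B\<^sup>2 * (2 * (norm (f x))\<^sup>2 + 2 * (norm (g x))\<^sup>2) * \<bar>w x\<bar>"
      by (intro mult_right_mono) auto
    then show "norm ((norm (y x))\<^sup>2 * w x) \<le> 2 * B\<^sup>2 * ?k x" by (simp add: abs_mult algebra_simps)
  qed
qed

lemma solution_wronskian_primitive:
  assumes y: "solution \<zeta> y" and f: "solution z f"
  shows "primitive_on I (wronskian y f) (\<lambda>x. (\<zeta> - z) * y x * f x * of_real (w x))"
proof (rule primitive_on_cong_AE [OF wronskian_primitive I_lebesgue])
  have "AE x in lebesgue_on I. sl_ell y x = \<zeta> * y x" "AE x in lebesgue_on I. sl_ell f x = z * f x"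
    using y f by (auto simp: solution_def ae_eq_def)
  then show "AE x in lebesgue_on I. (sl_ell y x * f x - y x * sl_ell f x) * of_real (w x) = (\<zeta> - z) * y x * f x * of_real (w x)"
    by eventually_elim (simp add: algebra_simps)
qed (use y f in \<open>auto simp: solution_def\<close>)

text \<open>On a tail where the coefficient of the integral equation for \<open>C1\<close>, \<open>C2\<close> has mass at most \<open>1/4\<close>,
  the maximum of \<open>norm C1 + norm C2\<close> over a segment is at most twice its value at the starting point.\<close>

lemma weyl_bound:
  assumes tail: "interval_tail I T Fl"
    and \<phi>: "solution z \<phi>" "l2_on (T m) \<phi>" and \<psi>: "solution z \<psi>" "l2_on (T m) \<psi>"
    and W: "\<And>x. x \<in> I \<Longrightarrow> wronskian \<phi> \<psi> x = 1"
    and y: "solution \<zeta> y"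
  obtains n where "m \<le> n" "l2_on (T n) y"
proof -
  interpret interval_tail I T Fl by (rule tail)
  \<comment> \<open>\<open>C1\<close> and \<open>- C2\<close> are the varying coordinates of
    \<open>y\<close> with respect to \<open>\<phi>\<close> and \<open>\<psi>\<close>. Their
    derivatives are multiples of \<open>y\<close>, hence combinations of \<open>C1\<close> and
    \<open>C2\<close> with integrable coefficients.\<close>
  define C1 where "C1 = wronskian y \<psi>"
  define C2 where "C2 = wronskian y \<phi>"
  have y_eq: "y x = C1 x * \<phi> x - C2 x * \<psi> x" if "x \<in> I" for x
  proof -
    have "C1 x * \<phi> x - C2 x * \<psi> x = y x * wronskian \<phi> \<psi> x"
      by (simp add: C1_def C2_def wronskian_def algebra_simps)
    then show ?thesis using W [OF that] by simp
  qed
  have P1: "primitive_on I C1 (\<lambda>x. (\<zeta> - z) * y x * \<psi> x * of_real (w x))"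
    unfolding C1_def by (rule solution_wronskian_primitive [OF y \<psi>(1)])
  have P2: "primitive_on I C2 (\<lambda>x. (\<zeta> - z) * y x * \<phi> x * of_real (w x))"
    unfolding C2_def by (rule solution_wronskian_primitive [OF y \<phi>(1)])
  \<comment> \<open>A majorant of all these coefficients; the factor 2 comes from bounding the
    square of a sum by twice the sum of the squares.\<close>
  define k where "k x = 2 * norm (\<zeta> - z) * (norm ((norm (\<phi> x))\<^sup>2 * w x) + norm ((norm (\<psi> x))\<^sup>2 * w x))" for x
  have k0: "0 \<le> k x" for x by (simp add: k_def)
  have k_int: "k absolutely_integrable_on T m"
    using \<phi>(2) \<psi>(2) unfolding l2_on_def k_def
    by (intro set_integrable_mult_right set_integral_add(1) set_integrable_norm) auto
  obtain n where n: "m \<le> n" "integral (T n) (\<lambda>x. norm (k x)) < 1/4" by (rule small_tail [OF k_int, of "1/4"]) auto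
  have kn: "k absolutely_integrable_on T n" by (rule absolutely_integrable_tail [OF k_int n(1)])
  have kn_small: "integral (T n) k < 1/4" using n(2) k0 by simp
  define N where "N x = norm (C1 x) + norm (C2 x)" for x
  have N_cont: "continuous_on I N"
    unfolding N_def using primitive_on_continuous [OF P1 I_open] primitive_on_continuous [OF P2 I_open]
    by (intro continuous_intros)
  have pt: "norm (c * y x * f x * of_real (w x)) \<le> N x * k x"
    if "x \<in> I" "f = \<phi> \<or> f = \<psi>" "c = \<zeta> - z" for x f c
  proof -
    let ?u = "norm (\<phi> x)" and ?v = "norm (\<psi> x)"
    have "norm (y x) \<le> norm (C1 x) * ?u + norm (C2 x) * ?v"
      unfolding y_eq [OF that(1)] by (metis norm_mult norm_triangle_ineq4)
    also have "\<dots> \<le> N x * (?u + ?v)" by (simp add: N_def algebra_simps)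
    finally have 1: "norm (y x) \<le> N x * (?u + ?v)" .
    have 2: "norm (f x) \<le> ?u + ?v" using that by auto
    have "norm (c * y x * f x * of_real (w x)) = norm (\<zeta> - z) * (norm (y x) * norm (f x)) * \<bar>w x\<bar>"
      by (simp add: norm_mult that(3))
    also have "\<dots> \<le> norm (\<zeta> - z) * (N x * (?u + ?v) * (?u + ?v)) * \<bar>w x\<bar>"
      using 1 2 by (intro mult_right_mono mult_left_mono mult_mono) (auto simp: N_def)
    also have "\<dots> \<le> norm (\<zeta> - z) * (N x * (2 * ?u\<^sup>2 + 2 * ?v\<^sup>2)) * \<bar>w x\<bar>"
    proof -
      have "(?u + ?v) * (?u + ?v) \<le> 2 * ?u\<^sup>2 + 2 * ?v\<^sup>2"
        using sum_squares_bound [of ?u ?v] by (simp add: power2_eq_square algebra_simps)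
      then have "N x * ((?u + ?v) * (?u + ?v)) \<le> N x * (2 * ?u\<^sup>2 + 2 * ?v\<^sup>2)"
        by (rule mult_left_mono) (simp add: N_def)
      then show ?thesis by (intro mult_right_mono mult_left_mono) (auto simp: mult.assoc)
    qed
    also have "\<dots> = N x * k x" by (simp add: k_def abs_mult algebra_simps)
    finally show ?thesis .
  qed
  obtain x0 where x0: "x0 \<in> T n" using T_ne by blast
  have N_bound: "N x \<le> 2 * N x0" if x: "x \<in> T n" for x
  proof -
    let ?J = "{min x x0..max x x0}"
    have J: "?J \<subseteq> T n" using segment_tail [of "min x x0" n "max x x0"] x x0 by (auto simp: min_def max_def)
    have JI: "?J \<subseteq> I" using J T_sub by blast
    have "?J \<noteq> {}" by auto
    then have "\<exists>x1\<in>?J. \<forall>t\<in>?J. N t \<le> N x1"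
      by (rule continuous_attains_sup [OF compact_Icc _ continuous_on_subset [OF N_cont JI]])
    then obtain x1 where x1: "x1 \<in> ?J" "\<And>t. t \<in> ?J \<Longrightarrow> N t \<le> N x1" by blast
    have C_bound: "norm (C x1 - C x0) \<le> N x1 * (1/4)"
      if C: "primitive_on I C (\<lambda>x. (\<zeta> - z) * y x * f x * of_real (w x))" "f = \<phi> \<or> f = \<psi>" for C f
    proof -
      let ?c = "min x1 x0" and ?d = "max x1 x0"
      have K: "{?c..?d} \<subseteq> ?J" using x1(1) by auto
      then have KT: "{?c..?d} \<subseteq> T n" "{?c..?d} \<subseteq> I" using J JI by (blast intro: order_trans [OF K])+
      have kK: "k integrable_on {?c..?d}"
        using absolutely_integrable_on_subinterval [OF kn KT(1)] by (simp add: absolutely_integrable_on_def)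
      have "norm (C x1 - C x0) = norm (C ?d - C ?c)" by (auto simp: min_def max_def norm_minus_commute)
      also have "\<dots> = norm (integral {?c..?d} (\<lambda>x. (\<zeta> - z) * y x * f x * of_real (w x)))"
        using primitive_onD(3) [OF C(1) _ KT(2)] by simp
      also have "\<dots> \<le> integral {?c..?d} (\<lambda>x. N x1 * k x)"
      proof (rule integral_norm_bound_integral [OF primitive_onD(2) [OF C(1) _ KT(2)]])
        show "(\<lambda>x. N x1 * k x) integrable_on {?c..?d}" using kK by (rule integrable_on_mult_right)
        fix t assume t: "t \<in> {?c..?d}"
        then have "norm ((\<zeta> - z) * y t * f t * of_real (w t)) \<le> N t * k t" using pt C(2) KT(2) by blast
        also have "\<dots> \<le> N x1 * k t" by (intro mult_right_mono x1(2) subsetD [OF K t] k0)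
        finally show "norm ((\<zeta> - z) * y t * f t * of_real (w t)) \<le> N x1 * k t" .
      qed simp
      also have "\<dots> = N x1 * integral {?c..?d} k" by simp
      also have "\<dots> \<le> N x1 * (1/4)"
      proof (rule mult_left_mono)
        have "integral {?c..?d} k \<le> integral (T n) k"
          using kn kK k0 by (intro integral_subset_le KT) (auto simp: absolutely_integrable_on_def)
        then show "integral {?c..?d} k \<le> 1/4" using kn_small by simp
      qed (simp add: N_def)
      finally show ?thesis .
    qed
    \<comment> \<open>Each difference is at most a quarter of \<open>N x1\<close>, so
      \<open>N x1\<close> exceeds \<open>N x0\<close> by at most half of itself.\<close>
    have "N x1 \<le> N x0 + norm (C1 x1 - C1 x0) + norm (C2 x1 - C2 x0)"
      using norm_triangle_sub [of "C1 x1" "C1 x0"] norm_triangle_sub [of "C2 x1" "C2 x0"] by (simp add: N_def)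
    then have "N x1 \<le> 2 * N x0" using C_bound [OF P1] C_bound [OF P2] by simp
    then show ?thesis using x1(2) [of x] by force
  qed
  have "l2_on (T n) y"
  proof (rule l2_on_bounded [OF _ T_sub T_leb])
    show "regular_fun y" using y by (simp add: solution_def)
    show "l2_on (T n) \<phi>" "l2_on (T n) \<psi>"
      using \<phi> \<psi> T_sub absolutely_integrable_tail [OF _ n(1)]
      by (auto simp: l2_on_def solution_def intro!: regular_measurable)
    fix x assume x: "x \<in> T n"
    then have "x \<in> I" using T_sub by blast
    then have "norm (y x) \<le> norm (C1 x) * norm (\<phi> x) + norm (C2 x) * norm (\<psi> x)"
      using y_eq by (metis norm_mult norm_triangle_ineq4)
    also have "\<dots> \<le> N x * (norm (\<phi> x) + norm (\<psi> x))" by (simp add: N_def algebra_simps)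
    also have "\<dots> \<le> 2 * N x0 * (norm (\<phi> x) + norm (\<psi> x))" by (intro mult_right_mono N_bound x) auto
    finally show "norm (y x) \<le> 2 * N x0 * (norm (\<phi> x) + norm (\<psi> x))" .
  qed
  with n(1) that show thesis by blast
qed

end

context sturm_liouville
begin

section \<open>The weighted space and the maximal domain\<close>

lemma l2_on_subset:
  assumes "l2_on S f" "T \<subseteq> S" "T \<in> sets lebesgue"
  shows "l2_on T f"
  using assms unfolding l2_on_def by (blast intro: measurable_restrict_mono set_integrable_subset)

lemma l2_on_Un:
  assumes "regular_fun f" "l2_on S f" "l2_on T f" "S \<in> sets lebesgue" "T \<in> sets lebesgue" "S \<union> T \<subseteq> I"
  shows "l2_on (S \<union> T) f"
  using assms unfolding l2_on_def by (blast intro: regular_measurable set_integrable_Un)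

lemma l2_on_compact:
  assumes f: "regular_fun f" and cd: "{c..d} \<subseteq> I"
  shows "l2_on {c..d} f"
  unfolding l2_on_def
proof
  show "f \<in> borel_measurable (lebesgue_on {c..d})" by (rule regular_measurable [OF f cd])
  have cont: "continuous_on {c..d} (\<lambda>x. (norm (f x))\<^sup>2)"
    by (intro continuous_intros continuous_on_subset [OF regular_continuous(1) [OF f] cd])
  show "(\<lambda>x. (norm (f x))\<^sup>2 * w x) absolutely_integrable_on {c..d}"
  proof (rule absolutely_integrable_bounded_measurable_product_real)
    show "(\<lambda>x. (norm (f x))\<^sup>2) \<in> borel_measurable (lebesgue_on {c..d})"
      by (rule continuous_imp_measurable_on_sets_lebesgue [OF cont]) auto
    show "bounded ((\<lambda>x. (norm (f x))\<^sup>2) ` {c..d})"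
      by (intro compact_imp_bounded compact_continuous_image cont) auto
    show "w absolutely_integrable_on {c..d}"
      using coef cd unfolding coefficients_def l1_loc_def by blast
  qed auto
qed

lemma solution_regular: "solution z y \<Longrightarrow> regular_fun y"
  by (simp add: solution_def)

text \<open>Turns the weighted space into the square integrable functions of a measure, to which the
  general results apply. Since \<open>w > 0\<close> a.e., it has the same a.e. statements as
  \<open>lebesgue_on I\<close> (\<open>AE_weighted\<close>).\<close>

definition weighted :: "real measure" where
  "weighted = density (lebesgue_on I) (\<lambda>x. ennreal (w x))"

lemma w_nonneg: "AE x in lebesgue_on I. 0 \<le> w x"
  using w_pos by eventually_elim simp

lemma measurable_weighted: "f \<in> borel_measurable weighted \<longleftrightarrow> f \<in> borel_measurable (lebesgue_on I)"
  unfolding weighted_def by (simp add: measurable_def)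

lemma AE_weighted: "(AE x in weighted. P x) \<longleftrightarrow> (AE x in lebesgue_on I. P x)"
proof -
  have "(AE x in weighted. P x) \<longleftrightarrow> (AE x in lebesgue_on I. 0 < ennreal (w x) \<longrightarrow> P x)"
    unfolding weighted_def using w_measurable by (subst AE_density) auto
  also have "\<dots> \<longleftrightarrow> (AE x in lebesgue_on I. P x)"
  proof
    assume "AE x in lebesgue_on I. 0 < ennreal (w x) \<longrightarrow> P x"
    with w_pos show "AE x in lebesgue_on I. P x" by eventually_elim simp
  qed (auto elim: eventually_mono)
  finally show ?thesis .
qed

lemma integrable_lebesgue_on_I: "integrable (lebesgue_on I) f \<longleftrightarrow> f absolutely_integrable_on I"
  using I_lebesgue by (simp add: integrable_restrict_space set_integrable_def)

lemma integrable_weighted: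
  fixes f :: "real \<Rightarrow> 'b::euclidean_space"
  assumes "f \<in> borel_measurable (lebesgue_on I)"
  shows "integrable weighted f \<longleftrightarrow> (\<lambda>x. w x *\<^sub>R f x) absolutely_integrable_on I"
  unfolding weighted_def integrable_lebesgue_on_I [symmetric]
  by (rule integrable_density [OF assms w_measurable w_nonneg])

lemma l2_on_iff: "l2_on I f \<longleftrightarrow> sq_int weighted f"
proof -
  have "integrable weighted (\<lambda>x. (norm (f x))\<^sup>2) \<longleftrightarrow> (\<lambda>x. (norm (f x))\<^sup>2 * w x) absolutely_integrable_on I"
    if "f \<in> borel_measurable (lebesgue_on I)"
    using that by (subst integrable_weighted) (auto simp: mult.commute)
  then show ?thesis unfolding l2_on_def sq_int_def measurable_weighted by blast
qed

lemma l2_measurable: "l2_on S f \<Longrightarrow> f \<in> borel_measurable (lebesgue_on S)"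
  by (simp add: l2_on_def)

lemma wip_ip:
  assumes "f \<in> borel_measurable (lebesgue_on I)" "g \<in> borel_measurable (lebesgue_on I)"
  shows "wip f g = ip weighted f g"
proof -
  have "ip weighted f g = (\<integral>x. w x *\<^sub>R (f x * cnj (g x)) \<partial>lebesgue_on I)"
    unfolding ip_def weighted_def using assms by (intro integral_density w_measurable w_nonneg) auto
  also have "\<dots> = wip f g"
    unfolding wip_def by (intro Bochner_Integration.integral_cong) (auto simp: scaleR_conv_of_real mult.commute)
  finally show ?thesis by simp
qed

lemma wip_l2: "l2_on I f \<Longrightarrow> l2_on I g \<Longrightarrow> wip f g = ip weighted f g"
  by (intro wip_ip l2_measurable)

lemma wnorm_nsq: "l2_on I f \<Longrightarrow> wnorm f = sqrt (nsq weighted f)"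
  by (simp add: wnorm_def wip_l2 ip_self)

lemma borel_measurable_cong_AE_I:
  fixes f g :: "real \<Rightarrow> complex"
  assumes f: "f \<in> borel_measurable (lebesgue_on I)" and eq: "AE x in lebesgue_on I. f x = g x"
  shows "g \<in> borel_measurable (lebesgue_on I)"
proof (rule borel_measurable_if_D, rule borel_measurable_AE)
  show "(\<lambda>x. if x \<in> I then f x else 0) \<in> borel_measurable lebesgue"
    by (rule borel_measurable_if_I [OF f I_lebesgue])
  have "AE x in lebesgue. x \<in> I \<longrightarrow> f x = g x"
    using eq I_lebesgue by (subst (asm) AE_restrict_space_iff) auto
  then show "AE x in lebesgue. (if x \<in> I then f x else 0) = (if x \<in> I then g x else 0)"
    by eventually_elim auto
qed

lemma l2_on_cong_AE:
  assumes f: "l2_on I f" and eq: "AE x in lebesgue_on I. f x = g x"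
  shows "l2_on I g"
proof -
  have g: "g \<in> borel_measurable (lebesgue_on I)"
    by (rule borel_measurable_cong_AE_I [OF l2_measurable [OF f] eq])
  have "integrable weighted (\<lambda>x. (norm (g x))\<^sup>2)"
  proof (rule integrable_cong_AE_imp)
    show "integrable weighted (\<lambda>x. (norm (f x))\<^sup>2)" using f by (simp add: l2_on_iff sq_int_def)
    show "(\<lambda>x. (norm (g x))\<^sup>2) \<in> borel_measurable weighted" using g by (simp add: measurable_weighted)
    show "AE x in weighted. (norm (f x))\<^sup>2 = (norm (g x))\<^sup>2" unfolding AE_weighted using eq by eventually_elim simp
  qed
  then show ?thesis using g by (simp add: l2_on_iff sq_int_def measurable_weighted)
qed

lemma wip_cong:
  assumes "f \<in> borel_measurable (lebesgue_on I)" "g \<in> borel_measurable (lebesgue_on I)"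
    "AE x in lebesgue_on I. f x = f' x" "AE x in lebesgue_on I. g x = g' x"
  shows "wip f g = wip f' g'"
  unfolding wip_def
proof (rule integral_cong_AE)
  show "(\<lambda>x. f x * cnj (g x) * of_real (w x)) \<in> borel_measurable (lebesgue_on I)"
    using assms(1,2) w_measurable by measurable
  have "f' \<in> borel_measurable (lebesgue_on I)" "g' \<in> borel_measurable (lebesgue_on I)"
    using borel_measurable_cong_AE_I assms by blast+
  then show "(\<lambda>x. f' x * cnj (g' x) * of_real (w x)) \<in> borel_measurable (lebesgue_on I)"
    using w_measurable by measurable
  show "AE x in lebesgue_on I. f x * cnj (g x) * of_real (w x) = f' x * cnj (g' x) * of_real (w x)"
    using assms(3,4) by eventually_elim simp
qed

lemma l2_mult_integrable:
  assumes "l2_on I f" "l2_on I g"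
  shows "(\<lambda>x. f x * g x * of_real (w x)) absolutely_integrable_on I"
proof -
  have "integrable weighted (\<lambda>x. f x * g x)"
    using assms by (intro sq_int_integrable_mult) (auto simp: l2_on_iff)
  then have "(\<lambda>x. w x *\<^sub>R (f x * g x)) absolutely_integrable_on I"
    using assms l2_measurable by (subst (asm) integrable_weighted) auto
  then show ?thesis by (simp add: scaleR_conv_of_real mult.commute)
qed

lemma end_tails:
  obtains l u :: "nat \<Rightarrow> real" where "\<And>n. l n \<in> I" "\<And>n. u n \<in> I" "\<And>n. l n < u n"
    "interval_tail I (\<lambda>n. {x\<in>I. x < l n}) end_a" "interval_tail I (\<lambda>n. {x\<in>I. u n < x}) end_b"
proof (rule exhaustion)
  fix l u :: "nat \<Rightarrow> real"
  assume "\<And>n. l n \<in> I" "\<And>n. u n \<in> I" "\<And>n. l n < u n"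
    "interval_tail I (\<lambda>n. {x\<in>I. x < l n}) end_a" "interval_tail I (\<lambda>n. {x\<in>I. u n < x}) end_b"
  then show thesis by (rule that)
qed

definition max_dom :: "(real \<Rightarrow> complex) set" where
  "max_dom = {f. regular_fun f \<and> l2_on I f \<and> l2_on I (sl_ell f)}"

lemma max_domD:
  assumes "f \<in> max_dom"
  shows "regular_fun f" "l2_on I f" "l2_on I (sl_ell f)"
  using assms by (auto simp: max_dom_def)

lemma dmax_iff: "f \<in> dmax \<longleftrightarrow> f \<in> max_dom \<and> (\<forall>x. x \<notin> I \<longrightarrow> f x = 0)"
  by (auto simp: dmax_def max_dom_def)

lemma l2_lincomb: "l2_on I f \<Longrightarrow> l2_on I g \<Longrightarrow> l2_on I (\<lambda>x. c * f x + d * g x)"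
  unfolding l2_on_iff by (intro sq_int_add sq_int_cmult)

lemma l2_cnj: "l2_on I f \<Longrightarrow> l2_on I (\<lambda>x. cnj (f x))"
  unfolding l2_on_iff by (rule sq_int_cnj)

lemma max_dom_lincomb:
  assumes "f \<in> max_dom" "g \<in> max_dom"
  shows "(\<lambda>x. c * f x + d * g x) \<in> max_dom"
proof -
  note f = max_domD [OF assms(1)] and g = max_domD [OF assms(2)]
  have "AE x in lebesgue_on I. c * sl_ell f x + d * sl_ell g x = sl_ell (\<lambda>x. c * f x + d * g x) x"
    using regular_lincomb(3) [OF f(1) g(1), of c d] by eventually_elim simp
  then show ?thesis
    using regular_lincomb(1) [OF f(1) g(1)] l2_lincomb [OF f(2) g(2)] l2_on_cong_AE [OF l2_lincomb [OF f(3) g(3)]]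
    by (simp add: max_dom_def)
qed

lemma max_dom_cnj:
  assumes "f \<in> max_dom"
  shows "(\<lambda>x. cnj (f x)) \<in> max_dom"
proof -
  note f = max_domD [OF assms(1)]
  have "AE x in lebesgue_on I. cnj (sl_ell f x) = sl_ell (\<lambda>x. cnj (f x)) x"
    using regular_cnj(3) [OF f(1)] by eventually_elim simp
  then show ?thesis
    using regular_cnj(1) [OF f(1)] l2_cnj [OF f(2)] l2_on_cong_AE [OF l2_cnj [OF f(3)]]
    by (simp add: max_dom_def)
qed

lemma solution_max_dom:
  assumes y: "solution z y" "l2_on I y"
  shows "y \<in> max_dom"
proof -
  have "l2_on I (\<lambda>x. z * y x)" using y(2) unfolding l2_on_iff by (rule sq_int_cmult)
  moreover have "AE x in lebesgue_on I. z * y x = sl_ell y x"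
    using y(1) unfolding solution_def ae_eq_def by (auto elim: eventually_mono)
  ultimately have "l2_on I (sl_ell y)" by (rule l2_on_cong_AE)
  then show ?thesis using y by (simp add: max_dom_def solution_def)
qed

section \<open>Boundary limits of Wronskians and Green's formula\<close>

definition Wa :: "(real \<Rightarrow> complex) \<Rightarrow> (real \<Rightarrow> complex) \<Rightarrow> complex" where
  "Wa f g = Lim end_a (wronskian f g)"
definition Wb :: "(real \<Rightarrow> complex) \<Rightarrow> (real \<Rightarrow> complex) \<Rightarrow> complex" where
  "Wb f g = Lim end_b (wronskian f g)"

lemma bracket_a_eq: "regular_fun g \<Longrightarrow> bracket_a f g = Wa f (\<lambda>x. cnj (g x))"
  by (simp add: bracket_a_def Wa_def end_a_def bracket_wronskian)
lemma bracket_b_eq: "regular_fun g \<Longrightarrow> bracket_b f g = Wb f (\<lambda>x. cnj (g x))"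
  by (simp add: bracket_b_def Wb_def end_b_def bracket_wronskian)

text \<open>The limits exist because the mass of \<open>g\<close> on the tails tends to 0. Their
  difference is compared with a segment whose complement lies in two small tails. The uniform bound
  later keeps the coefficients in \<open>variation_of_constants\<close> bounded.\<close>

lemma integrable_primitive_limits:
  assumes F: "primitive_on I F g" and g: "g absolutely_integrable_on I"
  obtains A B where "(F \<longlongrightarrow> A) end_a" "(F \<longlongrightarrow> B) end_b" "B - A = integral\<^sup>L (lebesgue_on I) g"
    "\<And>x. x \<in> I \<Longrightarrow> norm (F x - A) \<le> integral I (\<lambda>x. norm (g x))"
proof -
  obtain l u where lu: "\<And>n. l n \<in> I" "\<And>n. u n \<in> I" "\<And>n. l n < u n"
    "interval_tail I (\<lambda>n. {x\<in>I. x < l n}) end_a" "interval_tail I (\<lambda>n. {x\<in>I. u n < x}) end_b"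
    by (rule end_tails, rule that)
  let ?Ta = "\<lambda>n. {x\<in>I. x < l n}" and ?Tb = "\<lambda>n. {x\<in>I. u n < x}"
  interpret A: interval_tail I ?Ta end_a by (rule lu)
  interpret B: interval_tail I ?Tb end_b by (rule lu)
  have gs: "g absolutely_integrable_on T" if "T \<subseteq> I" "T \<in> sets lebesgue" for T
    using set_integrable_subset [OF g that(2,1)] .
  have ng: "(\<lambda>x. norm (g x)) integrable_on T" if "T \<subseteq> I" "T \<in> sets lebesgue" for T
    using gs [OF that] by (simp add: absolutely_integrable_on_def)
  obtain A where A: "(F \<longlongrightarrow> A) end_a" "\<And>n x. 0 \<le> n \<Longrightarrow> x \<in> ?Ta n \<Longrightarrow> norm (F x - A) \<le> integral (?Ta n) (\<lambda>x. norm (g x))"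
    using A.primitive_tail_limit [OF F gs [OF A.T_sub A.T_leb], of 0] by blast
  obtain B where B: "(F \<longlongrightarrow> B) end_b" "\<And>n x. 0 \<le> n \<Longrightarrow> x \<in> ?Tb n \<Longrightarrow> norm (F x - B) \<le> integral (?Tb n) (\<lambda>x. norm (g x))"
    using B.primitive_tail_limit [OF F gs [OF B.T_sub B.T_leb], of 0] by blast
  have gI: "g integrable_on I" using g by (simp add: absolutely_integrable_on_def)
  have est: "norm (B - A - integral I g) \<le> \<epsilon>" if \<epsilon>: "0 < \<epsilon>" for \<epsilon>
  proof -
    \<comment> \<open>With mass below \<open>\<epsilon>/4\<close> on each tail, the complement of
      the segment costs at most \<open>\<epsilon>/2\<close> and each of the two limits
      \<open>\<epsilon>/4\<close>.\<close>
    obtain n where n: "integral (?Ta n) (\<lambda>x. norm (g x)) < \<epsilon>/4"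
      using A.small_tail [OF gs [OF A.T_sub A.T_leb], of "\<epsilon>/4"] \<epsilon> by auto
    obtain m where m: "integral (?Tb m) (\<lambda>x. norm (g x)) < \<epsilon>/4"
      using B.small_tail [OF gs [OF B.T_sub B.T_leb], of "\<epsilon>/4"] \<epsilon> by auto
    obtain k where k: "n \<le> k" "m \<le> k" by (meson nat_le_linear)
    obtain x where x: "x \<in> ?Ta k" using A.T_ne [of k] by blast
    obtain y where y: "y \<in> ?Tb k" using B.T_ne [of k] by blast
    have xy: "x \<in> I" "y \<in> I" "x < y" "x \<in> ?Ta n" "y \<in> ?Tb m"
      using x y lu(3) [of k] A.T_dec [OF k(1)] B.T_dec [OF k(2)] by auto
    have J: "{x..y} \<subseteq> I" by (rule I_segment [OF xy(1,2)])
    have gJ: "g integrable_on {x..y}" using primitive_onD(2) [OF F _ J] xy by simp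
    have L: "I - {x..y} \<in> sets lebesgue" using I_lebesgue by auto
    have gL: "g integrable_on (I - {x..y})" using gs [OF _ L] by (auto simp: absolutely_integrable_on_def)
    have eq: "integral I g = integral {x..y} g + integral (I - {x..y}) g"
      using Henstock_Kurzweil_Integration.integral_Un [OF gJ gL] J by (simp add: Un_absorb1)
    have "norm (integral (I - {x..y}) g) \<le> integral (I - {x..y}) (\<lambda>x. norm (g x))"
      by (rule integral_norm_bound_integral [OF gL ng [OF _ L]]) auto
    also have "\<dots> \<le> integral (?Ta n \<union> ?Tb m) (\<lambda>x. norm (g x))"
      by (rule integral_subset_le [OF _ ng [OF _ L] ng]) (use xy A.T_leb B.T_leb in auto)
    also have "\<dots> \<le> integral (?Ta n) (\<lambda>x. norm (g x)) + integral (?Tb m) (\<lambda>x. norm (g x))"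
    proof -
      let ?D = "?Tb m - ?Ta n"
      have D: "?D \<in> sets lebesgue" "?D \<subseteq> I" using A.T_leb B.T_leb by auto
      have "integral (?Ta n \<union> ?D) (\<lambda>x. norm (g x)) = integral (?Ta n) (\<lambda>x. norm (g x)) + integral ?D (\<lambda>x. norm (g x))"
        by (rule Henstock_Kurzweil_Integration.integral_Un [OF ng [OF A.T_sub A.T_leb] ng [OF D(2,1)]]) auto
      moreover have "?Ta n \<union> ?D = ?Ta n \<union> ?Tb m" by blast
      moreover have "integral ?D (\<lambda>x. norm (g x)) \<le> integral (?Tb m) (\<lambda>x. norm (g x))"
        by (rule integral_subset_le [OF _ ng [OF D(2,1)] ng [OF B.T_sub B.T_leb]]) auto
      ultimately show ?thesis by simp
    qed
    finally have "norm (integral (I - {x..y}) g) \<le> \<epsilon>/2" using n m by simp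
    moreover have "norm (F x - A) \<le> \<epsilon>/4" using A(2) [OF _ xy(4)] n by simp
    moreover have "norm (B - F y) \<le> \<epsilon>/4" using B(2) [OF _ xy(5)] m by (simp add: norm_minus_commute)
    moreover have EQ: "B - A - integral I g = (B - F y) + (F x - A) - integral (I - {x..y}) g"
      using primitive_onD(3) [OF F less_imp_le [OF xy(3)] J, symmetric] by (simp add: eq)
    moreover have "norm ((B - F y) + (F x - A) - integral (I - {x..y}) g)
        \<le> norm (B - F y) + norm (F x - A) + norm (integral (I - {x..y}) g)"
      by (meson add_mono norm_triangle_ineq norm_triangle_ineq4 order_refl order_trans)
    ultimately show ?thesis unfolding EQ by linarith
  qed
  then have "norm (B - A - integral I g) \<le> 0" by (rule field_le_epsilon [of _ 0, simplified])
  then have BA: "B - A = integral\<^sup>L (lebesgue_on I) g"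
    using lebesgue_integral_eq_integral [OF _ I_lebesgue, of g] g by (simp add: integrable_lebesgue_on_I)
  have "norm (F x - A) \<le> integral I (\<lambda>x. norm (g x))" if x: "x \<in> I" for x
  proof (rule tendsto_upperbound [OF _ _ end_a_nontriv])
    show "((\<lambda>y. norm (F x - F y)) \<longlongrightarrow> norm (F x - A)) end_a" by (intro tendsto_intros A)
    show "\<forall>\<^sub>F y in end_a. norm (F x - F y) \<le> integral I (\<lambda>x. norm (g x))"
      using eventually_end_a [OF x]
    proof eventually_elim
      case (elim y)
      then have J: "{y..x} \<subseteq> I" "y \<le> x" using I_segment x by auto
      have "norm (F x - F y) = norm (integral {y..x} g)" using primitive_onD(3) [OF F J(2,1)] by simp
      also have "\<dots> \<le> integral {y..x} (\<lambda>x. norm (g x))"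
        by (rule integral_norm_bound_integral [OF primitive_onD(2) [OF F J(2,1)] ng [OF J(1)]]) auto
      also have "\<dots> \<le> integral I (\<lambda>x. norm (g x))"
        by (rule integral_subset_le [OF J(1) ng [OF J(1)] ng]) (auto simp: I_lebesgue)
      finally show ?case .
    qed
  qed
  with A(1) B(1) BA that show thesis by blast
qed

text \<open>The integrand in Lagrange's identity is built from products of square integrable
  functions, hence integrable over all of \<open>I\<close>.\<close>

lemma wronskian_limits:
  assumes f: "f \<in> max_dom" and g: "g \<in> max_dom"
  shows "(wronskian f g \<longlongrightarrow> Wa f g) end_a" "(wronskian f g \<longlongrightarrow> Wb f g) end_b"
    "Wb f g - Wa f g = (\<integral>x. (sl_ell f x * g x - f x * sl_ell g x) * of_real (w x) \<partial>lebesgue_on I)"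
proof -
  note f' = max_domD [OF f] and g' = max_domD [OF g]
  have "(\<lambda>x. (sl_ell f x * g x - f x * sl_ell g x) * of_real (w x)) absolutely_integrable_on I"
    using set_integral_diff(1) [OF l2_mult_integrable [OF f'(3) g'(2)] l2_mult_integrable [OF f'(2) g'(3)]]
    by (simp add: left_diff_distrib)
  then obtain A B where AB: "(wronskian f g \<longlongrightarrow> A) end_a" "(wronskian f g \<longlongrightarrow> B) end_b"
    "B - A = (\<integral>x. (sl_ell f x * g x - f x * sl_ell g x) * of_real (w x) \<partial>lebesgue_on I)"
    using integrable_primitive_limits [OF wronskian_primitive [OF f'(1) g'(1)]] by blast
  moreover have "Wa f g = A" "Wb f g = B"
    unfolding Wa_def Wb_def using tendsto_Lim [OF end_a_nontriv AB(1)] tendsto_Lim [OF end_b_nontriv AB(2)] by auto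
  ultimately show "(wronskian f g \<longlongrightarrow> Wa f g) end_a" "(wronskian f g \<longlongrightarrow> Wb f g) end_b"
    "Wb f g - Wa f g = (\<integral>x. (sl_ell f x * g x - f x * sl_ell g x) * of_real (w x) \<partial>lebesgue_on I)"
    by simp_all
qed

lemma Wa_eqI: "(wronskian f g \<longlongrightarrow> A) end_a \<Longrightarrow> Wa f g = A"
  unfolding Wa_def by (rule tendsto_Lim [OF end_a_nontriv])
lemma Wb_eqI: "(wronskian f g \<longlongrightarrow> A) end_b \<Longrightarrow> Wb f g = A"
  unfolding Wb_def by (rule tendsto_Lim [OF end_b_nontriv])

lemma wronskian_lincomb:
  assumes "regular_fun f" "regular_fun g"
  shows "wronskian (\<lambda>x. c * f x + d * g x) h x = c * wronskian f h x + d * wronskian g h x"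
  by (simp add: wronskian_def regular_lincomb [OF assms] algebra_simps)

lemma W_lincomb:
  assumes f: "f \<in> max_dom" and g: "g \<in> max_dom" and h: "h \<in> max_dom"
  shows "Wa (\<lambda>x. c * f x + d * g x) h = c * Wa f h + d * Wa g h"
    "Wb (\<lambda>x. c * f x + d * g x) h = c * Wb f h + d * Wb g h"
proof -
  have eq: "wronskian (\<lambda>x. c * f x + d * g x) h = (\<lambda>x. c * wronskian f h x + d * wronskian g h x)"
    using wronskian_lincomb [OF max_domD(1) [OF f] max_domD(1) [OF g]] by auto
  show "Wa (\<lambda>x. c * f x + d * g x) h = c * Wa f h + d * Wa g h"
    by (rule Wa_eqI) (unfold eq, intro tendsto_intros wronskian_limits f g h)
  show "Wb (\<lambda>x. c * f x + d * g x) h = c * Wb f h + d * Wb g h"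
    by (rule Wb_eqI) (unfold eq, intro tendsto_intros wronskian_limits f g h)
qed

lemma W_anti:
  assumes f: "f \<in> max_dom" and g: "g \<in> max_dom"
  shows "Wa g f = - Wa f g" "Wb g f = - Wb f g"
proof -
  have eq: "wronskian g f = (\<lambda>x. - wronskian f g x)" by (auto simp: wronskian_def)
  show "Wa g f = - Wa f g" by (rule Wa_eqI) (unfold eq, intro tendsto_intros wronskian_limits f g)
  show "Wb g f = - Wb f g" by (rule Wb_eqI) (unfold eq, intro tendsto_intros wronskian_limits f g)
qed

lemma W_cnj:
  assumes f: "f \<in> max_dom" and g: "g \<in> max_dom"
  shows "Wa (\<lambda>x. cnj (f x)) (\<lambda>x. cnj (g x)) = cnj (Wa f g)" "Wb (\<lambda>x. cnj (f x)) (\<lambda>x. cnj (g x)) = cnj (Wb f g)"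
proof -
  have eq: "wronskian (\<lambda>x. cnj (f x)) (\<lambda>x. cnj (g x)) = (\<lambda>x. cnj (wronskian f g x))"
    using regular_cnj(2) max_domD(1) f g by (auto simp: wronskian_def)
  show "Wa (\<lambda>x. cnj (f x)) (\<lambda>x. cnj (g x)) = cnj (Wa f g)"
    by (rule Wa_eqI) (unfold eq, intro tendsto_intros wronskian_limits f g)
  show "Wb (\<lambda>x. cnj (f x)) (\<lambda>x. cnj (g x)) = cnj (Wb f g)"
    by (rule Wb_eqI) (unfold eq, intro tendsto_intros wronskian_limits f g)
qed

lemma W_cong:
  assumes f: "f \<in> max_dom" "g \<in> max_dom" and eq: "\<And>x. x \<in> I \<Longrightarrow> f x = f' x" "\<And>x. x \<in> I \<Longrightarrow> g x = g' x"
  shows "Wa f' g' = Wa f g" "Wb f' g' = Wb f g"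
proof -
  have "wronskian f' g' x = wronskian f g x" if "x \<in> I" for x
    using regular_cong(2) [OF max_domD(1) [OF f(1)] eq(1)] regular_cong(2) [OF max_domD(1) [OF f(2)] eq(2)] eq that by (simp add: wronskian_def)
  moreover obtain x0 where "x0 \<in> I" by (rule base_point)
  ultimately have ev: "eventually (\<lambda>x. wronskian f' g' x = wronskian f g x) end_a"
     "eventually (\<lambda>x. wronskian f' g' x = wronskian f g x) end_b"
    using eventually_end_a [of x0] eventually_end_b [of x0] by (auto elim: eventually_mono)
  show "Wa f' g' = Wa f g"
    by (rule Wa_eqI [OF tendsto_cong [OF ev(1), THEN iffD2, OF wronskian_limits(1) [OF f]]])
  show "Wb f' g' = Wb f g"
    by (rule Wb_eqI [OF tendsto_cong [OF ev(2), THEN iffD2, OF wronskian_limits(2) [OF f]]])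
qed

text \<open>The Pluecker relation for 2 by 2 determinants, taken to the limit. When the Wronskian of
  \<open>u\<close> and \<open>v\<close> is 1, it expresses the Wronskian of \<open>f\<close> and
  \<open>g\<close> through their values against \<open>u\<close> and \<open>v\<close>.\<close>

lemma W_pluecker:
  assumes "f \<in> max_dom" "g \<in> max_dom" "u \<in> max_dom" "v \<in> max_dom"
  shows "Wa f u * Wa g v - Wa f v * Wa g u = Wa f g * Wa u v" "Wb f u * Wb g v - Wb f v * Wb g u = Wb f g * Wb u v"
proof -
  have eq: "wronskian f u x * wronskian g v x - wronskian f v x * wronskian g u x = wronskian f g x * wronskian u v x" for x
    by (simp add: wronskian_def algebra_simps)
  have "((\<lambda>x. wronskian f u x * wronskian g v x - wronskian f v x * wronskian g u x)
      \<longlongrightarrow> Wa f u * Wa g v - Wa f v * Wa g u) end_a"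
    by (intro tendsto_intros wronskian_limits assms)
  moreover have "((\<lambda>x. wronskian f g x * wronskian u v x) \<longlongrightarrow> Wa f g * Wa u v) end_a"
    by (intro tendsto_intros wronskian_limits assms)
  ultimately show "Wa f u * Wa g v - Wa f v * Wa g u = Wa f g * Wa u v"
    unfolding eq by (rule tendsto_unique [OF end_a_nontriv])
  have "((\<lambda>x. wronskian f u x * wronskian g v x - wronskian f v x * wronskian g u x)
      \<longlongrightarrow> Wb f u * Wb g v - Wb f v * Wb g u) end_b"
    by (intro tendsto_intros wronskian_limits assms)
  moreover have "((\<lambda>x. wronskian f g x * wronskian u v x) \<longlongrightarrow> Wb f g * Wb u v) end_b"
    by (intro tendsto_intros wronskian_limits assms)
  ultimately show "Wb f u * Wb g v - Wb f v * Wb g u = Wb f g * Wb u v"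
    unfolding eq by (rule tendsto_unique [OF end_b_nontriv])
qed

text \<open>Lagrange's identity integrated over \<open>I\<close> for \<open>f\<close> and the
  conjugate of \<open>g\<close>; the coefficients are real, so conjugation commutes with
  \<open>sl_ell\<close> a.e.\<close>

lemma green:
  assumes f: "f \<in> max_dom" and g: "g \<in> max_dom"
  shows "wip (sl_ell f) g - wip f (sl_ell g) = Wb f (\<lambda>x. cnj (g x)) - Wa f (\<lambda>x. cnj (g x))"
proof -
  note f' = max_domD [OF f] and g' = max_domD [OF g]
  have "wip (sl_ell f) g - wip f (sl_ell g)
     = (\<integral>x. sl_ell f x * cnj (g x) * of_real (w x) - f x * cnj (sl_ell g x) * of_real (w x) \<partial>lebesgue_on I)"
    unfolding wip_def using l2_mult_integrable [OF f'(3) l2_cnj [OF g'(2)]] l2_mult_integrable [OF f'(2) l2_cnj [OF g'(3)]]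
    by (intro Bochner_Integration.integral_diff [symmetric]) (auto simp: integrable_lebesgue_on_I)
  also have "\<dots> = (\<integral>x. (sl_ell f x * cnj (g x) - f x * sl_ell (\<lambda>x. cnj (g x)) x) * of_real (w x) \<partial>lebesgue_on I)"
  proof (rule integral_cong_AE)
    have [measurable]: "f \<in> borel_measurable (lebesgue_on I)" "g \<in> borel_measurable (lebesgue_on I)"
      "sl_ell f \<in> borel_measurable (lebesgue_on I)" "sl_ell g \<in> borel_measurable (lebesgue_on I)"
      "sl_ell (\<lambda>x. cnj (g x)) \<in> borel_measurable (lebesgue_on I)" "w \<in> borel_measurable (lebesgue_on I)"
      using f' g' max_domD(3) [OF max_dom_cnj [OF g]] w_measurable l2_measurable by auto
    show "(\<lambda>x. sl_ell f x * cnj (g x) * of_real (w x) - f x * cnj (sl_ell g x) * of_real (w x)) \<in> borel_measurable (lebesgue_on I)"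
      by measurable
    show "(\<lambda>x. (sl_ell f x * cnj (g x) - f x * sl_ell (\<lambda>x. cnj (g x)) x) * of_real (w x)) \<in> borel_measurable (lebesgue_on I)"
      by measurable
    show "AE x in lebesgue_on I. sl_ell f x * cnj (g x) * of_real (w x) - f x * cnj (sl_ell g x) * of_real (w x)
        = (sl_ell f x * cnj (g x) - f x * sl_ell (\<lambda>x. cnj (g x)) x) * of_real (w x)"
      using regular_cnj(3) [OF g'(1)] by eventually_elim (simp add: algebra_simps)
  qed
  also have "\<dots> = Wb f (\<lambda>x. cnj (g x)) - Wa f (\<lambda>x. cnj (g x))"
    by (rule wronskian_limits(3) [OF f max_dom_cnj [OF g], symmetric])
  finally show ?thesis .
qed

end

locale limit_circle = sturm_liouville +
  assumes lc_a: limit_circle_a and lc_b: limit_circle_b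
begin

text \<open>The limit-circle property speaks of some spectral parameter at each endpoint;
  \<open>weyl_bound\<close> carries it to \<open>z\<close> on a tail. The two tails and a compact
  segment between them make up \<open>I\<close>.\<close>

lemma solution_l2:
  assumes y: "solution z y"
  shows "l2_on I y"
proof -
  obtain l u where lu: "\<And>n. l n \<in> I" "\<And>n. u n \<in> I" "\<And>n. l n < u n"
    "interval_tail I (\<lambda>n. {x\<in>I. x < l n}) end_a" "interval_tail I (\<lambda>n. {x\<in>I. u n < x}) end_b"
    by (rule end_tails, rule that)
  let ?Ta = "\<lambda>n. {x\<in>I. x < l n}" and ?Tb = "\<lambda>n. {x\<in>I. u n < x}"
  interpret A: interval_tail I ?Ta end_a by (rule lu)
  interpret B: interval_tail I ?Tb end_b by (rule lu)
  have "\<exists>n. l2_on (?Ta n) y"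
  proof -
    obtain \<zeta> where \<zeta>: "\<And>y. solution \<zeta> y \<Longrightarrow> \<exists>c\<in>I. l2_on (einterval a (ereal c)) y"
      using lc_a unfolding limit_circle_a_def by blast
    obtain \<phi> \<psi> where s: "solution \<zeta> \<phi>" "solution \<zeta> \<psi>" "\<And>x. x \<in> I \<Longrightarrow> wronskian \<phi> \<psi> x = 1"
      using solution_pair [of \<zeta>] by metis
    have tail: "\<exists>N. \<forall>m\<ge>N. l2_on (?Ta m) f" if f: "solution \<zeta> f" for f
    proof -
      obtain c where c: "c \<in> I" "l2_on (einterval a (ereal c)) f" using \<zeta> [OF f] by blast
      obtain N where "c \<notin> ?Ta N" using A.T_empty by blast
      then have N: "l N \<le> c" using c(1) by simp
      have "l2_on (?Ta m) f" if "N \<le> m" for m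
      proof (rule l2_on_subset [OF c(2) _ A.T_leb])
        have "?Ta m \<subseteq> ?Ta N" by (rule A.T_dec [OF that])
        then show "?Ta m \<subseteq> einterval a (ereal c)" using N by (auto simp: einterval_def)
      qed
      then show ?thesis by blast
    qed
    obtain N1 N2 where "\<forall>m\<ge>N1. l2_on (?Ta m) \<phi>" "\<forall>m\<ge>N2. l2_on (?Ta m) \<psi>"
      using tail [OF s(1)] tail [OF s(2)] by blast
    then have m: "l2_on (?Ta (max N1 N2)) \<phi>" "l2_on (?Ta (max N1 N2)) \<psi>" by auto
    show ?thesis by (rule weyl_bound [OF lu(4) s(1) m(1) s(2) m(2) s(3) y]) auto
  qed
  moreover have "\<exists>n. l2_on (?Tb n) y"
  proof -
    obtain \<zeta> where \<zeta>: "\<And>y. solution \<zeta> y \<Longrightarrow> \<exists>c\<in>I. l2_on (einterval (ereal c) b) y"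
      using lc_b unfolding limit_circle_b_def by blast
    obtain \<phi> \<psi> where s: "solution \<zeta> \<phi>" "solution \<zeta> \<psi>" "\<And>x. x \<in> I \<Longrightarrow> wronskian \<phi> \<psi> x = 1"
      using solution_pair [of \<zeta>] by metis
    have tail: "\<exists>N. \<forall>m\<ge>N. l2_on (?Tb m) f" if f: "solution \<zeta> f" for f
    proof -
      obtain c where c: "c \<in> I" "l2_on (einterval (ereal c) b) f" using \<zeta> [OF f] by blast
      obtain N where "c \<notin> ?Tb N" using B.T_empty by blast
      then have N: "c \<le> u N" using c(1) by simp
      have "l2_on (?Tb m) f" if "N \<le> m" for m
      proof (rule l2_on_subset [OF c(2) _ B.T_leb])
        have "?Tb m \<subseteq> ?Tb N" by (rule B.T_dec [OF that])
        then show "?Tb m \<subseteq> einterval (ereal c) b" using N by (auto simp: einterval_def)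
      qed
      then show ?thesis by blast
    qed
    obtain N1 N2 where "\<forall>m\<ge>N1. l2_on (?Tb m) \<phi>" "\<forall>m\<ge>N2. l2_on (?Tb m) \<psi>"
      using tail [OF s(1)] tail [OF s(2)] by blast
    then have m: "l2_on (?Tb (max N1 N2)) \<phi>" "l2_on (?Tb (max N1 N2)) \<psi>" by auto
    show ?thesis by (rule weyl_bound [OF lu(5) s(1) m(1) s(2) m(2) s(3) y]) auto
  qed
  ultimately obtain n m where n: "l2_on (?Ta n) y" and m: "l2_on (?Tb m) y" by blast
  have reg: "regular_fun y" by (rule solution_regular [OF y])
  have J: "{l n..u m} \<subseteq> I" by (rule I_segment [OF lu(1) lu(2)])
  have "l2_on (?Ta n \<union> {l n..u m}) y"
    by (rule l2_on_Un [OF reg n l2_on_compact [OF reg J] A.T_leb]) (use J in auto)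
  then have "l2_on ((?Ta n \<union> {l n..u m}) \<union> ?Tb m) y"
    using A.T_leb [of n] J by (intro l2_on_Un [OF reg _ m _ B.T_leb]) auto
  moreover have "(?Ta n \<union> {l n..u m}) \<union> ?Tb m = I"
    using J by (auto simp: not_less)
  ultimately show ?thesis by simp
qed

end


section \<open>The maximal domain and self-adjointness\<close>

lemma sq_int_project:
  assumes G: "sq_int M G" and e: "sq_int M e"
  shows "\<exists>c. ip M (\<lambda>x. G x - c * e x) e = 0"
proof (cases "nsq M e = 0")
  \<comment> \<open>Here \<open>e\<close> vanishes a.e., so \<open>G\<close> is already orthogonal
    to it and \<open>c = 0\<close> serves.\<close>
  case True
  then have "AE x in M. e x = 0" by (rule nsq_eq_0 [OF e])
  then have "AE x in M. G x * cnj (e x) = 0" by eventually_elim simp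
  moreover have "(\<lambda>x. G x * cnj (e x)) \<in> borel_measurable M"
    using ip_integrable [OF G e] by auto
  ultimately have "ip M G e = 0" unfolding ip_def using integral_cong_AE [of "\<lambda>x. G x * cnj (e x)" M "\<lambda>_. 0"] by simp
  then show ?thesis by (intro exI [of _ 0]) simp
next
  case False
  define c where "c = ip M G e / ip M e e"
  have "c * ip M e e = ip M G e" using False by (simp add: c_def ip_self)
  then have "ip M (\<lambda>x. G x - c * e x) e = 0"
    using ip_diff_left [OF G sq_int_cmult [OF e] e] by (simp add: ip_cmult_left)
  then show ?thesis by blast
qed

text \<open>Gram-Schmidt: \<open>e2\<close> is first made orthogonal to \<open>e1\<close>, so that
  the second projection does not disturb the first.\<close>

lemma sq_int_project2:
  assumes G: "sq_int M G" and e: "sq_int M e1" "sq_int M e2"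
  shows "\<exists>c1 c2. ip M (\<lambda>x. G x - c1 * e1 x - c2 * e2 x) e1 = 0 \<and> ip M (\<lambda>x. G x - c1 * e1 x - c2 * e2 x) e2 = 0"
proof -
  obtain d where d: "ip M (\<lambda>x. e2 x - d * e1 x) e1 = 0" using sq_int_project [OF e(2,1)] by blast
  define e2' where "e2' x = e2 x - d * e1 x" for x
  have e2': "sq_int M e2'" unfolding e2'_def by (intro sq_int_diff sq_int_cmult e)
  obtain c1 where c1: "ip M (\<lambda>x. G x - c1 * e1 x) e1 = 0" using sq_int_project [OF G e(1)] by blast
  define G' where "G' x = G x - c1 * e1 x" for x
  have G': "sq_int M G'" unfolding G'_def by (intro sq_int_diff sq_int_cmult G e)
  obtain c2 where c2: "ip M (\<lambda>x. G' x - c2 * e2' x) e2' = 0" using sq_int_project [OF G' e2'] by blast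
  define G2 where "G2 x = G' x - c2 * e2' x" for x
  have G2: "sq_int M G2" unfolding G2_def by (intro sq_int_diff sq_int_cmult G' e2')
  have 1: "ip M G2 e1 = 0"
    unfolding G2_def using ip_diff_left [OF G' sq_int_cmult [OF e2'] e(1)] c1 d
    by (simp add: ip_cmult_left G'_def [abs_def] e2'_def [abs_def])
  have "ip M G2 (\<lambda>x. e2' x + d * e1 x) = 0"
    using ip_add_right [OF e2' sq_int_cmult [OF e(1)] G2] 1 c2
    by (simp add: ip_cmult_right G2_def [abs_def])
  moreover have "(\<lambda>x. e2' x + d * e1 x) = e2" by (auto simp: e2'_def)
  ultimately have 2: "ip M G2 e2 = 0" by simp
  have "G2 = (\<lambda>x. G x - (c1 - c2 * d) * e1 x - c2 * e2 x)"
    by (auto simp: G2_def G'_def e2'_def algebra_simps)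
  with 1 2 show ?thesis by blast
qed

text \<open>After orthogonalisation the two conditions decouple, and independence keeps both
  denominators nonzero. In \<open>boundary_values_surjective\<close> the function \<open>r\<close>
  becomes the right-hand side that produces the wanted values at \<open>b\<close>.\<close>

lemma sq_int_dual_basis:
  assumes e: "sq_int M e1" "sq_int M e2"
    and indep: "\<And>c d. (AE x in M. c * e1 x + d * e2 x = 0) \<Longrightarrow> c = 0 \<and> d = 0"
  shows "\<exists>r. sq_int M r \<and> ip M r e1 = s \<and> ip M r e2 = t"
proof -
  obtain d where d: "ip M (\<lambda>x. e2 x - d * e1 x) e1 = 0" using sq_int_project [OF e(2,1)] by blast
  define e2' where "e2' x = e2 x - d * e1 x" for x
  have e2': "sq_int M e2'" unfolding e2'_def by (intro sq_int_diff sq_int_cmult e)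
  have "nsq M e1 \<noteq> 0"
  proof
    assume "nsq M e1 = 0"
    then have "AE x in M. 1 * e1 x + 0 * e2 x = 0" using nsq_eq_0 [OF e(1)] by simp
    from indep [OF this] show False by simp
  qed
  then have N1: "ip M e1 e1 \<noteq> 0" by (simp add: ip_self)
  have "nsq M e2' \<noteq> 0"
  proof
    assume "nsq M e2' = 0"
    then have "AE x in M. e2' x = 0" by (rule nsq_eq_0 [OF e2'])
    then have "AE x in M. (- d) * e1 x + 1 * e2 x = 0" by eventually_elim (simp add: e2'_def)
    from indep [OF this] show False by simp
  qed
  then have N2: "ip M e2' e2' \<noteq> 0" by (simp add: ip_self)
  have o1: "ip M e2' e1 = 0" using d by (simp add: e2'_def [abs_def])
  have o2: "ip M e1 e2' = 0" using o1 ip_cnj [of M e1 e2'] by simp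
  define x where "x = s / ip M e1 e1"
  \<comment> \<open>The correction \<open>cnj d * s\<close> appears because
    \<open>e2 = e2' + d * e1\<close>, and the scalar leaves the second slot conjugated.\<close>
  define y where "y = (t - cnj d * s) / ip M e2' e2'"
  define r where "r z = x * e1 z + y * e2' z" for z
  have r: "sq_int M r" unfolding r_def by (intro sq_int_add sq_int_cmult e e2')
  have r_ip: "ip M r h = x * ip M e1 h + y * ip M e2' h" if "sq_int M h" for h
    unfolding r_def using ip_add_left [OF sq_int_cmult [OF e(1)] sq_int_cmult [OF e2'] that] by (simp add: ip_cmult_left)
  have 1: "ip M r e1 = s" using r_ip [OF e(1)] o1 N1 by (simp add: x_def)
  have "ip M r (\<lambda>z. e2' z + d * e1 z) = ip M r e2' + cnj d * ip M r e1"
    using ip_add_right [OF e2' sq_int_cmult [OF e(1)] r] by (simp add: ip_cmult_right)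
  moreover have "(\<lambda>z. e2' z + d * e1 z) = e2" by (auto simp: e2'_def)
  moreover have "ip M r e2' = t - cnj d * s" using r_ip [OF e2'] o2 N2 by (simp add: y_def)
  ultimately have "ip M r e2 = t" using 1 by simp
  with 1 r show ?thesis by blast
qed

context limit_circle
begin

section \<open>Prescribed boundary values\<close>

lemma solution_in_max_dom: "solution z y \<Longrightarrow> y \<in> max_dom"
  by (rule solution_max_dom [OF _ solution_l2])

lemma W_solution_pair:
  assumes "\<And>x. x \<in> I \<Longrightarrow> wronskian \<phi> \<psi> x = k"
  shows "Wa \<phi> \<psi> = k" "Wb \<phi> \<psi> = k"
proof -
  obtain x0 where "x0 \<in> I" by (rule base_point)
  then have "\<forall>\<^sub>F x in end_a. wronskian \<phi> \<psi> x = k" "\<forall>\<^sub>F x in end_b. wronskian \<phi> \<psi> x = k"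
    using eventually_end_a [of x0] eventually_end_b [of x0] assms by (auto elim: eventually_mono)
  then show "Wa \<phi> \<psi> = k" "Wb \<phi> \<psi> = k"
    by (auto intro!: Wa_eqI Wb_eqI tendsto_eventually)
qed

text \<open>The ansatz \<open>C1 \<phi> + C2 \<psi>\<close> with \<open>C1' = r \<psi> w\<close> and
  \<open>C2' = - r \<phi> w\<close>. These integrands are integrable over all of \<open>I\<close>,
  so the coefficients are bounded, which puts \<open>f\<close> in the weighted space, and have
  limits at \<open>a\<close>. The Wronskians of \<open>f\<close> with \<open>\<psi>\<close> and
  \<open>\<phi>\<close> are \<open>C1\<close> and \<open>- C2\<close>, so the integration constants
  fix the values at \<open>a\<close>.\<close>

lemma variation_of_constants:
  assumes \<phi>: "solution 0 \<phi>" and \<psi>: "solution 0 \<psi>" and W: "\<And>x. x \<in> I \<Longrightarrow> wronskian \<phi> \<psi> x = 1"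
    and r: "l2_on I r"
  shows "\<exists>f\<in>dmax. ae_eq (sl_ell f) r \<and> Wa f \<phi> = \<alpha> \<and> Wa f \<psi> = \<beta>"
proof -
  note reg = solution_regular [OF \<phi>] solution_regular [OF \<psi>]
  note l2 = solution_l2 [OF \<phi>] solution_l2 [OF \<psi>]
  obtain x0 where x0: "x0 \<in> I" by (rule base_point)
  have const: "\<exists>C B. primitive_on I C g \<and> (C \<longlongrightarrow> \<gamma>) end_a \<and> (\<forall>x\<in>I. norm (C x) \<le> B)"
    if g: "g absolutely_integrable_on I" for g \<gamma>
  proof -
    have "locally_integrable_on I g"
      using g unfolding locally_integrable_on_def by (auto intro: absolutely_integrable_on_subinterval)
    then have P: "primitive_on I (oriented_integral x0 g) g"
      by (rule primitive_on_oriented_integral [OF I_interval x0])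
    obtain A where A: "(oriented_integral x0 g \<longlongrightarrow> A) end_a"
      "\<And>x. x \<in> I \<Longrightarrow> norm (oriented_integral x0 g x - A) \<le> integral I (\<lambda>x. norm (g x))"
      using integrable_primitive_limits [OF P g] by blast
    define C where "C x = oriented_integral x0 g x + (\<gamma> - A)" for x
    have "primitive_on I C g"
      using primitive_on_add [OF P primitive_on_const [of I "\<gamma> - A"]] by (simp add: C_def [abs_def])
    moreover have "(C \<longlongrightarrow> A + (\<gamma> - A)) end_a" unfolding C_def by (intro tendsto_intros A)
    moreover have "norm (C x) \<le> integral I (\<lambda>x. norm (g x)) + norm \<gamma>" if "x \<in> I" for x
    proof -
      have "C x = (oriented_integral x0 g x - A) + \<gamma>" by (simp add: C_def)
      then show ?thesis using A(2) [OF that] norm_triangle_ineq [of "oriented_integral x0 g x - A" \<gamma>] by simp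
    qed
    ultimately show ?thesis by auto
  qed
  obtain C1 B1 where C1: "primitive_on I C1 (\<lambda>x. r x * \<psi> x * of_real (w x))" "(C1 \<longlongrightarrow> \<beta>) end_a"
      "\<And>x. x \<in> I \<Longrightarrow> norm (C1 x) \<le> B1"
    using const [OF l2_mult_integrable [OF r l2(2)], of \<beta>] by blast
  have "(\<lambda>x. (-1) * (r x * \<phi> x * of_real (w x))) absolutely_integrable_on I"
    by (intro set_integrable_mult_right l2_mult_integrable r l2)
  then obtain C2 B2 where C2: "primitive_on I C2 (\<lambda>x. (-1) * (r x * \<phi> x * of_real (w x)))" "(C2 \<longlongrightarrow> - \<alpha>) end_a"
      "\<And>x. x \<in> I \<Longrightarrow> norm (C2 x) \<le> B2"
    using const [of _ "- \<alpha>"] by blast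
  define f where "f x = (if x \<in> I then C1 x * \<phi> x + C2 x * \<psi> x else 0)" for x
  define h where "h x = C1 x * qderiv \<phi> x + C2 x * qderiv \<psi> x" for x
  have "primitive_on I (\<lambda>x. C1 x * \<phi> x + C2 x * \<psi> x)
    (\<lambda>x. (r x * \<psi> x * of_real (w x) * \<phi> x + C1 x * (qderiv \<phi> x / of_real (p x)))
       + ((-1) * (r x * \<phi> x * of_real (w x)) * \<psi> x + C2 x * (qderiv \<psi> x / of_real (p x))))"
    by (intro primitive_on_add primitive_on_mult C1 C2 I_open regular_primitive reg)
  then have "primitive_on I (\<lambda>x. C1 x * \<phi> x + C2 x * \<psi> x) (\<lambda>x. h x / of_real (p x))"
    by (simp add: h_def add_divide_distrib algebra_simps)
  then have f_prim: "primitive_on I f (\<lambda>x. h x / of_real (p x))"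
    by (rule primitive_on_cong) (simp add: f_def)
  have h_prim: "primitive_on I h
    (\<lambda>x. (r x * \<psi> x * of_real (w x) * qderiv \<phi> x + C1 x * (- (of_real (q x) * \<phi> x + of_real (w x) * sl_ell \<phi> x)))
       + ((-1) * (r x * \<phi> x * of_real (w x)) * qderiv \<psi> x + C2 x * (- (of_real (q x) * \<psi> x + of_real (w x) * sl_ell \<psi> x))))"
    (is "primitive_on I h ?k")
    unfolding h_def by (intro primitive_on_add primitive_on_mult C1 C2 I_open regular_primitive_qderiv reg)
  note f = regular_funI [OF f_prim h_prim]
  have s: "AE x in lebesgue_on I. sl_ell \<phi> x = 0" "AE x in lebesgue_on I. sl_ell \<psi> x = 0"
    using \<phi> \<psi> by (auto simp: solution_def ae_eq_def)
  have "AE x in lebesgue_on I. x \<in> I \<longrightarrow> sl_ell f x = r x"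
    using f(3) s w_pos
  proof eventually_elim
    case (elim x)
    show ?case
    proof
      assume x: "x \<in> I"
      have "?k x + of_real (q x) * f x = - (of_real (w x) * r x * wronskian \<phi> \<psi> x)"
        using elim(2,3) x by (simp add: f_def wronskian_def algebra_simps)
      then show "sl_ell f x = r x" using elim(1,4) W [OF x] by simp
    qed
  qed
  then have ell: "AE x in lebesgue_on I. sl_ell f x = r x"
    by (rule AE_mp) (auto intro!: AE_I2)
  have "l2_on I f"
  proof (rule l2_on_bounded [OF f(1) order_refl I_lebesgue l2])
    fix x assume x: "x \<in> I"
    have "norm (f x) \<le> norm (C1 x) * norm (\<phi> x) + norm (C2 x) * norm (\<psi> x)"
      using x by (simp add: f_def) (metis norm_mult norm_triangle_ineq)
    also have "\<dots> \<le> max B1 B2 * norm (\<phi> x) + max B1 B2 * norm (\<psi> x)"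
      using C1(3) [OF x] C2(3) [OF x] by (intro add_mono mult_right_mono) auto
    finally show "norm (f x) \<le> max B1 B2 * (norm (\<phi> x) + norm (\<psi> x))" by (simp add: algebra_simps)
  qed
  moreover have "l2_on I (sl_ell f)"
    by (rule l2_on_cong_AE [OF r]) (use ell in eventually_elim, simp)
  ultimately have "f \<in> dmax" using f(1) by (simp add: dmax_def f_def)
  moreover have "Wa f \<psi> = \<beta>"
  proof (rule Wa_eqI, rule Lim_transform_eventually [OF C1(2)])
    show "\<forall>\<^sub>F x in end_a. C1 x = wronskian f \<psi> x"
      using eventually_end_a [OF x0]
    proof eventually_elim
      case (elim x)
      then have x: "x \<in> I" by simp
      have "wronskian f \<psi> x = C1 x * wronskian \<phi> \<psi> x"
        using x f(2) [OF x] by (simp add: wronskian_def f_def h_def algebra_simps)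
      then show ?case using W [OF x] by simp
    qed
  qed
  moreover have "Wa f \<phi> = \<alpha>"
  proof (rule Wa_eqI, rule Lim_transform_eventually)
    show "((\<lambda>x. - C2 x) \<longlongrightarrow> \<alpha>) end_a" using tendsto_minus [OF C2(2)] by simp
    show "\<forall>\<^sub>F x in end_a. - C2 x = wronskian f \<phi> x"
      using eventually_end_a [OF x0]
    proof eventually_elim
      case (elim x)
      then have x: "x \<in> I" by simp
      have "wronskian f \<phi> x = - C2 x * wronskian \<phi> \<psi> x"
        using x f(2) [OF x] by (simp add: wronskian_def f_def h_def algebra_simps)
      then show ?case using W [OF x] by simp
    qed
  qed
  ultimately show ?thesis using ell by (auto simp: ae_eq_def)
qed

text \<open>The conjugate of \<open>\<phi>\<close> again solves the homogeneous equation, so Green's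
  formula leaves only the pairing of \<open>r\<close> with it.\<close>

lemma W_at_b:
  assumes f: "f \<in> max_dom" "ae_eq (sl_ell f) r" and r: "l2_on I r" and \<phi>: "solution 0 \<phi>"
  shows "Wb f \<phi> = Wa f \<phi> + ip weighted r (\<lambda>x. cnj (\<phi> x))"
proof -
  let ?c = "\<lambda>x. cnj (\<phi> x)"
  have \<phi>': "\<phi> \<in> max_dom" by (rule solution_in_max_dom [OF \<phi>])
  note c = max_dom_cnj [OF \<phi>']
  have "AE x in lebesgue_on I. sl_ell \<phi> x = 0" using \<phi> by (simp add: solution_def ae_eq_def)
  with regular_cnj(3) [OF max_domD(1) [OF \<phi>']] have "AE x in lebesgue_on I. sl_ell ?c x = 0"
    by eventually_elim simp
  then have "wip f (sl_ell ?c) = wip f (\<lambda>_. 0)"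
    using max_domD f(1) c l2_measurable by (intro wip_cong) auto
  moreover have "wip (sl_ell f) ?c = wip r ?c"
    using max_domD f c l2_measurable by (intro wip_cong) (auto simp: ae_eq_def)
  moreover have "wip r ?c = ip weighted r ?c" by (intro wip_l2 r max_domD c)
  ultimately show ?thesis using green [OF f(1) c] by (simp add: wip_def)
qed

lemma solution_pair_independent:
  assumes \<phi>: "solution z \<phi>" and \<psi>: "solution z \<psi>" and W: "\<And>x. x \<in> I \<Longrightarrow> wronskian \<phi> \<psi> x = 1"
    and eq: "AE x in lebesgue_on I. c * \<phi> x + d * \<psi> x = 0"
  shows "c = 0 \<and> d = 0"
proof -
  note reg = solution_regular [OF \<phi>] solution_regular [OF \<psi>]
  have zero: "c * \<phi> x + d * \<psi> x = 0" if "x \<in> I" for x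
    by (rule continuous_AE_eq [OF I_open _ _ eq that]) (intro continuous_intros regular_continuous reg)+
  have z: "regular_fun (\<lambda>x. c * \<phi> x + d * \<psi> x)" by (rule regular_lincomb(1) [OF reg])
  have q0: "qderiv (\<lambda>_. 0) = (\<lambda>_. 0)" "regular_fun (\<lambda>_. 0)"
    using regular_lincomb(1,2) [OF reg, of 0 0] by simp_all
  have "qderiv (\<lambda>_. 0) = qderiv (\<lambda>x. c * \<phi> x + d * \<psi> x)"
    by (rule regular_cong(2) [OF z zero])
  then have q: "c * qderiv \<phi> x + d * qderiv \<psi> x = 0" for x
    unfolding q0 regular_lincomb(2) [OF reg] by metis
  obtain x where x: "x \<in> I" by (rule base_point)
  have "c * wronskian \<phi> \<psi> x = (c * \<phi> x + d * \<psi> x) * qderiv \<psi> x - (c * qderiv \<phi> x + d * qderiv \<psi> x) * \<psi> x"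
    by (simp add: wronskian_def algebra_simps)
  then have "c = 0" using zero [OF x] q [of x] W [OF x] by simp
  moreover have "d * wronskian \<phi> \<psi> x = \<phi> x * (c * qderiv \<phi> x + d * qderiv \<psi> x) - qderiv \<phi> x * (c * \<phi> x + d * \<psi> x)"
    by (simp add: wronskian_def algebra_simps)
  then have "d = 0" using zero [OF x] q [of x] W [OF x] by simp
  ultimately show ?thesis by simp
qed

text \<open>The values at \<open>a\<close> are integration constants. The values at \<open>b\<close>
  differ from them by the inner products of \<open>r\<close> with the conjugates of
  \<open>\<phi>\<close> and \<open>\<psi>\<close>; these are independent, so a suitable
  \<open>r\<close> exists.\<close>

lemma boundary_values_surjective:
  assumes \<phi>: "solution 0 \<phi>" and \<psi>: "solution 0 \<psi>" and W: "\<And>x. x \<in> I \<Longrightarrow> wronskian \<phi> \<psi> x = 1"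
  shows "\<exists>f\<in>dmax. Wa f \<phi> = \<alpha> \<and> Wa f \<psi> = \<beta> \<and> Wb f \<phi> = \<gamma> \<and> Wb f \<psi> = \<delta>"
proof -
  have sq: "sq_int weighted (\<lambda>x. cnj (\<phi> x))" "sq_int weighted (\<lambda>x. cnj (\<psi> x))"
    using solution_l2 \<phi> \<psi> by (auto simp: l2_on_iff intro: sq_int_cnj)
  have indep: "c = 0 \<and> d = 0" if "AE x in weighted. c * cnj (\<phi> x) + d * cnj (\<psi> x) = 0" for c d
  proof -
    have "AE x in lebesgue_on I. cnj (c * cnj (\<phi> x) + d * cnj (\<psi> x)) = 0"
      using that unfolding AE_weighted by eventually_elim simp
    then have E: "AE x in lebesgue_on I. cnj c * \<phi> x + cnj d * \<psi> x = 0" by simp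
    have "cnj c = 0 \<and> cnj d = 0" by (rule solution_pair_independent [OF \<phi> \<psi> _ E]) (rule W)
    then show ?thesis by simp
  qed
  obtain r where r: "sq_int weighted r" "ip weighted r (\<lambda>x. cnj (\<phi> x)) = \<gamma> - \<alpha>" "ip weighted r (\<lambda>x. cnj (\<psi> x)) = \<delta> - \<beta>"
    using sq_int_dual_basis [OF sq indep] by blast
  have r2: "l2_on I r" using r(1) by (simp add: l2_on_iff)
  obtain f where f: "f \<in> dmax" "ae_eq (sl_ell f) r" "Wa f \<phi> = \<alpha>" "Wa f \<psi> = \<beta>"
    using variation_of_constants [OF \<phi> \<psi> W r2] by blast
  have fm: "f \<in> max_dom" using f(1) by (simp add: dmax_iff)
  have "Wb f \<phi> = \<gamma>" "Wb f \<psi> = \<delta>"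
    using W_at_b [OF fm f(2) r2 \<phi>] W_at_b [OF fm f(2) r2 \<psi>] f(3,4) r(2,3) by simp_all
  with f show ?thesis by blast
qed

text \<open>By \<open>green\<close> this is \<open>wip (sl_ell f) g - wip f (sl_ell g)\<close>, the
  defect of symmetry.\<close>

definition bform :: "(real \<Rightarrow> complex) \<Rightarrow> (real \<Rightarrow> complex) \<Rightarrow> complex" where
  "bform f g = Wb f (\<lambda>x. cnj (g x)) - Wa f (\<lambda>x. cnj (g x))"

lemma bform_conj_sym:
  assumes f: "f \<in> max_dom" and g: "g \<in> max_dom"
  shows "bform f g = - cnj (bform g f)"
proof -
  note c = max_dom_cnj [OF f] max_dom_cnj [OF g]
  have "cnj (Wa g (\<lambda>x. cnj (f x))) = - Wa f (\<lambda>x. cnj (g x))" "cnj (Wb g (\<lambda>x. cnj (f x))) = - Wb f (\<lambda>x. cnj (g x))"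
    using W_cnj [OF g c(1)] W_anti [OF f c(2)] by simp_all
  then show ?thesis by (simp add: bform_def)
qed

lemma zero_dmax: "(\<lambda>_. 0) \<in> dmax" "AE x in lebesgue_on I. sl_ell (\<lambda>_. 0) x = 0"
proof -
  obtain \<phi> where \<phi>: "solution 0 \<phi>" using solution_pair by metis
  note m = solution_in_max_dom [OF \<phi>]
  show "(\<lambda>_. 0) \<in> dmax" using max_dom_lincomb [OF m m, of 0 0] by (simp add: dmax_iff)
  show "AE x in lebesgue_on I. sl_ell (\<lambda>_. 0) x = 0"
    using regular_lincomb(3) [OF max_domD(1) [OF m] max_domD(1) [OF m], of 0 0] by simp
qed

text \<open>The difference of \<open>g\<close> and a solution \<open>k\<close> of \<open>sl_ell k = h\<close> is orthogonal to the orthogonal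
  complement of the homogeneous solutions, hence is one of them.\<close>

lemma in_adjoint_representative:
  assumes D: "D \<subseteq> dmax"
    and max: "\<And>g. g \<in> dmax \<Longrightarrow> (\<And>f. f \<in> D \<Longrightarrow> bform f g = 0) \<Longrightarrow> g \<in> D"
    and adj: "in_adjoint D g h"
  shows "\<exists>f\<in>D. ae_eq f g \<and> ae_eq (sl_ell f) h"
proof -
  have g: "l2_on I g" and h: "l2_on I h" and eq: "\<And>f. f \<in> D \<Longrightarrow> wip (sl_ell f) g = wip f h"
    using adj by (auto simp: in_adjoint_def)
  obtain \<phi> \<psi> where s: "solution 0 \<phi>" "solution 0 \<psi>" "\<And>x. x \<in> I \<Longrightarrow> wronskian \<phi> \<psi> x = 1"
    and out: "\<And>x. x \<notin> I \<Longrightarrow> \<phi> x = 0" "\<And>x. x \<notin> I \<Longrightarrow> \<psi> x = 0"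
    using solution_pair [of 0] by metis
  note m = solution_in_max_dom [OF s(1)] solution_in_max_dom [OF s(2)]
  obtain k where k: "k \<in> dmax" "ae_eq (sl_ell k) h"
    using variation_of_constants [OF s h] by blast
  have km: "k \<in> max_dom" using k(1) by (simp add: dmax_iff)
  let ?e1 = "\<lambda>x. cnj (\<phi> x)" and ?e2 = "\<lambda>x. cnj (\<psi> x)"
  have e: "sq_int weighted ?e1" "sq_int weighted ?e2"
    using solution_l2 s by (auto simp: l2_on_iff intro: sq_int_cnj)
  define G where "G x = g x - k x" for x
  have sg: "sq_int weighted g" "sq_int weighted k" using g max_domD(2) [OF km] by (auto simp: l2_on_iff)
  have G: "sq_int weighted G" unfolding G_def by (intro sq_int_diff sg)
  have perp: "ip weighted r G = 0"
    if r: "sq_int weighted r" "ip weighted r ?e1 = 0" "ip weighted r ?e2 = 0" for r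
  proof -
    have r2: "l2_on I r" using r(1) by (simp add: l2_on_iff)
    obtain f where f: "f \<in> dmax" "ae_eq (sl_ell f) r" "Wa f \<phi> = 0" "Wa f \<psi> = 0"
      using variation_of_constants [OF s r2] by blast
    have fm: "f \<in> max_dom" using f(1) by (simp add: dmax_iff)
    have fb: "Wb f \<phi> = 0" "Wb f \<psi> = 0"
      using W_at_b [OF fm f(2) r2 s(1)] W_at_b [OF fm f(2) r2 s(2)] f(3,4) r(2,3) by simp_all
    \<comment> \<open>The pair \<open>\<phi>\<close>, \<open>\<psi>\<close> has Wronskian 1, so
      Pluecker's identity reduces all boundary values of \<open>f\<close> to those against this
      pair.\<close>
    have zero: "Wa f u = 0 \<and> Wb f u = 0" if "u \<in> max_dom" for u
      using W_pluecker [OF fm that m] f(3,4) fb W_solution_pair [OF s(3)] by simp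
    have bf: "bform f u = 0" if "u \<in> max_dom" for u
      unfolding bform_def using zero [OF max_dom_cnj [OF that]] by simp
    \<comment> \<open>All boundary limits of \<open>f\<close> vanish, so \<open>f\<close> is in the
      complement of \<open>D\<close> under \<open>bform\<close>, which \<open>D\<close> contains by
      assumption.\<close>
    have "f \<in> D"
    proof (rule max [OF f(1)])
      fix u assume "u \<in> D"
      then have "u \<in> max_dom" using D by (auto simp: dmax_iff)
      then show "bform u f = 0" using bform_conj_sym [OF _ fm, of u] bf by simp
    qed
    have "wip r g = wip (sl_ell f) g"
      using f(2) max_domD(3) [OF fm] g l2_measurable by (intro wip_cong [symmetric]) (auto simp: ae_eq_def)
    also have "\<dots> = wip f h" by (rule eq [OF \<open>f \<in> D\<close>])
    also have "\<dots> = wip f (sl_ell k)"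
      using k(2) max_domD(2) [OF fm] max_domD(3) [OF km] l2_measurable by (intro wip_cong [symmetric]) (auto simp: ae_eq_def)
    also have "\<dots> = wip (sl_ell f) k" using green [OF fm km] bf [OF km] by (simp add: bform_def)
    also have "\<dots> = wip r k"
      using f(2) max_domD(3) [OF fm] max_domD(2) [OF km] l2_measurable by (intro wip_cong) (auto simp: ae_eq_def)
    finally have "ip weighted r g = ip weighted r k" using r2 g max_domD(2) [OF km] by (simp add: wip_l2)
    then show ?thesis unfolding G_def using ip_diff_right [OF sg r(1)] by simp
  qed
  obtain c1 c2 where c: "ip weighted (\<lambda>x. G x - c1 * ?e1 x - c2 * ?e2 x) ?e1 = 0"
      "ip weighted (\<lambda>x. G x - c1 * ?e1 x - c2 * ?e2 x) ?e2 = 0"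
    using sq_int_project2 [OF G e] by blast
  define R where "R x = G x - c1 * ?e1 x - c2 * ?e2 x" for x
  have R: "sq_int weighted R" unfolding R_def by (intro sq_int_diff sq_int_cmult G e)
  have Re: "ip weighted R ?e1 = 0" "ip weighted R ?e2 = 0" using c by (simp_all add: R_def [abs_def])
  have sc: "sq_int weighted (\<lambda>x. c1 * ?e1 x)" "sq_int weighted (\<lambda>x. c2 * ?e2 x)" by (intro sq_int_cmult e)+
  have "ip weighted R R = ip weighted R G - ip weighted R (\<lambda>x. c1 * ?e1 x) - ip weighted R (\<lambda>x. c2 * ?e2 x)"
    using ip_diff_right [OF sq_int_diff [OF G sc(1)] sc(2) R] ip_diff_right [OF G sc(1) R] by (simp add: R_def [abs_def])
  also have "\<dots> = 0" using perp [OF R Re] Re by (simp add: ip_cmult_right)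
  finally have "nsq weighted R = 0" by (simp add: ip_self)
  then have R0: "AE x in lebesgue_on I. R x = 0" using nsq_eq_0 [OF R] by (simp add: AE_weighted)
  define z where "z x = c1 * ?e1 x + c2 * ?e2 x" for x
  note mc = max_dom_cnj [OF m(1)] max_dom_cnj [OF m(2)]
  have z: "z \<in> max_dom" unfolding z_def by (rule max_dom_lincomb [OF mc])
  have "AE x in lebesgue_on I. sl_ell \<phi> x = 0" "AE x in lebesgue_on I. sl_ell \<psi> x = 0"
    using s by (auto simp: solution_def ae_eq_def)
  with regular_lincomb(3) [OF max_domD(1) [OF mc(1)] max_domD(1) [OF mc(2)], of c1 c2]
    regular_cnj(3) [OF max_domD(1) [OF m(1)]] regular_cnj(3) [OF max_domD(1) [OF m(2)]]
  have zl: "AE x in lebesgue_on I. sl_ell z x = 0"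
    unfolding z_def [abs_def] by eventually_elim simp
  define F where "F x = 1 * k x + 1 * z x" for x
  have Fm: "F \<in> max_dom" unfolding F_def by (rule max_dom_lincomb [OF km z])
  have Fd: "F \<in> dmax" using Fm k(1) out by (auto simp: dmax_iff F_def z_def)
  have Fg: "ae_eq F g" unfolding ae_eq_def using R0
    by eventually_elim (simp add: F_def z_def R_def G_def algebra_simps)
  have Fh: "ae_eq (sl_ell F) h"
    using regular_lincomb(3) [OF max_domD(1) [OF km] max_domD(1) [OF z], of 1 1] k(2) zl
    unfolding F_def [abs_def] ae_eq_def by eventually_elim simp
  have "F \<in> D"
  proof (rule max [OF Fd])
    fix f assume f: "f \<in> D"
    then have fm: "f \<in> max_dom" using D by (auto simp: dmax_iff)
    have "wip (sl_ell f) F = wip (sl_ell f) g" "wip f (sl_ell F) = wip f h"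
      using Fg Fh max_domD [OF fm] max_domD [OF Fm] l2_measurable by (auto intro!: wip_cong simp: ae_eq_def)
    then show "bform f F = 0" using green [OF fm Fm] eq [OF f] by (simp add: bform_def)
  qed
  with Fg Fh show ?thesis by blast
qed

text \<open>The criterion asks that \<open>D\<close> be isotropic for \<open>bform\<close> and
  contain its own complement. Isotropy puts the graph inside the adjoint, and
  \<open>in_adjoint_representative\<close> gives the reverse inclusion.\<close>

lemma self_adjointI:
  assumes D: "D \<subseteq> dmax"
    and lin: "\<And>c d f g. f \<in> D \<Longrightarrow> g \<in> D \<Longrightarrow> (\<lambda>x. c * f x + d * g x) \<in> D" and zero: "(\<lambda>_. 0) \<in> D"
    and sym: "\<And>f g. f \<in> D \<Longrightarrow> g \<in> D \<Longrightarrow> bform f g = 0"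
    and max: "\<And>g. g \<in> dmax \<Longrightarrow> (\<And>f. f \<in> D \<Longrightarrow> bform f g = 0) \<Longrightarrow> g \<in> D"
  shows "self_adjoint D"
  unfolding self_adjoint_def
proof (intro conjI allI impI)
  have Dm: "f \<in> max_dom" if "f \<in> D" for f using that D by (auto simp: dmax_iff)
  show "in_adjoint D g h \<longleftrightarrow> (\<exists>f\<in>D. ae_eq f g \<and> ae_eq (sl_ell f) h)" if gh: "l2_on I g \<and> l2_on I h" for g h
  proof
    assume "in_adjoint D g h"
    then show "\<exists>f\<in>D. ae_eq f g \<and> ae_eq (sl_ell f) h"
      using in_adjoint_representative [OF D max] by blast
  next
    assume "\<exists>f\<in>D. ae_eq f g \<and> ae_eq (sl_ell f) h"
    then obtain F where F: "F \<in> D" "ae_eq F g" "ae_eq (sl_ell F) h" by blast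
    have "wip (sl_ell f) g = wip f h" if f: "f \<in> D" for f
    proof -
      have "wip (sl_ell f) F = wip (sl_ell f) g" "wip f (sl_ell F) = wip f h"
        using F(2,3) max_domD [OF Dm [OF f]] max_domD [OF Dm [OF F(1)]] l2_measurable
        by (auto intro!: wip_cong simp: ae_eq_def)
      then show ?thesis using green [OF Dm [OF f] Dm [OF F(1)]] sym [OF f F(1)] by (simp add: bform_def)
    qed
    then show "in_adjoint D g h" using gh by (simp add: in_adjoint_def)
  qed
  show "dense_domain D"
    unfolding dense_domain_def
  proof (intro allI impI)
    fix h and \<epsilon> :: real assume h: "l2_on I h" and \<epsilon>: "0 < \<epsilon>"
    have "\<exists>f\<in>D. nsq weighted (\<lambda>x. h x - f x) < \<epsilon>\<^sup>2"
    proof (rule L2_dense_of_trivial_complement)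
      show "sq_int weighted f" if "f \<in> D" for f using max_domD(2) [OF Dm [OF that]] by (simp add: l2_on_iff)
      show "(\<lambda>_. 0) \<in> D" by (rule zero)
      show "(\<lambda>x. f x + g x) \<in> D" if "f \<in> D" "g \<in> D" for f g using lin [OF that, of 1 1] by simp
      show "(\<lambda>x. c * f x) \<in> D" if "f \<in> D" for c f using lin [OF that that, of c 0] by simp
      show "sq_int weighted h" using h by (simp add: l2_on_iff)
      show "0 < \<epsilon>\<^sup>2" using \<epsilon> by simp
      fix k assume k: "sq_int weighted k" "\<And>f. f \<in> D \<Longrightarrow> ip weighted k f = 0"
      have k2: "l2_on I k" using k(1) by (simp add: l2_on_iff)
      \<comment> \<open>Density: if \<open>k\<close> is orthogonal to \<open>D\<close>, then the
        pair of 0 and \<open>k\<close> belongs to the adjoint. Its representative in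
        \<open>D\<close> is the zero function, whose image is 0 a.e., and so is
        \<open>k\<close>.\<close>
      have "in_adjoint D (\<lambda>_. 0) k"
        unfolding in_adjoint_def
      proof (intro conjI ballI)
        show "l2_on I (\<lambda>_. 0)" by (simp add: l2_on_iff)
        fix f assume f: "f \<in> D"
        have "wip f k = cnj (ip weighted k f)"
          using wip_l2 [OF max_domD(2) [OF Dm [OF f]] k2] ip_cnj [of weighted f k] by simp
        then show "wip (sl_ell f) (\<lambda>_. 0) = wip f k" using k(2) [OF f] by (simp add: wip_def)
      qed (rule k2)
      then obtain F where F: "F \<in> D" "ae_eq F (\<lambda>_. 0)" "ae_eq (sl_ell F) k"
        using in_adjoint_representative [OF D max] by blast
      have "F = (\<lambda>_. 0)"
      proof
        fix x show "F x = 0"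
        proof (cases "x \<in> I")
          case True
          show ?thesis
            by (rule continuous_AE_eq [OF I_open regular_continuous(1) [OF max_domD(1) [OF Dm [OF F(1)]]] _ _ True])
              (use F(2) in \<open>auto simp: ae_eq_def\<close>)
        next
          case False
          then show ?thesis using F(1) D by (auto simp: dmax_iff)
        qed
      qed
      then have "AE x in lebesgue_on I. k x = 0"
        using F(3) zero_dmax(2) unfolding ae_eq_def by (auto elim: eventually_elim2)
      then show "AE x in weighted. k x = 0" by (simp add: AE_weighted)
    qed
    then obtain f where f: "f \<in> D" "nsq weighted (\<lambda>x. h x - f x) < \<epsilon>\<^sup>2" by blast
    have "l2_on I (\<lambda>x. h x - f x)"
      using h max_domD(2) [OF Dm [OF f(1)]] unfolding l2_on_iff by (rule sq_int_diff)
    then have "wnorm (\<lambda>x. h x - f x) < \<epsilon>"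
      using f(2) \<epsilon> by (simp add: wnorm_nsq real_less_lsqrt)
    with f(1) show "\<exists>f\<in>D. wnorm (\<lambda>x. h x - f x) < \<epsilon>" by blast
  qed
qed

end


section \<open>Boundary maps and double eigenvalues\<close>

text \<open>The scalar multiplication is the one written out in \<open>eig_mult\<close>, so that
  dimension theory applies to eigenspaces.\<close>

interpretation fun_space: vector_space "\<lambda>(c::complex) (f :: real \<Rightarrow> complex) x. c * f x"
  by unfold_locales (auto simp: fun_eq_iff algebra_simps)

context limit_circle
begin

section \<open>The solution space and double eigenvalues\<close>

lemma constant_wronskian:
  assumes f: "solution z f" and g: "solution z g" and x: "x \<in> I"
  shows "wronskian f g x = Wa f g"
proof -
  have P: "primitive_on I (wronskian f g) (\<lambda>_. 0)"
    using solution_wronskian_primitive [OF f g] by simp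
  have "wronskian f g y = wronskian f g x" if y: "y \<in> I" for y
    using primitive_onD(3) [OF P, of x y] primitive_onD(3) [OF P, of y x] I_segment [OF x y] I_segment [OF y x]
    by (cases "x \<le> y") auto
  then show ?thesis using W_solution_pair(1) by metis
qed

definition solution_space :: "complex \<Rightarrow> (real \<Rightarrow> complex) set" where
  "solution_space z = {f. solution z f \<and> (\<forall>x. x \<notin> I \<longrightarrow> f x = 0)}"

lemma solution_space_dmax: "f \<in> solution_space z \<Longrightarrow> f \<in> dmax"
  using solution_in_max_dom by (auto simp: solution_space_def dmax_iff)

lemma eigenspace_eq: "D \<subseteq> dmax \<Longrightarrow> eigenspace D z = D \<inter> solution_space z"
  by (auto simp: eigenspace_def solution_space_def solution_def dmax_def)

lemma solution_space_lincomb: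
  assumes "f \<in> solution_space z" "g \<in> solution_space z"
  shows "(\<lambda>x. c * f x + d * g x) \<in> solution_space z"
proof -
  have f: "regular_fun f" "AE x in lebesgue_on I. sl_ell f x = z * f x"
    and g: "regular_fun g" "AE x in lebesgue_on I. sl_ell g x = z * g x"
    using assms by (auto simp: solution_space_def solution_def ae_eq_def)
  have "AE x in lebesgue_on I. sl_ell (\<lambda>x. c * f x + d * g x) x = z * (c * f x + d * g x)"
    using f(2) g(2) regular_lincomb(3) [OF f(1) g(1), of c d] by eventually_elim (simp add: algebra_simps)
  then show ?thesis
    using assms regular_lincomb(1) [OF f(1) g(1)] by (simp add: solution_space_def solution_def ae_eq_def)
qed

lemma solution_space_cnj:
  assumes "f \<in> solution_space z" "z \<in> \<real>"
  shows "(\<lambda>x. cnj (f x)) \<in> solution_space z"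
proof -
  have f: "regular_fun f" "AE x in lebesgue_on I. sl_ell f x = z * f x"
    using assms(1) by (auto simp: solution_space_def solution_def ae_eq_def)
  have "AE x in lebesgue_on I. sl_ell (\<lambda>x. cnj (f x)) x = z * cnj (f x)"
    using f(2) regular_cnj(3) [OF f(1)] by eventually_elim (use assms(2) in \<open>simp add: Reals_cnj_iff\<close>)
  then show ?thesis
    using assms(1) regular_cnj(1) [OF f(1)] by (simp add: solution_space_def solution_def ae_eq_def)
qed

text \<open>Cramer's rule with constant Wronskians: the coordinates of a solution are its Wronskians
  with the two basis functions.\<close>

lemma solution_basis:
  obtains \<phi> \<psi> where "\<phi> \<in> solution_space z" "\<psi> \<in> solution_space z" "Wa \<phi> \<psi> = 1"
    "\<And>f. f \<in> solution_space z \<Longrightarrow> f = (\<lambda>x. Wa f \<psi> * \<phi> x + - Wa f \<phi> * \<psi> x)"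
proof -
  obtain \<phi> \<psi> where s: "solution z \<phi>" "solution z \<psi>" "\<And>x. x \<in> I \<Longrightarrow> wronskian \<phi> \<psi> x = 1"
    and out: "\<And>x. x \<notin> I \<Longrightarrow> \<phi> x = 0" "\<And>x. x \<notin> I \<Longrightarrow> \<psi> x = 0"
    using solution_pair [of z] by metis
  have "f = (\<lambda>x. Wa f \<psi> * \<phi> x + - Wa f \<phi> * \<psi> x)" if f: "f \<in> solution_space z" for f
  proof
    fix x
    show "f x = Wa f \<psi> * \<phi> x + - Wa f \<phi> * \<psi> x"
    proof (cases "x \<in> I")
      case True
      have fs: "solution z f" using f by (simp add: solution_space_def)
      have "wronskian f \<psi> x * \<phi> x + - wronskian f \<phi> x * \<psi> x = f x * wronskian \<phi> \<psi> x"
        by (simp add: wronskian_def algebra_simps)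
      then show ?thesis using constant_wronskian [OF fs s(1) True] constant_wronskian [OF fs s(2) True] s(3) [OF True] by simp
    next
      case False
      then show ?thesis using f out by (simp add: solution_space_def)
    qed
  qed
  then show thesis using that [of \<phi> \<psi>] s out W_solution_pair(1) [OF s(3)] by (auto simp: solution_space_def)
qed

definition linear_domain :: "(real \<Rightarrow> complex) set \<Rightarrow> bool" where
  "linear_domain D \<longleftrightarrow> D \<subseteq> dmax \<and> (\<lambda>_. 0) \<in> D \<and> (\<forall>f\<in>D. \<forall>g\<in>D. \<forall>c d. (\<lambda>x. c * f x + d * g x) \<in> D)"

text \<open>The eigenspace is the part of the two-dimensional solution space that lies in
  \<open>D\<close>, so it has dimension 2 only if nothing is cut off. This trades a dimension count
  for an inclusion.\<close>

lemma double_eigenvalue_iff: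
  assumes D: "linear_domain D"
  shows "eig_mult D z = 2 \<longleftrightarrow> solution_space z \<subseteq> D"
proof -
  obtain \<phi> \<psi> where b: "\<phi> \<in> solution_space z" "\<psi> \<in> solution_space z" "Wa \<phi> \<psi> = 1"
    "\<And>f. f \<in> solution_space z \<Longrightarrow> f = (\<lambda>x. Wa f \<psi> * \<phi> x + - Wa f \<phi> * \<psi> x)"
    by (rule solution_basis [of z], rule that)
  have lin: "(\<lambda>x. c * f x + d * g x) \<in> D" if "f \<in> D" "g \<in> D" for c d f g
    using D that by (simp add: linear_domain_def)
  have sub: "fun_space.subspace D"
    unfolding fun_space.subspace_def
  proof (intro conjI ballI allI)
    show "0 \<in> D" using D by (simp add: linear_domain_def zero_fun_def)
    show "f + g \<in> D" if "f \<in> D" "g \<in> D" for f g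
      using lin [OF that, of 1 1] by (simp add: plus_fun_def)
    show "(\<lambda>x. c * f x) \<in> D" if "f \<in> D" for c f
      using lin [OF that that, of c 0] by simp
  qed
  have m: "\<phi> \<in> max_dom" "\<psi> \<in> max_dom" using b solution_space_dmax by (auto simp: dmax_iff)
  have span: "f \<in> fun_space.span {\<phi>, \<psi>}" if f: "f \<in> solution_space z" for f
  proof -
    have "(\<lambda>x. c * \<phi> x) + (\<lambda>x. d * \<psi> x) \<in> fun_space.span {\<phi>, \<psi>}" for c d
      by (intro fun_space.span_add fun_space.span_scale fun_space.span_base) auto
    then have "(\<lambda>x. c * \<phi> x + d * \<psi> x) \<in> fun_space.span {\<phi>, \<psi>}" for c d by (simp add: plus_fun_def)
    then show ?thesis by (subst b(4) [OF f])
  qed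
  have Dmax: "D \<subseteq> dmax" using D by (simp add: linear_domain_def)
  have em: "eig_mult D z = fun_space.dim (D \<inter> solution_space z)"
    by (simp add: eig_mult_def eigenspace_eq [OF Dmax])
  have self0: "Wa \<phi> \<phi> = 0" "Wa \<psi> \<psi> = 0" using W_anti(1) [OF m(1) m(1)] W_anti(1) [OF m(2) m(2)] by simp_all
  have neq: "\<phi> \<noteq> \<psi>" using b(3) self0 by auto
  have "\<phi> \<noteq> 0" 
  proof
    assume "\<phi> = 0"
    then have "\<phi> = (\<lambda>x. 0 * \<psi> x + 0 * \<psi> x)" by (simp add: zero_fun_def)
    then have "Wa \<phi> \<psi> = 0" using W_lincomb(1) [OF m(2) m(2) m(2), of 0 0] by simp
    then show False using b(3) by simp
  qed
  then have i1: "fun_space.independent {\<phi>}" by (simp add: fun_space.dependent_single)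
  have "\<psi> \<notin> fun_space.span {\<phi>}"
  proof
    assume "\<psi> \<in> fun_space.span {\<phi>}"
    then obtain c where "\<psi> = (\<lambda>x. c * \<phi> x + 0 * \<phi> x)" by (auto simp: fun_space.span_singleton)
    then have "Wa \<psi> \<phi> = 0" using W_lincomb(1) [OF m(1) m(1) m(1), of c 0] self0 by simp
    then show False using W_anti(1) [OF m] b(3) by simp
  qed
  then have "fun_space.independent (insert \<psi> {\<phi>})" using i1 by (rule fun_space.independent_insertI)
  then have indep: "fun_space.independent {\<phi>, \<psi>}" by (simp add: insert_commute)
  show ?thesis
  proof
    assume sol: "solution_space z \<subseteq> D"
    then have "D \<inter> solution_space z = solution_space z" by blast
    moreover have "fun_space.dim (solution_space z) = card {\<phi>, \<psi>}"
      by (rule fun_space.dim_unique [OF _ _ indep refl]) (use b span in auto)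
    ultimately show "eig_mult D z = 2" using neq em by simp
  next
    assume "eig_mult D z = 2"
    then have dim: "fun_space.dim (D \<inter> solution_space z) = 2" using em by simp
    obtain B where B: "B \<subseteq> D \<inter> solution_space z" "fun_space.independent B" "card B = 2"
      using fun_space.basis_exists [of "D \<inter> solution_space z"] dim by metis
    have fB: "finite B" using B(3) card.infinite by fastforce
    \<comment> \<open>A solution outside the span of \<open>B\<close> would yield three independent
      functions in the span of \<open>\<phi>\<close> and \<open>\<psi>\<close>.\<close>
    have in_span: "f \<in> fun_space.span B" if f: "f \<in> solution_space z" for f
    proof (rule ccontr)
      assume nf: "f \<notin> fun_space.span B"
      then have "fun_space.independent (insert f B)" using B(2) by (rule fun_space.independent_insertI)
      moreover have "insert f B \<subseteq> fun_space.span {\<phi>, \<psi>}" using span f B(1) by blast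
      ultimately have "card (insert f B) \<le> card {\<phi>, \<psi>}"
        using fun_space.independent_span_bound [of "{\<phi>, \<psi>}" "insert f B"] by simp
      moreover have "f \<notin> B" using nf fun_space.span_base by blast
      ultimately show False using fB B(3) neq by simp
    qed
    have "fun_space.span B \<subseteq> D" using B(1) sub by (intro fun_space.span_minimal) auto
    then show "solution_space z \<subseteq> D" using in_span by blast
  qed
qed

end

lemma matrix_vector_mult_axis:
  fixes \<theta> :: "complex^2^2"
  shows "(\<theta> *v axis k 1) $ i = \<theta> $ i $ k"
  using exhaust_2 [of k] by (auto simp: matrix_vector_mult_def sum_2 axis_def)

text \<open>The two parametrisations of self-adjoint extensions in the theorem differ only in the
  boundary maps: \<open>(X, Y)\<close> is \<open>(\<Gamma>\<^sub>0, \<Gamma>\<^sub>1)\<close> for one and \<open>(- \<Gamma>\<^sub>1, \<Gamma>\<^sub>0)\<close> for the other.\<close>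

locale boundary_pair = limit_circle +
  fixes X Y :: "(real \<Rightarrow> complex) \<Rightarrow> complex^2"
  assumes X_lincomb: "f \<in> max_dom \<Longrightarrow> g \<in> max_dom \<Longrightarrow> X (\<lambda>x. c * f x + d * g x) $ i = c * X f $ i + d * X g $ i"
    and Y_lincomb: "f \<in> max_dom \<Longrightarrow> g \<in> max_dom \<Longrightarrow> Y (\<lambda>x. c * f x + d * g x) $ i = c * Y f $ i + d * Y g $ i"
    and X_cnj: "f \<in> max_dom \<Longrightarrow> X (\<lambda>x. cnj (f x)) $ i = cnj (X f $ i)"
    and Y_cnj: "f \<in> max_dom \<Longrightarrow> Y (\<lambda>x. cnj (f x)) $ i = cnj (Y f $ i)"
    and bform_XY: "f \<in> max_dom \<Longrightarrow> g \<in> max_dom \<Longrightarrow>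
      bform f g = (\<Sum>i\<in>UNIV. Y f $ i * cnj (X g $ i) - X f $ i * cnj (Y g $ i))"
    and XY_surj: "\<exists>f\<in>dmax. X f = x \<and> Y f = y"
    and XY_left: "f \<in> max_dom \<Longrightarrow> g \<in> max_dom \<Longrightarrow> X f $ 1 = 0 \<Longrightarrow> Y f $ 1 = 0 \<Longrightarrow> Wa f g = 0"
begin

definition ext :: "complex^2^2 \<Rightarrow> (real \<Rightarrow> complex) set" where
  "ext \<theta> = {f \<in> dmax. \<theta> *v X f = Y f}"

lemma ext_iff: "f \<in> ext \<theta> \<longleftrightarrow> f \<in> dmax \<and> (\<forall>i. \<theta> $ i $ 1 * X f $ 1 + \<theta> $ i $ 2 * X f $ 2 = Y f $ i)"
  by (simp add: ext_def vec_eq_iff matrix_vector_mult_def sum_2)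

lemma XY_zero: "X (\<lambda>_. 0) = 0" "Y (\<lambda>_. 0) = 0"
proof -
  have z: "(\<lambda>_. 0) \<in> max_dom" using zero_dmax(1) by (simp add: dmax_iff)
  show "X (\<lambda>_. 0) = 0" "Y (\<lambda>_. 0) = 0"
    using X_lincomb [OF z z, of 0 0] Y_lincomb [OF z z, of 0 0] by (simp_all add: vec_eq_iff)
qed

lemma linear_domain_ext: "linear_domain (ext \<theta>)"
proof -
  have lin: "(\<lambda>x. c * f x + d * g x) \<in> ext \<theta>" if f: "f \<in> ext \<theta>" and g: "g \<in> ext \<theta>" for c d f g
  proof -
    have d: "f \<in> dmax" "g \<in> dmax" using f g by (simp_all add: ext_iff)
    then have m: "f \<in> max_dom" "g \<in> max_dom" by (simp_all add: dmax_iff)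
    have "(\<lambda>x. c * f x + d * g x) \<in> dmax" using d max_dom_lincomb [OF m] by (simp add: dmax_iff)
    moreover have "\<theta> $ i $ 1 * (c * X f $ 1 + d * X g $ 1) + \<theta> $ i $ 2 * (c * X f $ 2 + d * X g $ 2) = c * Y f $ i + d * Y g $ i" for i
    proof -
      have "\<theta> $ i $ 1 * (c * X f $ 1 + d * X g $ 1) + \<theta> $ i $ 2 * (c * X f $ 2 + d * X g $ 2)
        = c * (\<theta> $ i $ 1 * X f $ 1 + \<theta> $ i $ 2 * X f $ 2) + d * (\<theta> $ i $ 1 * X g $ 1 + \<theta> $ i $ 2 * X g $ 2)"
        by (simp add: algebra_simps)
      then show ?thesis using f g by (simp add: ext_iff)
    qed
    ultimately show ?thesis by (simp add: ext_iff X_lincomb [OF m] Y_lincomb [OF m])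
  qed
  have "(\<lambda>_. 0) \<in> ext \<theta>" using zero_dmax(1) by (simp add: ext_iff XY_zero)
  then show ?thesis using lin by (auto simp: linear_domain_def ext_iff)
qed

text \<open>In the coordinates \<open>X\<close>, \<open>Y\<close> the boundary form is the standard
  symplectic one, and the graph of a Hermitian matrix equals its own complement for it.\<close>

lemma self_adjoint_ext:
  assumes \<theta>: "hermitian \<theta>"
  shows "self_adjoint (ext \<theta>)"
proof (rule self_adjointI)
  have h: "\<theta> $ i $ j = cnj (\<theta> $ j $ i)" for i j using \<theta> unfolding hermitian_def by blast
  show "ext \<theta> \<subseteq> dmax" "(\<lambda>_. 0) \<in> ext \<theta>" using linear_domain_ext by (simp_all add: linear_domain_def)
  show "(\<lambda>x. c * f x + d * g x) \<in> ext \<theta>" if "f \<in> ext \<theta>" "g \<in> ext \<theta>" for c d f g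
    using linear_domain_ext that by (simp add: linear_domain_def)
  show "bform f g = 0" if f: "f \<in> ext \<theta>" and g: "g \<in> ext \<theta>" for f g
  proof -
    have m: "f \<in> max_dom" "g \<in> max_dom" using f g by (simp_all add: ext_iff dmax_iff)
    have Y: "Y f $ i = \<theta> $ i $ 1 * X f $ 1 + \<theta> $ i $ 2 * X f $ 2" 
      "cnj (Y g $ i) = \<theta> $ 1 $ i * cnj (X g $ 1) + \<theta> $ 2 $ i * cnj (X g $ 2)" for i
    proof -
      show "Y f $ i = \<theta> $ i $ 1 * X f $ 1 + \<theta> $ i $ 2 * X f $ 2" using f by (simp add: ext_iff)
      have "Y g $ i = \<theta> $ i $ 1 * X g $ 1 + \<theta> $ i $ 2 * X g $ 2" using g by (simp add: ext_iff)
      then have "cnj (Y g $ i) = cnj (\<theta> $ i $ 1) * cnj (X g $ 1) + cnj (\<theta> $ i $ 2) * cnj (X g $ 2)" by simp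
      then show "cnj (Y g $ i) = \<theta> $ 1 $ i * cnj (X g $ 1) + \<theta> $ 2 $ i * cnj (X g $ 2)"
        by (simp only: h [symmetric])
    qed
    show ?thesis unfolding bform_XY [OF m] sum_2 Y by (simp add: algebra_simps)
  qed
  show "g \<in> ext \<theta>" if g: "g \<in> dmax" and perp: "\<And>f. f \<in> ext \<theta> \<Longrightarrow> bform f g = 0" for g
  proof -
    have gm: "g \<in> max_dom" using g by (simp add: dmax_iff)
    have "\<theta> $ k $ 1 * X g $ 1 + \<theta> $ k $ 2 * X g $ 2 = Y g $ k" for k
    proof -
      \<comment> \<open>Testing \<open>g\<close> against functions of the domain with
        \<open>X f\<close> a unit vector recovers the boundary condition of \<open>g\<close> row by
        row.\<close>
      obtain f where f: "f \<in> dmax" "X f = axis k 1" "Y f = \<theta> *v axis k 1" using XY_surj by blast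
      then have "f \<in> ext \<theta>" by (simp add: ext_def)
      then have "bform f g = 0" by (rule perp)
      moreover have "f \<in> max_dom" using f(1) by (simp add: dmax_iff)
      moreover have Yf: "Y f $ i = \<theta> $ i $ k" for i using f(3) by (simp add: matrix_vector_mult_axis)
      ultimately have "(\<Sum>i\<in>UNIV. \<theta> $ i $ k * cnj (X g $ i) - axis k 1 $ i * cnj (Y g $ i)) = 0"
        using bform_XY [OF _ gm] f(2) by simp
      then have "\<theta> $ 1 $ k * cnj (X g $ 1) + \<theta> $ 2 $ k * cnj (X g $ 2) - cnj (Y g $ k) = 0"
        using exhaust_2 [of k] by (auto simp: sum_2 axis_def algebra_simps)
      then have "cnj (\<theta> $ 1 $ k * cnj (X g $ 1) + \<theta> $ 2 $ k * cnj (X g $ 2) - cnj (Y g $ k)) = 0" by simp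
      then show ?thesis by (simp add: h [symmetric])
    qed
    then show ?thesis using g by (simp add: ext_iff)
  qed
qed

text \<open>The first components belong to the endpoint \<open>a\<close>. If both vanish there, so
  do the Wronskians with the basis functions, which are the coordinates of \<open>f\<close>.\<close>

lemma solution_left_zero:
  assumes f: "f \<in> solution_space z" and 0: "X f $ 1 = 0" "Y f $ 1 = 0"
  shows "f = (\<lambda>_. 0)"
proof -
  obtain \<phi> \<psi> where b: "\<phi> \<in> solution_space z" "\<psi> \<in> solution_space z"
    "\<And>f. f \<in> solution_space z \<Longrightarrow> f = (\<lambda>x. Wa f \<psi> * \<phi> x + - Wa f \<phi> * \<psi> x)"
    by (rule solution_basis [of z], rule that)
  have m: "f \<in> max_dom" "\<phi> \<in> max_dom" "\<psi> \<in> max_dom"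
    using f b solution_space_dmax by (auto simp: dmax_iff)
  have "Wa f \<psi> = 0" "Wa f \<phi> = 0" using XY_left [OF m(1) _ 0] m by auto
  then show ?thesis using b(3) [OF f] by simp
qed

text \<open>An injective \<open>X\<close> on the two-dimensional solution space is a bijection onto
  the plane; \<open>F k\<close> is the preimage of the unit vector \<open>k\<close>. The images
  \<open>Y (F k)\<close> will be the columns of the matrix.\<close>

lemma solution_dual_basis:
  assumes inj: "\<And>f. f \<in> solution_space z \<Longrightarrow> X f = 0 \<Longrightarrow> f = (\<lambda>_. 0)"
  obtains F where "\<And>k. F k \<in> solution_space z" "\<And>k. X (F k) = axis k 1"
    "\<And>f. f \<in> solution_space z \<Longrightarrow> f = (\<lambda>x. X f $ 1 * F 1 x + X f $ 2 * F 2 x)"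
proof -
  obtain \<phi> \<psi> where b: "\<phi> \<in> solution_space z" "\<psi> \<in> solution_space z" "Wa \<phi> \<psi> = 1"
    by (rule solution_basis [of z], rule that)
  have m: "\<phi> \<in> max_dom" "\<psi> \<in> max_dom" using b solution_space_dmax by (auto simp: dmax_iff)
  define d where "d = X \<phi> $ 1 * X \<psi> $ 2 - X \<phi> $ 2 * X \<psi> $ 1"
  have comb0: "c = 0 \<and> e = 0"
    if "c * X \<phi> $ 1 + e * X \<psi> $ 1 = 0" "c * X \<phi> $ 2 + e * X \<psi> $ 2 = 0" for c e
  proof -
    let ?f = "\<lambda>x. c * \<phi> x + e * \<psi> x"
    have "X ?f $ i = 0" for i using that exhaust_2 [of i] by (auto simp: X_lincomb [OF m])
    then have f0: "?f = (\<lambda>_. 0)"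
      by (intro inj solution_space_lincomb b) (simp add: vec_eq_iff)
    have W0: "Wa (\<lambda>_. 0) \<psi> = 0" "Wa (\<lambda>_. 0) \<phi> = 0"
      using W_lincomb(1) [OF m m(2), of 0 0] W_lincomb(1) [OF m m(1), of 0 0] by simp_all
    have "c * Wa \<phi> \<psi> + e * Wa \<psi> \<psi> = 0" "c * Wa \<phi> \<phi> + e * Wa \<psi> \<phi> = 0"
      unfolding W_lincomb(1) [OF m m(2), symmetric] W_lincomb(1) [OF m m(1), symmetric] f0 by (rule W0)+
    then show ?thesis
      using b(3) W_anti(1) [OF m] W_anti(1) [OF m(1) m(1)] W_anti(1) [OF m(2) m(2)] by simp
  qed
  have d: "d \<noteq> 0"
  proof
    assume "d = 0"
    \<comment> \<open>With determinant 0 the pairs \<open>(X \<psi> $ i, - X \<phi> $ i)\<close> are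
      coefficients of null combinations. All four entries are then 0, and \<open>\<phi>\<close>
      alone contradicts \<open>comb0\<close>.\<close>
    then have "X \<psi> $ 1 = 0 \<and> - X \<phi> $ 1 = 0" "X \<psi> $ 2 = 0 \<and> - X \<phi> $ 2 = 0"
      by (intro comb0; simp add: d_def algebra_simps)+
    then show False using comb0 [of 1 0] by simp
  qed
  \<comment> \<open>\<open>(P k, R k)\<close> is column \<open>k\<close> of the inverse of the
    matrix with columns \<open>X \<phi>\<close> and \<open>X \<psi>\<close>.\<close>
  define P :: "2 \<Rightarrow> complex" where "P k = (if k = 1 then X \<psi> $ 2 else - X \<psi> $ 1) / d" for k
  define R :: "2 \<Rightarrow> complex" where "R k = (if k = 1 then - X \<phi> $ 2 else X \<phi> $ 1) / d" for k
  define F where "F k = (\<lambda>x. P k * \<phi> x + R k * \<psi> x)" for k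
  have F: "F k \<in> solution_space z" for k
    unfolding F_def by (rule solution_space_lincomb [OF b(1,2)])
  have XF: "X (F k) = axis k 1" for k
  proof -
    have "X (F k) $ i = axis k 1 $ i" for i
    proof -
      have "d * (P k * X \<phi> $ i + R k * X \<psi> $ i) = d * axis k 1 $ i"
        using exhaust_2 [of k] exhaust_2 [of i] d
        by (auto simp: P_def R_def axis_def distrib_left) (simp_all add: d_def algebra_simps)
      then show ?thesis using d unfolding F_def X_lincomb [OF m] by simp
    qed
    then show ?thesis by (simp add: vec_eq_iff)
  qed
  have "f = (\<lambda>x. X f $ 1 * F 1 x + X f $ 2 * F 2 x)" if f: "f \<in> solution_space z" for f
  proof -
    have FM: "F k \<in> max_dom" for k using F solution_space_dmax by (auto simp: dmax_iff)
    have fM: "f \<in> max_dom" using f solution_space_dmax by (auto simp: dmax_iff)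
    let ?g = "\<lambda>x. X f $ 1 * F 1 x + X f $ 2 * F 2 x"
    have g: "?g \<in> solution_space z" by (intro solution_space_lincomb F)
    have gM: "?g \<in> max_dom" using g solution_space_dmax by (auto simp: dmax_iff)
    have "X (\<lambda>x. 1 * f x + (-1) * ?g x) $ i = 0" for i
      unfolding X_lincomb [OF fM gM] X_lincomb [OF FM FM] XF
      using exhaust_2 [of i] by (auto simp: axis_def)
    then have E: "(\<lambda>x. 1 * f x + (-1) * ?g x) = (\<lambda>_. 0)"
      by (intro inj solution_space_lincomb f g) (simp add: vec_eq_iff)
    show ?thesis
    proof
      fix x show "f x = X f $ 1 * F 1 x + X f $ 2 * F 2 x" using fun_cong [OF E, of x] by algebra
    qed
  qed
  with F XF that show thesis by blast
qed

text \<open>Injectivity of \<open>X\<close> follows from the double eigenvalue itself: the boundary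
  condition turns \<open>X f = 0\<close> into \<open>Y f = 0\<close>, and the values at
  \<open>a\<close> already determine a solution. The consequences of a double eigenvalue thus do not
  rest on a resolvent set.\<close>

lemma double_injective:
  assumes sub: "solution_space z \<subseteq> ext \<theta>" and f: "f \<in> solution_space z" and 0: "X f = 0"
  shows "f = (\<lambda>_. 0)"
proof -
  have "Y f = 0" using sub f 0 by (auto simp: ext_def)
  then show ?thesis using 0 by (intro solution_left_zero [OF f]) simp_all
qed

lemma ext_column: "f \<in> ext \<theta> \<Longrightarrow> X f = axis k 1 \<Longrightarrow> Y f $ i = \<theta> $ i $ k"
  unfolding ext_def using matrix_vector_mult_axis [of \<theta> k i] by auto

text \<open>The values \<open>Y (F k)\<close> prescribe every column of the matrix.\<close>

lemma double_unique:
  assumes "solution_space z \<subseteq> ext \<theta>" "solution_space z \<subseteq> ext \<theta>'"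
  shows "\<theta> = \<theta>'"
proof -
  obtain F where F: "\<And>k. F k \<in> solution_space z" "\<And>k. X (F k) = axis k 1"
    using solution_dual_basis [OF double_injective [OF assms(1)]] by metis
  have "\<theta> $ i $ k = \<theta>' $ i $ k" for i k
    using ext_column [of "F k" \<theta> k i] ext_column [of "F k" \<theta>' k i] F assms by (metis subsetD)
  then show ?thesis by (simp add: vec_eq_iff)
qed

lemma double_exists:
  assumes inj: "\<And>f. f \<in> solution_space z \<Longrightarrow> X f = 0 \<Longrightarrow> f = (\<lambda>_. 0)" and z: "z \<in> \<real>"
  shows "\<exists>\<theta>. hermitian \<theta> \<and> solution_space z \<subseteq> ext \<theta>"
proof -
  obtain F where F: "\<And>k. F k \<in> solution_space z" "\<And>k. X (F k) = axis k 1"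
    "\<And>f. f \<in> solution_space z \<Longrightarrow> f = (\<lambda>x. X f $ 1 * F 1 x + X f $ 2 * F 2 x)"
    using solution_dual_basis [OF inj] by blast
  define \<theta> :: "complex^2^2" where "\<theta> = (\<chi> i k. Y (F k) $ i)"
  have M: "f \<in> max_dom" if "f \<in> solution_space z" for f using that solution_space_dmax by (auto simp: dmax_iff)
  have "\<theta> $ i $ j = cnj (\<theta> $ j $ i)" for i j
  proof -
    have s: "AE x in lebesgue_on I. sl_ell (F k) x = z * F k x" for k
      using F(1) [of k] by (simp add: solution_space_def solution_def ae_eq_def)
    have meas: "F k \<in> borel_measurable (lebesgue_on I)" "sl_ell (F k) \<in> borel_measurable (lebesgue_on I)" for k
      using max_domD [OF M [OF F(1)]] l2_measurable by auto
    have "wip (sl_ell (F j)) (F i) = wip (\<lambda>x. z * F j x) (F i)"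
      by (rule wip_cong) (use meas s in auto)
    also have "\<dots> = wip (F j) (\<lambda>x. z * F i x)"
      unfolding wip_def using z by (simp add: Reals_cnj_iff mult.left_commute mult.assoc)
    also have "\<dots> = wip (F j) (sl_ell (F i))"
      by (rule wip_cong [symmetric]) (use meas s in auto)
    \<comment> \<open>Two eigenfunctions for the same real eigenvalue have vanishing boundary form.
      In the dual basis this equation is precisely the Hermitian symmetry of the entry.\<close>
    finally have "bform (F j) (F i) = 0" using green [OF M M, OF F(1) F(1), of j i] by (simp add: bform_def)
    then have "(\<Sum>l\<in>UNIV. Y (F j) $ l * cnj (axis i 1 $ l) - axis j 1 $ l * cnj (Y (F i) $ l)) = 0"
      using bform_XY [OF M M, OF F(1) F(1), of j i] by (simp add: F(2))
    then have "Y (F j) $ i - cnj (Y (F i) $ j) = 0"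
      using exhaust_2 [of i] exhaust_2 [of j] by (auto simp: sum_2 axis_def)
    then show ?thesis by (simp add: \<theta>_def)
  qed
  then have "hermitian \<theta>" unfolding hermitian_def by blast
  moreover have "f \<in> ext \<theta>" if f: "f \<in> solution_space z" for f
  proof -
    have "Y f $ i = X f $ 1 * Y (F 1) $ i + X f $ 2 * Y (F 2) $ i" for i
      by (subst F(3) [OF f]) (rule Y_lincomb [OF M M, OF F(1) F(1)])
    then show ?thesis using solution_space_dmax [OF f] by (simp add: ext_iff \<theta>_def mult.commute)
  qed
  ultimately show ?thesis by blast
qed

text \<open>Since \<open>z\<close> is real, the conjugate of \<open>F k\<close> is again a solution;
  it has the same real vector as its \<open>X\<close>-value, so column \<open>k\<close> equals its
  own conjugate.\<close>

lemma double_properties: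
  assumes h: "hermitian \<theta>" and sub: "solution_space z \<subseteq> ext \<theta>" and z: "z \<in> \<real>"
  shows "real_matrix \<theta> \<and> \<theta> $ 1 $ 2 \<noteq> 0 \<and> \<theta> $ 2 $ 1 \<noteq> 0"
proof -
  obtain F where F: "\<And>k. F k \<in> solution_space z" "\<And>k. X (F k) = axis k 1"
    using solution_dual_basis [OF double_injective [OF sub]] by metis
  have M: "f \<in> max_dom" if "f \<in> solution_space z" for f using that solution_space_dmax by (auto simp: dmax_iff)
  have "\<theta> $ i $ k \<in> \<real>" for i k
  proof -
    have c: "(\<lambda>x. cnj (F k x)) \<in> ext \<theta>" using solution_space_cnj [OF F(1) z] sub by blast
    have "X (\<lambda>x. cnj (F k x)) = axis k 1"
      using X_cnj [OF M [OF F(1)]] F(2) by (simp add: vec_eq_iff axis_def)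
    from ext_column [OF c this] have "cnj (Y (F k) $ i) = \<theta> $ i $ k" using Y_cnj [OF M [OF F(1)]] by simp
    moreover have "Y (F k) $ i = \<theta> $ i $ k" using ext_column F sub by blast
    ultimately show ?thesis by (simp add: Reals_cnj_iff)
  qed
  moreover have "\<theta> $ 1 $ 2 \<noteq> 0"
  proof
    assume 0: "\<theta> $ 1 $ 2 = 0"
    \<comment> \<open>\<open>F 2\<close> has first component 0 under \<open>X\<close> by
      construction, and the vanishing entry makes its first component 0 under \<open>Y\<close> as
      well. Both values at \<open>a\<close> vanish although \<open>F 2\<close> is not the zero
      function.\<close>
    have "Y (F 2) $ 1 = 0" using ext_column [of "F 2" \<theta> 2 1] F sub 0 by auto
    then have "F 2 = (\<lambda>_. 0)" using F(2) [of 2] by (intro solution_left_zero [OF F(1)]) (simp_all add: axis_def)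
    moreover have "X (\<lambda>_. 0) $ 2 = 0" by (simp add: XY_zero)
    ultimately show False using F(2) [of 2] by (simp add: axis_def)
  qed
  moreover have "\<theta> $ 1 $ 2 = cnj (\<theta> $ 2 $ 1)" using h unfolding hermitian_def by blast
  ultimately show ?thesis unfolding real_matrix_def by auto
qed

end

context limit_circle
begin

text \<open>The resolvent equation with right-hand side 0 has a unique solution in \<open>D\<close>,
  and both \<open>f\<close> and the zero function solve it.\<close>

lemma resolvent_no_eigenvector:
  assumes z: "z \<in> resolvent_set D" and D: "(\<lambda>_. 0) \<in> D" "f \<in> D" and f: "solution z f"
  shows "f = (\<lambda>_. 0)"
proof -
  have "l2_on I (\<lambda>_. 0)" by (simp add: l2_on_iff)
  then have "\<exists>!f. f \<in> D \<and> ae_eq (\<lambda>x. sl_ell f x - z * f x) (\<lambda>_. 0)"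
    using z unfolding resolvent_set_def by blast
  moreover have "ae_eq (\<lambda>x. sl_ell f x - z * f x) (\<lambda>_. 0)"
    using f unfolding solution_def ae_eq_def by (auto elim: eventually_mono)
  moreover have "ae_eq (\<lambda>x. sl_ell (\<lambda>_. 0) x - z * (\<lambda>_. 0) x) (\<lambda>_. 0)"
    using zero_dmax(2) unfolding ae_eq_def by eventually_elim simp
  ultimately show ?thesis using D by blast
qed

end

locale sl_limit_circle_frame = limit_circle a b p q w + sl_frame a b p q w u\<^sub>a v\<^sub>a u\<^sub>b v\<^sub>b
  for a b :: ereal and p q w :: "real \<Rightarrow> real" and u\<^sub>a v\<^sub>a u\<^sub>b v\<^sub>b :: "real \<Rightarrow> complex" +
  fixes lam\<^sub>0 :: real
  assumes frame: "frame lam\<^sub>0"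
begin

section \<open>The boundary maps of the given frame\<close>

lemma frame_solution:
  assumes "y \<in> {u\<^sub>a, v\<^sub>a, u\<^sub>b, v\<^sub>b}"
  shows "y \<in> max_dom" "\<And>x. x \<in> I \<Longrightarrow> cnj (y x) = y x"
proof -
  have "real_solution lam\<^sub>0 y"
    using frame assms unfolding frame_def principal_a_def principal_b_def non_principal_a_def non_principal_b_def by blast
  then show "y \<in> max_dom" "\<And>x. x \<in> I \<Longrightarrow> cnj (y x) = y x"
    unfolding real_solution_def by (auto intro: solution_in_max_dom simp: Reals_cnj_iff)
qed

lemma frame_max_dom: "u\<^sub>a \<in> max_dom" "v\<^sub>a \<in> max_dom" "u\<^sub>b \<in> max_dom" "v\<^sub>b \<in> max_dom"
  by (rule frame_solution; simp)+

text \<open>The frame functions are known to be real on \<open>I\<close> only; this suffices because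
  boundary limits depend only on values in \<open>I\<close>.\<close>

lemma W_cnj_frame:
  assumes y: "y \<in> {u\<^sub>a, v\<^sub>a, u\<^sub>b, v\<^sub>b}" and f: "f \<in> max_dom"
  shows "Wa f (\<lambda>x. cnj (y x)) = Wa f y" "Wb f (\<lambda>x. cnj (y x)) = Wb f y"
  using frame_solution [OF y] by (intro W_cong f; simp)+

lemma bracket_frame:
  assumes y: "y \<in> {u\<^sub>a, v\<^sub>a, u\<^sub>b, v\<^sub>b}" and f: "f \<in> max_dom"
  shows "bracket_a f y = Wa f y" "bracket_b f y = Wb f y"
  using bracket_a_eq bracket_b_eq max_domD(1) [OF frame_solution(1) [OF y]] W_cnj_frame [OF assms] by simp_all

lemma frame_normalised: "Wa u\<^sub>a v\<^sub>a = 1" "Wb u\<^sub>b v\<^sub>b = 1"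
  using frame bracket_frame(1) [of v\<^sub>a u\<^sub>a] bracket_frame(2) [of v\<^sub>b u\<^sub>b] frame_max_dom
  unfolding frame_def by simp_all

lemma W_frame_cnj:
  assumes y: "y \<in> {u\<^sub>a, v\<^sub>a, u\<^sub>b, v\<^sub>b}" and f: "f \<in> max_dom"
  shows "Wa (\<lambda>x. cnj (f x)) y = cnj (Wa f y)" "Wb (\<lambda>x. cnj (f x)) y = cnj (Wb f y)"
  using W_cnj [OF f frame_solution(1) [OF y]] W_cnj_frame [OF y max_dom_cnj [OF f]] by simp_all

lemma \<Gamma>_components:
  assumes "f \<in> max_dom"
  shows "\<Gamma>\<^sub>0 f $ 1 = Wa f v\<^sub>a" "\<Gamma>\<^sub>0 f $ 2 = Wb f v\<^sub>b" "\<Gamma>\<^sub>1 f $ 1 = - Wa f u\<^sub>a" "\<Gamma>\<^sub>1 f $ 2 = Wb f u\<^sub>b"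
  using bracket_frame [OF _ assms] by (simp_all add: \<Gamma>\<^sub>0_def \<Gamma>\<^sub>1_def)

lemma \<Gamma>_lincomb:
  assumes m: "f \<in> max_dom" "g \<in> max_dom"
  shows "\<Gamma>\<^sub>0 (\<lambda>x. c * f x + d * g x) $ i = c * \<Gamma>\<^sub>0 f $ i + d * \<Gamma>\<^sub>0 g $ i"
    "\<Gamma>\<^sub>1 (\<lambda>x. c * f x + d * g x) $ i = c * \<Gamma>\<^sub>1 f $ i + d * \<Gamma>\<^sub>1 g $ i"
  using exhaust_2 [of i]
  by (auto simp: \<Gamma>_components m max_dom_lincomb W_lincomb frame_max_dom algebra_simps)

lemma \<Gamma>_cnj:
  assumes m: "f \<in> max_dom"
  shows "\<Gamma>\<^sub>0 (\<lambda>x. cnj (f x)) $ i = cnj (\<Gamma>\<^sub>0 f $ i)" "\<Gamma>\<^sub>1 (\<lambda>x. cnj (f x)) $ i = cnj (\<Gamma>\<^sub>1 f $ i)"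
  using exhaust_2 [of i] by (auto simp: \<Gamma>_components m max_dom_cnj W_frame_cnj)

text \<open>Pluecker's identity with the normalised frame at each endpoint. The opposite signs in
  the two components of \<open>\<Gamma>\<^sub>1\<close> absorb the opposite signs of the boundary
  terms at \<open>a\<close> and \<open>b\<close>, so both contribute in the same form.\<close>

lemma bform_\<Gamma>:
  assumes f: "f \<in> max_dom" and g: "g \<in> max_dom"
  shows "bform f g = (\<Sum>i\<in>UNIV. \<Gamma>\<^sub>1 f $ i * cnj (\<Gamma>\<^sub>0 g $ i) - \<Gamma>\<^sub>0 f $ i * cnj (\<Gamma>\<^sub>1 g $ i))"
proof -
  let ?g = "\<lambda>x. cnj (g x)"
  have "Wa f ?g = Wa f u\<^sub>a * cnj (Wa g v\<^sub>a) - Wa f v\<^sub>a * cnj (Wa g u\<^sub>a)"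
    using W_pluecker(1) [OF f max_dom_cnj [OF g] frame_max_dom(1,2)] frame_normalised W_frame_cnj [OF _ g] by simp
  moreover have "Wb f ?g = Wb f u\<^sub>b * cnj (Wb g v\<^sub>b) - Wb f v\<^sub>b * cnj (Wb g u\<^sub>b)"
    using W_pluecker(2) [OF f max_dom_cnj [OF g] frame_max_dom(3,4)] frame_normalised W_frame_cnj [OF _ g] by simp
  ultimately show ?thesis by (simp add: bform_def sum_2 \<Gamma>_components f g algebra_simps)
qed

text \<open>Against a pair of Wronskian 1, two values at an endpoint fix all boundary values there;
  this moves prescribed values from \<open>\<phi>\<close>, \<open>\<psi>\<close> to the
  frame.\<close>

lemma W_determined:
  assumes f: "f \<in> max_dom" and e: "e \<in> max_dom" and \<phi>: "\<phi> \<in> max_dom" and \<psi>: "\<psi> \<in> max_dom" and g: "g \<in> max_dom"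
  shows "Wa \<phi> \<psi> = 1 \<Longrightarrow> Wa f \<phi> = Wa e \<phi> \<Longrightarrow> Wa f \<psi> = Wa e \<psi> \<Longrightarrow> Wa f g = Wa e g"
    "Wb \<phi> \<psi> = 1 \<Longrightarrow> Wb f \<phi> = Wb e \<phi> \<Longrightarrow> Wb f \<psi> = Wb e \<psi> \<Longrightarrow> Wb f g = Wb e g"
  using W_pluecker [OF f g \<phi> \<psi>] W_pluecker [OF e g \<phi> \<psi>] by simp_all

lemma \<Gamma>_surjective: "\<exists>f\<in>dmax. \<Gamma>\<^sub>0 f = x \<and> \<Gamma>\<^sub>1 f = y"
proof -
  obtain \<phi> \<psi> where s: "solution 0 \<phi>" "solution 0 \<psi>" "\<And>x. x \<in> I \<Longrightarrow> wronskian \<phi> \<psi> x = 1"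
    using solution_pair [of 0] by metis
  note m = solution_in_max_dom [OF s(1)] solution_in_max_dom [OF s(2)]
  define s2 where "s2 = - y $ 2"
  \<comment> \<open>Near \<open>a\<close> and near \<open>b\<close> the function sought should have
    the boundary values of these combinations; their coefficients are read off from the
    normalisation of the frame, with \<open>s2 = - y $ 2\<close> due to the sign convention of
    \<open>\<Gamma>\<^sub>1\<close>.\<close>
  let ?ea = "\<lambda>t. x $ 1 * u\<^sub>a t + y $ 1 * v\<^sub>a t" and ?eb = "\<lambda>t. x $ 2 * u\<^sub>b t + s2 * v\<^sub>b t"
  note F = frame_max_dom
  have e: "?ea \<in> max_dom" "?eb \<in> max_dom" by (intro max_dom_lincomb F)+
  obtain f where f: "f \<in> dmax" "Wa f \<phi> = Wa ?ea \<phi>" "Wa f \<psi> = Wa ?ea \<psi>" "Wb f \<phi> = Wb ?eb \<phi>" "Wb f \<psi> = Wb ?eb \<psi>"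
    using boundary_values_surjective [OF s] by blast
  have fm: "f \<in> max_dom" using f(1) by (simp add: dmax_iff)
  have fa: "Wa f g = Wa ?ea g" if "g \<in> max_dom" for g
    by (rule W_determined(1) [OF fm e(1) m that]) (use f W_solution_pair [OF s(3)] in auto)
  have fb: "Wb f g = Wb ?eb g" if "g \<in> max_dom" for g
    by (rule W_determined(2) [OF fm e(2) m that]) (use f W_solution_pair [OF s(3)] in auto)
  have self: "Wa g g = 0" "Wb g g = 0" if "g \<in> max_dom" for g
    using W_anti [OF that that] by simp_all
  have "Wa f v\<^sub>a = x $ 1" "Wa f u\<^sub>a = - y $ 1" "Wb f v\<^sub>b = x $ 2" "Wb f u\<^sub>b = - s2"
    using fa [OF F(2)] fa [OF F(1)] fb [OF F(4)] fb [OF F(3)]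
      W_lincomb(1) [OF F(1,2) F(2)] W_lincomb(1) [OF F(1,2) F(1)] W_lincomb(2) [OF F(3,4) F(4)] W_lincomb(2) [OF F(3,4) F(3)]
      W_anti(1) [OF F(1,2)] W_anti(2) [OF F(3,4)] self F frame_normalised by simp_all
  then have "\<Gamma>\<^sub>0 f $ i = x $ i \<and> \<Gamma>\<^sub>1 f $ i = y $ i" for i
    using exhaust_2 [of i] by (auto simp: \<Gamma>_components fm s2_def)
  then show ?thesis using f(1) by (intro bexI [of _ f]) (auto simp: vec_eq_iff)
qed

lemma left_values_zero:
  assumes f: "f \<in> max_dom" and g: "g \<in> max_dom" and "\<Gamma>\<^sub>0 f $ 1 = 0" "\<Gamma>\<^sub>1 f $ 1 = 0"
  shows "Wa f g = 0"
  using W_pluecker(1) [OF f g frame_max_dom(1,2)] frame_normalised assms(3,4) by (simp add: \<Gamma>_components f)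

lemma boundary_pair_0: "boundary_pair a b p q w \<Gamma>\<^sub>0 \<Gamma>\<^sub>1"
  by unfold_locales (simp_all add: \<Gamma>_lincomb \<Gamma>_cnj bform_\<Gamma> \<Gamma>_surjective left_values_zero)

text \<open>The exchange of \<open>(\<Gamma>\<^sub>0, \<Gamma>\<^sub>1)\<close> for
  \<open>(- \<Gamma>\<^sub>1, \<Gamma>\<^sub>0)\<close> is symplectic, so the boundary form keeps
  its shape.\<close>

lemma boundary_pair_1: "boundary_pair a b p q w (\<lambda>f. - \<Gamma>\<^sub>1 f) \<Gamma>\<^sub>0"
proof
  fix x y
  obtain f where "f \<in> dmax" "\<Gamma>\<^sub>0 f = y" "\<Gamma>\<^sub>1 f = - x" using \<Gamma>_surjective by blast
  then show "\<exists>f\<in>dmax. - \<Gamma>\<^sub>1 f = x \<and> \<Gamma>\<^sub>0 f = y" by (intro bexI [of _ f]) simp_all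
qed (simp_all add: \<Gamma>_lincomb \<Gamma>_cnj bform_\<Gamma> left_values_zero algebra_simps)

sublocale P0: boundary_pair a b p q w \<Gamma>\<^sub>0 \<Gamma>\<^sub>1
  by (rule boundary_pair_0)

sublocale P1: boundary_pair a b p q w "\<lambda>f. - \<Gamma>\<^sub>1 f" \<Gamma>\<^sub>0
  by (rule boundary_pair_1)

lemma ext_eq: "L_ext \<theta> = P0.ext \<theta>" "L_ext' \<theta> = P1.ext \<theta>"
  by (simp_all add: L_ext_def L_ext'_def P0.ext_def P1.ext_def)

lemma double_iff:
  "eig_mult (L_ext \<theta>) z = 2 \<longleftrightarrow> solution_space z \<subseteq> L_ext \<theta>"
  "eig_mult (L_ext' \<theta>) z = 2 \<longleftrightarrow> solution_space z \<subseteq> L_ext' \<theta>"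
  unfolding ext_eq
  by (rule double_eigenvalue_iff [OF P0.linear_domain_ext], rule double_eigenvalue_iff [OF P1.linear_domain_ext])

lemma injective_0:
  assumes "z \<in> resolvent_set L_0" "f \<in> solution_space z" "\<Gamma>\<^sub>0 f = 0"
  shows "f = (\<lambda>_. 0)"
  using assms P0.XY_zero zero_dmax(1) solution_space_dmax [OF assms(2)]
  by (intro resolvent_no_eigenvector [OF assms(1)]) (auto simp: L_0_def solution_space_def)

lemma injective_inf:
  assumes "z \<in> resolvent_set L_inf" "f \<in> solution_space z" "- \<Gamma>\<^sub>1 f = 0"
  shows "f = (\<lambda>_. 0)"
  using assms P0.XY_zero zero_dmax(1) solution_space_dmax [OF assms(2)]
  by (intro resolvent_no_eigenvector [OF assms(1)]) (auto simp: L_inf_def solution_space_def)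

text \<open>On a solution both boundary conditions hold, so \<open>\<theta>\<close> sends
  \<open>\<Gamma>\<^sub>0 f\<close> to \<open>\<Gamma>\<^sub>1 f\<close> and
  \<open>- \<theta>'\<close> sends it back. On the dual basis this says that
  \<open>- \<theta>'\<close> is a left inverse, and for square matrices a two-sided one.\<close>

lemma double_inverse:
  assumes L: "solution_space z \<subseteq> L_ext \<theta>" and L': "solution_space z \<subseteq> L_ext' \<theta>'"
  shows "invertible \<theta> \<and> invertible \<theta>' \<and> \<theta>' = - matrix_inv \<theta>"
proof -
  have L0: "solution_space z \<subseteq> P0.ext \<theta>" using L by (simp add: ext_eq)
  obtain F where F: "\<And>k. F k \<in> solution_space z" "\<And>k. \<Gamma>\<^sub>0 (F k) = axis k 1"
    using P0.solution_dual_basis [OF P0.double_injective [OF L0]] by metis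
  have "((- \<theta>') ** \<theta>) *v axis k 1 = axis k 1" for k
  proof -
    have 1: "\<theta> *v axis k 1 = \<Gamma>\<^sub>1 (F k)" using F L unfolding L_ext_def by force
    have 2: "\<theta>' *v (- \<Gamma>\<^sub>1 (F k)) = axis k 1" using F L' unfolding L_ext'_def by force
    have "((- \<theta>') ** \<theta>) *v axis k 1 = (- \<theta>') *v \<Gamma>\<^sub>1 (F k)" by (simp add: 1 flip: matrix_vector_mul_assoc)
    also have "\<dots> = \<theta>' *v (- \<Gamma>\<^sub>1 (F k))" by (simp add: vec_eq_iff matrix_vector_mult_def)
    finally show ?thesis using 2 by simp
  qed
  then have "((- \<theta>') ** \<theta>) $ i $ k = axis k 1 $ i" for i k
    using matrix_vector_mult_axis [of "(- \<theta>') ** \<theta>" k i] by simp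
  then have 1: "(- \<theta>') ** \<theta> = mat 1" by (simp add: vec_eq_iff mat_def axis_def)
  then have 2: "\<theta> ** (- \<theta>') = mat 1" using matrix_left_right_inverse by blast
  have inv: "invertible \<theta>" unfolding invertible_def using 1 2 by blast
  have "(- A) ** B = A ** (- B)" for A B :: "complex^2^2"
    by (simp add: vec_eq_iff matrix_matrix_mult_def)
  then have "\<theta>' ** (- \<theta>) = mat 1" using 1 by simp
  then have inv': "invertible \<theta>'" unfolding invertible_right_inverse by blast
  have "\<theta> ** matrix_inv \<theta> = mat 1 \<and> matrix_inv \<theta> ** \<theta> = mat 1"
    unfolding matrix_inv_def by (rule someI [of _ "- \<theta>'"]) (use 1 2 in blast)
  then have "- \<theta>' = matrix_inv \<theta>" using 1 by (metis matrix_mul_assoc matrix_mul_lid matrix_mul_rid)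
  then show ?thesis using inv inv' by (metis minus_minus)
qed

end

text \<open>Each existence claim is tied to its own resolvent set, which makes the corresponding
  boundary map injective on the solution space. If a nonzero solution has
  \<open>\<Gamma>\<^sub>1 f = 0\<close>, then \<open>\<theta>\<close> annihilates the nonzero vector
  \<open>\<Gamma>\<^sub>0 f\<close>; invertibility and the formula for the inverse are therefore
  asserted for a pair of matrices that both yield the double eigenvalue.\<close>

theorem corollary3p12:
  fixes a b :: ereal and p q w :: "real \<Rightarrow> real"
    and u\<^sub>a v\<^sub>a u\<^sub>b v\<^sub>b :: "real \<Rightarrow> complex"
    and lam\<^sub>0 K lam :: real
  defines "L \<equiv> sl_frame.L_ext a b p q w u\<^sub>a v\<^sub>a u\<^sub>b v\<^sub>b"
    and "L' \<equiv> sl_frame.L_ext' a b p q w u\<^sub>a v\<^sub>a u\<^sub>b v\<^sub>b"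
    and "\<rho>\<^sub>0 \<equiv> sl_expression.resolvent_set a b p q w (sl_frame.L_0 a b p q w v\<^sub>a v\<^sub>b)"
    and "\<rho>\<^sub>i\<^sub>n\<^sub>f \<equiv> sl_expression.resolvent_set a b p q w (sl_frame.L_inf a b p q w u\<^sub>a u\<^sub>b)"
    and "double \<equiv> \<lambda>D. sl_expression.eig_mult a b p q w D (complex_of_real lam) = 2"
    and "selfadj \<equiv> sl_expression.self_adjoint a b p q w"
  assumes "sl_expression.coefficients a b p q w"
    and "sl_expression.limit_circle_a a b p q w"
    and "sl_expression.limit_circle_b a b p q w"
    and "sl_expression.semibounded_below a b p q w (sl_expression.dmin a b p q w) K"
    and "sl_frame.frame a b p q w u\<^sub>a v\<^sub>a u\<^sub>b v\<^sub>b lam\<^sub>0"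
    and "K \<le> lam"
    and "complex_of_real lam \<in> \<rho>\<^sub>0 \<union> \<rho>\<^sub>i\<^sub>n\<^sub>f"
  shows
    "(complex_of_real lam \<in> \<rho>\<^sub>0 \<longrightarrow> (\<exists>!\<theta>. hermitian \<theta> \<and> double (L \<theta>))) \<and>
     (complex_of_real lam \<in> \<rho>\<^sub>i\<^sub>n\<^sub>f \<longrightarrow> (\<exists>!\<theta>'. hermitian \<theta>' \<and> double (L' \<theta>'))) \<and>
     (\<forall>\<theta>. hermitian \<theta> \<and> double (L \<theta>) \<longrightarrow>
        selfadj (L \<theta>) \<and> real_matrix \<theta> \<and> \<theta> $ 1 $ 2 \<noteq> 0 \<and> \<theta> $ 2 $ 1 \<noteq> 0) \<and>
     (\<forall>\<theta>'. hermitian \<theta>' \<and> double (L' \<theta>') \<longrightarrow>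
        selfadj (L' \<theta>') \<and> real_matrix \<theta>' \<and> \<theta>' $ 1 $ 2 \<noteq> 0 \<and> \<theta>' $ 2 $ 1 \<noteq> 0) \<and>
     (\<forall>\<theta> \<theta>'. hermitian \<theta> \<and> double (L \<theta>) \<and> hermitian \<theta>' \<and> double (L' \<theta>') \<longrightarrow>
        invertible \<theta> \<and> invertible \<theta>' \<and> \<theta>' = - matrix_inv \<theta>)"
proof -
  interpret sl_limit_circle_frame a b p q w u\<^sub>a v\<^sub>a u\<^sub>b v\<^sub>b lam\<^sub>0
    by unfold_locales (rule assms)+
  let ?z = "complex_of_real lam"
  have z: "?z \<in> \<real>" by simp
  have L: "double (L \<theta>) \<longleftrightarrow> solution_space ?z \<subseteq> P0.ext \<theta>" for \<theta>
    unfolding L_def double_def double_iff(1) by (simp only: ext_eq)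
  have L': "double (L' \<theta>) \<longleftrightarrow> solution_space ?z \<subseteq> P1.ext \<theta>" for \<theta>
    unfolding L'_def double_def double_iff(2) by (simp only: ext_eq)
  have "\<exists>!\<theta>. hermitian \<theta> \<and> double (L \<theta>)" if "?z \<in> \<rho>\<^sub>0"
  proof -
    have "\<exists>\<theta>. hermitian \<theta> \<and> solution_space ?z \<subseteq> P0.ext \<theta>"
    proof (rule P0.double_exists [OF _ z])
      fix f assume "f \<in> solution_space ?z" "\<Gamma>\<^sub>0 f = 0"
      then show "f = (\<lambda>_. 0)" using that unfolding \<rho>\<^sub>0_def by (intro injective_0 [of ?z])
    qed
    then obtain \<theta> where "hermitian \<theta>" "solution_space ?z \<subseteq> P0.ext \<theta>" by blast
    then show ?thesis unfolding L using P0.double_unique by (intro ex1I [of _ \<theta>]) blast+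
  qed
  moreover have "\<exists>!\<theta>'. hermitian \<theta>' \<and> double (L' \<theta>')" if "?z \<in> \<rho>\<^sub>i\<^sub>n\<^sub>f"
  proof -
    have "\<exists>\<theta>. hermitian \<theta> \<and> solution_space ?z \<subseteq> P1.ext \<theta>"
    proof (rule P1.double_exists [OF _ z])
      fix f assume "f \<in> solution_space ?z" "- \<Gamma>\<^sub>1 f = 0"
      then show "f = (\<lambda>_. 0)" using that unfolding \<rho>\<^sub>i\<^sub>n\<^sub>f_def by (intro injective_inf [of ?z])
    qed
    then obtain \<theta> where "hermitian \<theta>" "solution_space ?z \<subseteq> P1.ext \<theta>" by blast
    then show ?thesis unfolding L' using P1.double_unique by (intro ex1I [of _ \<theta>]) blast+
  qed
  moreover have "selfadj (L \<theta>) \<and> real_matrix \<theta> \<and> \<theta> $ 1 $ 2 \<noteq> 0 \<and> \<theta> $ 2 $ 1 \<noteq> 0"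
    if "hermitian \<theta>" "double (L \<theta>)" for \<theta>
    using P0.self_adjoint_ext [OF that(1)] P0.double_properties [OF that(1) _ z] that(2)
    unfolding L by (simp add: selfadj_def L_def ext_eq)
  moreover have "selfadj (L' \<theta>) \<and> real_matrix \<theta> \<and> \<theta> $ 1 $ 2 \<noteq> 0 \<and> \<theta> $ 2 $ 1 \<noteq> 0"
    if "hermitian \<theta>" "double (L' \<theta>)" for \<theta>
    using P1.self_adjoint_ext [OF that(1)] P1.double_properties [OF that(1) _ z] that(2)
    unfolding L' by (simp add: selfadj_def L'_def ext_eq)
  moreover have "invertible \<theta> \<and> invertible \<theta>' \<and> \<theta>' = - matrix_inv \<theta>"
    if "double (L \<theta>)" "double (L' \<theta>')" for \<theta> \<theta>'
    using double_inverse that unfolding L L' ext_eq by blast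
  ultimately show ?thesis by blast
qed

end
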